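(* Let $D\subset\mathbb R^2$ be a fixed domain with $C^1$ boundary, let $V,\gamma_{LG},\rho,g,\zeta>0$, and let $u^*\in C_0^2(D)$ satisfy $u^*\ge0$ and $\int_Du^*\,dx\,dy=V$. With $X_1$, $K$, $E$, $I_K$ and the resolvents $J_\tau^A,J_\tau^B$ as in the context, let $u_0=u^*+v_0$ with $v_0\in K$, and let $T>0$. For $t\in[0,T]$ let $$u(t)=e^{-t(\nabla E+\partial I_K)}u_0:=u^*+e^{-t(\nabla E+\partial I_K)}v_0$$ be the mild solution of the parabolic obstacle problem stated in the context, and let $$\bar u_\tau(t)=(J^B_\tau J^A_\tau)^{[t/\tau]}u_0,\qquad t\in[0,T],$$ be the numerical solution obtained from the projection method with time step $\tau$, where $[\cdot]$ denotes the integer part. Then $$\lim_{\tau\to0}\ \sup_{t\in[0,T]}\|\bar u_\tau(t)-u(t)\|=0,$$ where $\|\cdot\|$ is the $L^2(D)$ norm.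
   Context: Obstacle problem (droplet with pinned contact line $\partial D$, volume $V$): find $u(t)\in C_0(D)$ with $u(t)\ge0$, and $\lambda(t)\in\mathbb R$, such that $$\zeta\int_D\partial_tu\,(\tilde v-u)\,dx\,dy\ \ge\ \int_DF\,(\tilde v-u)\,dx\,dy\quad\text{for all }\tilde v\in C_0(D),\ \tilde v\ge0,\qquad \int_Du\,dx\,dy=V,$$ where $F=\gamma_{LG}\nabla\cdot\Big(\frac{\nabla u}{\sqrt{1+|\nabla u|^2}}\Big)-\rho gu+\lambda$. Hilbert space: $X_1=\{v\in L^2(D):\int_Dv\,dx\,dy=0\}$. Convex set: $K=\{v\in X_1:\ u^*+v\ge0\}$. Indicator functional: $I_K(v)=0$ if $v\in K$, $+\infty$ if $v\notin K$. Energy: $E:X_1\to[0,+\infty]$, $$E(v)=\gamma_{LG}\int_D\sqrt{1+|\nabla(v+u^* )|^2}\,dx\,dy+\rho g\int_D\frac{(v+u^* )^2}{2}\,dx\,dy,$$ regarded as a proper, convex, lower semicontinuous functional on $X_1$. Its subdifferential in $X_1$ is taken to be single-valued and equal to its Gâteaux derivative $$\nabla E(v)=-\gamma_{LG}\nabla\cdot\Big(\frac{\nabla(v+u^* )}{\sqrt{1+|\nabla(v+u^* )|^2}}\Big)+\rho g(v+u^* )-\lambda,$$ with $\lambda$ any real constant (constants are the zero element of $(X_1)'$); the corresponding evolution carries the boundary condition $v+u^*=0$ on $\partial D$. $\partial I_K$ is the subdifferential of $I_K$ in $X_1$. The operator $\nabla E+\partial I_K$ is regarded as a maximal monotone operator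 in $X_1$, and $e^{-t(\nabla E+\partial I_K)}$, $t\ge 0$, denotes the strongly continuous semigroup of contractions it generates (for $\partial_t v\in-(\nabla E+\partial I_K)(v)$). Projection method: with $A=\nabla E$, $B=\partial I_K$, set $J^A_\tau=(I+\tau\nabla E)^{-1}$ and $J^B_\tau=(I+\tau\,\partial I_K)^{-1}$. These are operators on $X_1$, applied to functions $u=u^*+v$, $v\in X_1$, by $Ju:=u^*+Jv$. Starting from $u^0=u_0$, one step consists of: (i) for $u^k=u^*+v^k$, $v^k\in K$, set $\tilde u^{k+1}=J^A_\tau u^k=u^*+\operatorname{argmin}_{v\in X_1}\Big\{E(v)+\frac{\|v-v^k\|^2}{2\tau}\Big\}$; (ii) find $u^{k+1}$ and $\lambda\in\mathbb R$ with $u^{k+1}=\max\{\tilde u^{k+1}+\lambda,0\}$ and $\int_Du^{k+1}\,dx\,dy=V$; equivalently $u^{k+1}=J^B_\tau\tilde u^{k+1}=u^*+\mathrm{Proj}_K(\tilde u^{k+1}-u^* )$. Thus $u^{k+1}=J^B_\tau J^A_\tau u^k$, and $\bar u_\tau$ is the piecewise constant interpolation $\bar u_\tau(t)=u^k$ for $t\in[k\tau,(k+1)\tau)$. *)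

theory Defs
  imports "HOL-Analysis.Analysis"
begin

section \<open>The Hilbert space of square-integrable functions on the plane\<close>

definition square_integrable :: "(real^2 \<Rightarrow> real) \<Rightarrow> bool" where
  "square_integrable f \<longleftrightarrow> f \<in> borel_measurable lborel \<and> integrable lborel (\<lambda>x. (f x)\<^sup>2)"

definition l2_rel :: "(real^2 \<Rightarrow> real) \<Rightarrow> (real^2 \<Rightarrow> real) \<Rightarrow> bool" where
  "l2_rel f g \<longleftrightarrow> square_integrable f \<and> square_integrable g \<and> (AE x in lborel. f x = g x)"

lemma square_integrable_prod:
  assumes "square_integrable f" "square_integrable g"
  shows "integrable lborel (\<lambda>x. f x * g x)"
proof (rule Bochner_Integration.integrable_bound)
  show "integrable lborel (\<lambda>x. (f x)\<^sup>2 + (g x)\<^sup>2)"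
    using assms by (auto simp: square_integrable_def)
  show "(\<lambda>x. f x * g x) \<in> borel_measurable lborel"
    using assms by (auto simp: square_integrable_def)
  have "\<bar>a * b\<bar> \<le> a\<^sup>2 + b\<^sup>2" for a b :: real
  proof -
    have "2 * \<bar>a * b\<bar> \<le> a\<^sup>2 + b\<^sup>2"
      using sum_squares_bound[of "\<bar>a\<bar>" "\<bar>b\<bar>"] by (simp add: mult.assoc abs_mult)
    moreover have "0 \<le> \<bar>a * b\<bar>" by (rule abs_ge_zero)
    ultimately show ?thesis by linarith
  qed
  then show "AE x in lborel. norm (f x * g x) \<le> norm ((f x)\<^sup>2 + (g x)\<^sup>2)"
    by (auto intro: order_trans)
qed

lemma square_integrable_zero: "square_integrable (\<lambda>x. 0)"
  by (simp add: square_integrable_def)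

lemma square_integrable_add:
  assumes "square_integrable f" "square_integrable g"
  shows "square_integrable (\<lambda>x. f x + g x)"
  using assms square_integrable_prod[OF assms]
  by (auto simp: square_integrable_def power2_sum mult.assoc)

lemma square_integrable_scale:
  assumes "square_integrable f"
  shows "square_integrable (\<lambda>x. c * f x)"
  using assms by (auto simp: square_integrable_def power_mult_distrib)

lemma square_integrable_uminus:
  assumes "square_integrable f"
  shows "square_integrable (\<lambda>x. - f x)"
  using square_integrable_scale[OF assms, of "-1"] by simp

lemma square_integrable_diff:
  assumes "square_integrable f" "square_integrable g"
  shows "square_integrable (\<lambda>x. f x - g x)"
  using square_integrable_add[OF assms(1) square_integrable_uminus[OF assms(2)]] by simp

quotient_type l2 = "real^2 \<Rightarrow> real" / partial: l2_rel
proof (rule part_equivpI)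
  show "\<exists>f. l2_rel f f"
    using square_integrable_zero by (auto simp: l2_rel_def)
  show "symp l2_rel"
    by (auto simp: l2_rel_def intro!: sympI)
  show "transp l2_rel"
    by (auto simp: l2_rel_def intro!: transpI)
qed

instantiation l2 :: real_inner
begin

lift_definition zero_l2 :: l2 is "\<lambda>x. 0"
  by (simp add: l2_rel_def square_integrable_zero)

lift_definition plus_l2 :: "l2 \<Rightarrow> l2 \<Rightarrow> l2" is "\<lambda>f g x. f x + g x"
  by (auto simp: l2_rel_def square_integrable_add)

lift_definition minus_l2 :: "l2 \<Rightarrow> l2 \<Rightarrow> l2" is "\<lambda>f g x. f x - g x"
  by (auto simp: l2_rel_def square_integrable_diff)

lift_definition uminus_l2 :: "l2 \<Rightarrow> l2" is "\<lambda>f x. - f x"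
  by (auto simp: l2_rel_def square_integrable_uminus)

lift_definition scaleR_l2 :: "real \<Rightarrow> l2 \<Rightarrow> l2" is "\<lambda>c f x. c * f x"
  by (auto simp: l2_rel_def square_integrable_scale)

lift_definition inner_l2 :: "l2 \<Rightarrow> l2 \<Rightarrow> real" is "\<lambda>f g. \<integral>x. f x * g x \<partial>lborel"
  by (rule integral_cong_AE) (auto simp: l2_rel_def square_integrable_def)

definition norm_l2 :: "l2 \<Rightarrow> real" where "norm_l2 f = sqrt (inner f f)"

definition dist_l2 :: "l2 \<Rightarrow> l2 \<Rightarrow> real" where "dist_l2 f g = norm (f - g)"

definition sgn_l2 :: "l2 \<Rightarrow> l2" where "sgn_l2 f = inverse (norm f) *\<^sub>R f"

definition uniformity_l2 :: "(l2 \<times> l2) filter" where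
  "uniformity_l2 = (INF e\<in>{0<..}. principal {(x, y). dist x y < e})"

definition open_l2 :: "l2 set \<Rightarrow> bool" where
  "open_l2 U = (\<forall>x\<in>U. eventually (\<lambda>(x', y). x' = x \<longrightarrow> y \<in> U) uniformity)"

instance
proof
  fix f g h :: l2 and a b :: real and U :: "l2 set"
  show "f + g + h = f + (g + h)"
    by transfer (auto simp: l2_rel_def square_integrable_add add.assoc)
  show "f + g = g + f"
    by transfer (auto simp: l2_rel_def square_integrable_add add.commute)
  show "0 + f = f"
    by transfer (auto simp: l2_rel_def)
  show "- f + f = 0"
    by transfer (auto simp: l2_rel_def square_integrable_zero)
  show "f - g = f + - g"
    by transfer (auto simp: l2_rel_def square_integrable_diff)
  show "a *\<^sub>R (f + g) = a *\<^sub>R f + a *\<^sub>R g"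
    by transfer (auto simp: l2_rel_def square_integrable_add square_integrable_scale distrib_left
      simp flip: distrib_left)
  show "(a + b) *\<^sub>R f = a *\<^sub>R f + b *\<^sub>R f"
    by transfer (auto simp: l2_rel_def square_integrable_scale distrib_right
      simp flip: distrib_right)
  show "a *\<^sub>R b *\<^sub>R f = (a * b) *\<^sub>R f"
    by transfer (auto simp: l2_rel_def square_integrable_scale simp flip: mult.assoc)
  show "1 *\<^sub>R f = f"
    by transfer (auto simp: l2_rel_def)
  show "inner f g = inner g f"
    by transfer (simp add: mult.commute)
  show "inner (f + g) h = inner f h + inner g h"
    by transfer (simp add: l2_rel_def distrib_right square_integrable_prod)
  show "inner (a *\<^sub>R f) g = a * inner f g"
    by transfer (simp add: mult.assoc)
  show "0 \<le> inner f f"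
    by transfer simp
  show "inner f f = 0 \<longleftrightarrow> f = 0"
  proof (transfer, goal_cases)
    case (1 f)
    then have "integrable lborel (\<lambda>x. f x * f x)"
      by (simp add: l2_rel_def square_integrable_prod)
    then have "(\<integral>x. f x * f x \<partial>lborel) = 0 \<longleftrightarrow> (AE x in lborel. f x * f x = 0)"
      by (intro integral_nonneg_eq_0_iff_AE) auto
    with 1 show ?case
      by (simp add: l2_rel_def square_integrable_zero)
  qed
  show "norm f = sqrt (inner f f)" by (rule norm_l2_def)
  show "dist f g = norm (f - g)" by (rule dist_l2_def)
  show "sgn f = inverse (norm f) *\<^sub>R f" by (rule sgn_l2_def)
  show "(uniformity :: (l2 \<times> l2) filter) = (INF e\<in>{0<..}. principal {(x, y). dist x y < e})"
    by (rule uniformity_l2_def)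
  show "open U = (\<forall>x\<in>U. eventually (\<lambda>(x', y). x' = x \<longrightarrow> y \<in> U) uniformity)"
    by (rule open_l2_def)
qed

end

text \<open>
  \<open>L\<^sup>2(D)\<close> is the subspace of those classes that vanish almost everywhere outside \<open>D\<close>, so the norm of
  type \<^typ>\<open>l2\<close> restricts to the \<open>L\<^sup>2(D)\<close> norm.  All conditions below are stated for the
  representative \<^const>\<open>rep_l2\<close>; for measurable \<open>D\<close> they do not depend on its choice.
\<close>

definition L2_on :: "(real^2) set \<Rightarrow> l2 set" where
  "L2_on D = {f. AE x in lborel. x \<notin> D \<longrightarrow> rep_l2 f x = 0}"

definition L2_of :: "(real^2) set \<Rightarrow> (real^2 \<Rightarrow> real) \<Rightarrow> l2" where
  "L2_of D \<phi> = abs_l2 (\<lambda>x. indicator D x * \<phi> x)"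


section \<open>Smooth functions and domains with smooth boundary\<close>

definition gradient :: "('a::real_inner \<Rightarrow> real) \<Rightarrow> 'a \<Rightarrow> 'a" where
  "gradient f x = (THE d. GDERIV f x :> d)"

definition C1_on :: "(real^2) set \<Rightarrow> (real^2 \<Rightarrow> real) \<Rightarrow> bool" where
  "C1_on U f \<longleftrightarrow> (\<forall>x\<in>U. f differentiable (at x)) \<and> continuous_on U (gradient f)"

definition C2_on :: "(real^2) set \<Rightarrow> (real^2 \<Rightarrow> real) \<Rightarrow> bool" where
  "C2_on U f \<longleftrightarrow> C1_on U f \<and> (\<forall>i. C1_on U (\<lambda>x. gradient f x $ i))"

text \<open>
  Continuous functions on the open set \<open>D\<close> that vanish at its boundary (and at infinity, if \<open>D\<close>
  is unbounded).  For bounded \<open>D\<close> these are the restrictions of the continuous functions on the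
  closure of \<open>D\<close> that are zero on the frontier.
\<close>

definition C0 :: "(real^2) set \<Rightarrow> (real^2 \<Rightarrow> real) set" where
  "C0 D = {f. continuous_on D f \<and> (\<forall>e>0. compact {x\<in>D. e \<le> \<bar>f x\<bar>})}"

text \<open>The boundary is locally the regular zero set of a \<open>C\<^sup>1\<close> function, with \<open>D\<close> on one side of it.\<close>

definition C1_boundary :: "(real^2) set \<Rightarrow> bool" where
  "C1_boundary D \<longleftrightarrow> (\<forall>p\<in>frontier D. \<exists>U \<phi>. open U \<and> p \<in> U \<and> C1_on U \<phi> \<and>
     (\<forall>x\<in>U. gradient \<phi> x \<noteq> 0) \<and> D \<inter> U = {x\<in>U. \<phi> x < 0})"


section \<open>Set-valued operators, resolvents, semigroups\<close>

definition op_sum :: "('a::real_inner \<Rightarrow> 'a set) \<Rightarrow> ('a \<Rightarrow> 'a set) \<Rightarrow> 'a \<Rightarrow> 'a set" where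
  "op_sum A B v = {a + b | a b. a \<in> A v \<and> b \<in> B v}"

text \<open>\<open>(I + \<tau> A)\<^sup>-\<^sup>1\<close>\<close>

definition resolvent :: "('a::real_inner \<Rightarrow> 'a set) \<Rightarrow> real \<Rightarrow> 'a \<Rightarrow> 'a" where
  "resolvent A \<tau> x = (THE y. \<exists>a\<in>A y. x = y + \<tau> *\<^sub>R a)"

text \<open>The subdifferential of \<open>\<phi>\<close> in the Hilbert space \<open>X\<close>, where \<open>X\<close> is a subspace of the ambient type.\<close>

definition subdifferential :: "'a::real_inner set \<Rightarrow> ('a \<Rightarrow> ereal) \<Rightarrow> 'a \<Rightarrow> 'a set" where
  "subdifferential X \<phi> v =
     {p. v \<in> X \<and> p \<in> X \<and> \<bar>\<phi> v\<bar> \<noteq> \<infinity> \<and> (\<forall>w\<in>X. \<phi> v + ereal (p \<bullet> (w - v)) \<le> \<phi> w)}"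

definition convex_indicator :: "'a set \<Rightarrow> 'a \<Rightarrow> ereal" where
  "convex_indicator K v = (if v \<in> K then 0 else \<infinity>)"

text \<open>
  \<open>S\<close> is the strongly continuous semigroup of contractions generated by \<open>C\<close>, i.e. for
  \<open>v' \<in> - C(v)\<close>.  It lives on the closure of the domain of \<open>C\<close>; for initial data \<open>v\<close> in the domain
  the trajectory is a strong solution (for maximal monotone \<open>C\<close> it is differentiable from the
  right at every time), for the remaining \<open>v\<close> it is the limit of strong solutions.
\<close>

definition generates_semigroup ::
    "('a::real_inner \<Rightarrow> 'a set) \<Rightarrow> (real \<Rightarrow> 'a \<Rightarrow> 'a) \<Rightarrow> bool" where
  "generates_semigroup C S \<longleftrightarrow>
     (let dom = {v. C v \<noteq> {}}; Q = closure dom in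
        (\<forall>t\<ge>0. \<forall>v\<in>Q. S t v \<in> Q) \<and>
        (\<forall>v\<in>Q. S 0 v = v) \<and>
        (\<forall>s\<ge>0. \<forall>t\<ge>0. \<forall>v\<in>Q. S (s + t) v = S s (S t v)) \<and>
        (\<forall>t\<ge>0. \<forall>v\<in>Q. \<forall>w\<in>Q. norm (S t v - S t w) \<le> norm (v - w)) \<and>
        (\<forall>v\<in>Q. continuous_on {0..} (\<lambda>t. S t v)) \<and>
        (\<forall>v\<in>dom. \<forall>t\<ge>0. \<exists>c\<in>C (S t v). ((\<lambda>s. S s v) has_vector_derivative - c) (at_right t)))"


section \<open>The energy of the droplet and the constraint\<close>

definition X1 :: "(real^2) set \<Rightarrow> l2 set" where
  "X1 D = {v \<in> L2_on D. (LINT x:D|lborel. rep_l2 v x) = 0}"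

definition constraint_set :: "(real^2) set \<Rightarrow> (real^2 \<Rightarrow> real) \<Rightarrow> l2 set" where
  "constraint_set D ustar = {v \<in> X1 D. AE x in lborel. x \<in> D \<longrightarrow> 0 \<le> rep_l2 (L2_of D ustar + v) x}"

text \<open>
  The area of the graph of \<open>w\<close> is given by the integral formula for \<open>C\<^sup>1\<close> functions with zero
  boundary values, and extended to \<open>L\<^sup>2(D)\<close> as a lower semicontinuous functional in the usual way:
  set it to infinity on all other classes and take the lower semicontinuous envelope
  \<open>liminf\<^bsub>z \<rightarrow> w\<^esub>\<close>.  The Dirichlet condition is part of the class over which one relaxes.
\<close>

definition smooth_area :: "(real^2) set \<Rightarrow> l2 \<Rightarrow> ennreal" where
  "smooth_area D w =
     (INF \<phi>\<in>{\<phi> \<in> C0 D. C1_on D \<phi> \<and> w = L2_of D \<phi>}.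
        \<integral>\<^sup>+x\<in>D. ennreal (sqrt (1 + (norm (gradient \<phi> x))\<^sup>2)) \<partial>lborel)"

definition area :: "(real^2) set \<Rightarrow> l2 \<Rightarrow> ennreal" where
  "area D w = Liminf (nhds w) (smooth_area D)"

text \<open>On \<open>L\<^sup>2(D)\<close> the squared norm is the integral of the square over \<open>D\<close>.\<close>

definition energy ::
    "(real^2) set \<Rightarrow> real \<Rightarrow> real \<Rightarrow> real \<Rightarrow> (real^2 \<Rightarrow> real) \<Rightarrow> l2 \<Rightarrow> ereal" where
  "energy D \<gamma>LG \<rho> g ustar v =
     ereal \<gamma>LG * enn2ereal (area D (v + L2_of D ustar))
     + ereal (\<rho> * g * (norm (v + L2_of D ustar))\<^sup>2 / 2)"

text \<open>
  \<open>\<nabla>E\<close> is the subdifferential of the energy in \<open>X\<^sub>1\<close>; its values have zero mean, which fixes the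
  free constant \<open>\<lambda>\<close> in the formula for the derivative.
\<close>

definition grad_E ::
    "(real^2) set \<Rightarrow> real \<Rightarrow> real \<Rightarrow> real \<Rightarrow> (real^2 \<Rightarrow> real) \<Rightarrow> l2 \<Rightarrow> l2 set" where
  "grad_E D \<gamma>LG \<rho> g ustar = subdifferential (X1 D) (energy D \<gamma>LG \<rho> g ustar)"

definition sub_IK :: "(real^2) set \<Rightarrow> (real^2 \<Rightarrow> real) \<Rightarrow> l2 \<Rightarrow> l2 set" where
  "sub_IK D ustar = subdifferential (X1 D) (convex_indicator (constraint_set D ustar))"


section \<open>The projection method\<close>

text \<open>An operator \<open>J\<close> on \<open>X\<^sub>1\<close> acts on \<open>u = u\<^sup>* + v\<close> by \<open>J u = u\<^sup>* + J v\<close>.\<close>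

definition shifted :: "'a::real_inner \<Rightarrow> ('a \<Rightarrow> 'a) \<Rightarrow> 'a \<Rightarrow> 'a" where
  "shifted c J u = c + J (u - c)"

definition JA ::
    "(real^2) set \<Rightarrow> real \<Rightarrow> real \<Rightarrow> real \<Rightarrow> (real^2 \<Rightarrow> real) \<Rightarrow> real \<Rightarrow> l2 \<Rightarrow> l2" where
  "JA D \<gamma>LG \<rho> g ustar \<tau> = shifted (L2_of D ustar) (resolvent (grad_E D \<gamma>LG \<rho> g ustar) \<tau>)"

definition JB :: "(real^2) set \<Rightarrow> (real^2 \<Rightarrow> real) \<Rightarrow> real \<Rightarrow> l2 \<Rightarrow> l2" where
  "JB D ustar \<tau> = shifted (L2_of D ustar) (resolvent (sub_IK D ustar) \<tau>)"

definition ubar ::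
    "(real^2) set \<Rightarrow> real \<Rightarrow> real \<Rightarrow> real \<Rightarrow> (real^2 \<Rightarrow> real) \<Rightarrow> l2 \<Rightarrow> real \<Rightarrow> real \<Rightarrow> l2" where
  "ubar D \<gamma>LG \<rho> g ustar u0 \<tau> t =
     ((JB D ustar \<tau> \<circ> JA D \<gamma>LG \<rho> g ustar \<tau>) ^^ nat \<lfloor>t / \<tau>\<rfloor>) u0"

end

theory Submission
  imports Defs
begin

text \<open>
  The proof is a nonlinear Chernoff-Trotter argument that uses only the convexity of the energy.
  One step \<open>F \<tau>\<close> of the projection method is a contraction, and so is one step \<open>G \<mu> \<tau>\<close> of the implicit
  Euler scheme, with step size \<open>\<mu>\<close>, for the operator \<open>(I - F \<tau>) / \<tau>\<close>.  For initial data in the domain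
  of \<open>\<nabla>E\<close>, Kobayashi's estimate bounds the distance of \<open>(F \<tau>)\<^sup>n v\<close> from \<open>(G \<mu> \<tau>)\<^sup>j v\<close> uniformly in \<open>\<tau>\<close>; as \<open>\<tau>\<close>
  tends to zero with \<open>\<mu>\<close> fixed, \<open>G \<mu> \<tau>\<close> converges to the resolvent of \<open>\<partial>(E + I\<^sub>K)\<close>, because penalised
  near-minimisers of \<open>E\<close> in shrinking neighbourhoods of \<open>K\<close> converge by strong convexity; and the
  iterated resolvents are compared with the semigroup by differentiating the squared distance.
  Arbitrary initial data in \<open>K\<close> are reached because the domain of \<open>\<nabla>E\<close> is dense there: for every
  nonnegative \<open>C\<^sup>2\<close> function \<open>\<psi>\<close> with compact support in \<open>D\<close> and volume \<open>V\<close>, integration by parts turns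
  the curvature into a subgradient of the relaxed area at \<open>\<psi>\<close>, and such functions are dense because
  polynomial expressions in bumps on balls approximate indicators of open sets.
\<close>

section \<open>Resolvents of convex functionals\<close>


text \<open>Two operators have to be kept apart. The semigroup is generated by the sum \<nabla>E +
  \<partial>I_K, whereas the Euler steps converge to the resolvent of \<partial>(E + I_K). The sum
  is contained in the latter by adding inequalities. So the trajectory supplies elements of the sum,
  the resolvents exist everywhere by minimisation, and the two meet through monotonicity of the
  larger operator. In the limit of small \<tau> no single point carries all bounds: the Euler step z
  lies in K without control of its energy, the half step \<open>J \<tau> z\<close> has controlled
  energy but lies outside K. Their distance is of order sqrt \<tau>, and strong convexity takes the
  place of weak compactness in passing to the limit. Kobayashi's recursion starts from a
  displacement bound of order \<tau> at the initial value. A subgradient of E alone at v in K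
  provides it, because the projection fixes v. Hence density is proved for points where E itself has
  a subgradient, which is what calls for the curvature of smooth functions.\<close>

definition subgrad :: "'a::real_inner set \<Rightarrow> 'a set \<Rightarrow> ('a \<Rightarrow> real) \<Rightarrow> 'a \<Rightarrow> 'a set" where
  "subgrad X Y e v = {p. v \<in> Y \<and> p \<in> X \<and> (\<forall>w\<in>Y. e v + p \<bullet> (w - v) \<le> e w)}"

text \<open>The last term, the defect of convexity, is the source of every uniqueness and Cauchy
  argument for minimisers below.\<close>

lemma norm_convex_comb:
  fixes a b :: "'a::real_inner"
  shows "(norm ((1 - t) *\<^sub>R a + t *\<^sub>R b))\<^sup>2 =
    (1 - t) * (norm a)\<^sup>2 + t * (norm b)\<^sup>2 - t * (1 - t) * (norm (a - b))\<^sup>2"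
  unfolding power2_norm_eq_inner inner_add_left inner_add_right inner_diff_left inner_diff_right
    inner_scaleR_left inner_scaleR_right inner_commute[of b a]
  by (simp add: algebra_simps)

text \<open>The real function e stands for +\<infinity> outside Y, so the last axiom must also
  deliver x \<in> Y; the bounds c n replace a liminf. For e = 0 the axiom says that Y is closed, so
  indicator functionals are instances too.\<close>

locale closed_convex_fun =
  fixes X Y :: "'a::real_inner set" and e :: "'a \<Rightarrow> real"
  assumes subspace: "subspace X" and complete: "complete X"
    and dom_subset: "Y \<subseteq> X" and dom_ne: "Y \<noteq> {}"
    and convex_dom: "convex Y"
    and convex: "\<And>t x y. \<lbrakk>0 \<le> t; t \<le> 1; x \<in> Y; y \<in> Y\<rbrakk> \<Longrightarrow>
        e ((1 - t) *\<^sub>R x + t *\<^sub>R y) \<le> (1 - t) * e x + t * e y"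
    and nonneg: "\<And>x. x \<in> Y \<Longrightarrow> 0 \<le> e x"
    and lsc: "\<And>xs x c C. \<lbrakk>\<And>n. xs n \<in> Y; xs \<longlonglongrightarrow> x; \<And>n::nat. e (xs n) \<le> c n; c \<longlonglongrightarrow> C\<rbrakk> \<Longrightarrow>
        x \<in> Y \<and> e x \<le> C"
begin

text \<open>This is 2\<mu> times the Moreau-Yosida functional e w + |x - w|^2 / (2\<mu>); the
  scaling gives the quadratic term coefficient one.\<close>

definition penal :: "real \<Rightarrow> 'a \<Rightarrow> 'a \<Rightarrow> real" where
  "penal \<mu> x w = (norm (x - w))\<^sup>2 + 2 * \<mu> * e w"

abbreviation J :: "real \<Rightarrow> 'a \<Rightarrow> 'a" where
  "J \<equiv> resolvent (subgrad X Y e)"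

lemma penal_strongly_convex:
  assumes "0 < \<mu>" "0 \<le> t" "t \<le> 1" "a \<in> Y" "b \<in> Y"
  shows "penal \<mu> x ((1 - t) *\<^sub>R a + t *\<^sub>R b) \<le>
    (1 - t) * penal \<mu> x a + t * penal \<mu> x b - t * (1 - t) * (norm (a - b))\<^sup>2"
proof -
  have "x - ((1 - t) *\<^sub>R a + t *\<^sub>R b) = (1 - t) *\<^sub>R (x - a) + t *\<^sub>R (x - b)"
    by (simp add: algebra_simps)
  then have "(norm (x - ((1 - t) *\<^sub>R a + t *\<^sub>R b)))\<^sup>2 =
    (1 - t) * (norm (x - a))\<^sup>2 + t * (norm (x - b))\<^sup>2 - t * (1 - t) * (norm (a - b))\<^sup>2"
    by (simp only: norm_convex_comb) (simp add: norm_minus_commute)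
  moreover have "2 * \<mu> * e ((1 - t) *\<^sub>R a + t *\<^sub>R b) \<le> 2 * \<mu> * ((1 - t) * e a + t * e b)"
    using convex[OF assms(2-5)] assms(1) by (intro mult_left_mono) auto
  ultimately show ?thesis unfolding penal_def by (simp add: algebra_simps)
qed

lemma penal_nonneg: "0 < \<mu> \<Longrightarrow> w \<in> Y \<Longrightarrow> 0 \<le> penal \<mu> x w"
  unfolding penal_def using nonneg by simp

text \<open>The infima over the decreasing convex sets increase to a limit at most B, and strong
  convexity bounds the distance of near-minimisers by the remaining gap, so they form a Cauchy
  sequence. With constant sets this yields minimisers; with shrinking neighbourhoods of K it yields
  a point of K.\<close>

lemma nested_minimum:
  assumes lam: "0 < \<mu>" and cA: "\<And>n. convex (A n)" and dec: "decseq A"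
    and ex: "\<And>n::nat. \<exists>y\<in>A n \<inter> Y. penal \<mu> x y \<le> B + inverse (real (Suc n))"
  obtains w ws where "w \<in> Y" "penal \<mu> x w \<le> B" "ws \<longlonglongrightarrow> w" "\<And>n. ws n \<in> A n"
proof -
  define P where "P = penal \<mu> x"
  define i where "i n = Inf (P ` (A n \<inter> Y))" for n
  define r where "r n = inverse (real (Suc n))" for n
  have r0: "r \<longlonglongrightarrow> 0" unfolding r_def by (rule LIMSEQ_inverse_real_of_nat)
  have rpos: "0 < r n" for n unfolding r_def by simp
  have ne: "A n \<inter> Y \<noteq> {}" for n using ex[of n] by blast
  have bdd: "bdd_below (P ` (A n \<inter> Y))" for n
    using penal_nonneg[OF lam] unfolding P_def by (intro bdd_belowI2[where m=0]) auto
  have i_le: "i n \<le> P y" if "y \<in> A n" "y \<in> Y" for n y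
    unfolding i_def using that by (intro cInf_lower bdd) auto
  have i_B: "i n \<le> B + r n" for n
    using ex[of n] i_le[of _ n] unfolding P_def r_def by fastforce
  have i_mono: "incseq i"
  proof (rule incseq_SucI)
    fix n
    have "A (Suc n) \<subseteq> A n" using dec by (simp add: decseq_SucD)
    then show "i n \<le> i (Suc n)"
      unfolding i_def using bdd ne by (intro cInf_superset_mono) auto
  qed
  have "i n \<le> B + 1" for n using i_B[of n] unfolding r_def by (smt (verit) inverse_le_1_iff of_nat_Suc of_nat_0_le_iff)
  then obtain l where l: "i \<longlonglongrightarrow> l"
    using incseq_convergent[OF i_mono, of "B + 1"] by blast
  have il: "i n \<le> l" for n using incseq_le[OF i_mono l] .
  have lB: "l \<le> B"
  proof (rule LIMSEQ_le[OF l])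
    show "(\<lambda>n. B + r n) \<longlonglongrightarrow> B" using tendsto_add[OF tendsto_const r0, of B] by simp
  qed (use i_B in auto)
  have "\<exists>w\<in>A n \<inter> Y. P w < i n + r n" for n
    using cInf_lessD[of "P ` (A n \<inter> Y)" "i n + r n"] ne[of n] rpos[of n] unfolding i_def by auto
  then obtain ws where ws: "\<And>n. ws n \<in> A n" "\<And>n. ws n \<in> Y" "\<And>n. P (ws n) < i n + r n"
    by (metis IntD1 IntD2)
  have est: "(norm (ws n - ws k))\<^sup>2 \<le> 4 * (l - i n) + 4 * r n + 4 * r k" if "n \<le> k" for n k
  proof -
    \<comment> \<open>The midpoint stays in the larger set \<open>A n\<close>, so its value is at
      least \<open>i n\<close>; the defect of convexity then bounds the distance of the two
      points.\<close>
    let ?m = "(1 - 1/2) *\<^sub>R ws n + (1/2::real) *\<^sub>R ws k"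
    have "ws k \<in> A n" using decseqD[OF dec that] ws(1) by blast
    then have "?m \<in> A n" using ws(1)[of n] by (intro convexD_alt[OF cA]) auto
    moreover have "?m \<in> Y" using ws(2) by (intro convexD_alt[OF convex_dom]) auto
    ultimately have "i n \<le> P ?m" by (rule i_le)
    also have "\<dots> \<le> (1 - 1/2) * P (ws n) + (1/2) * P (ws k) - (1/2) * (1 - 1/2) * (norm (ws n - ws k))\<^sup>2"
      unfolding P_def using ws(2) lam by (intro penal_strongly_convex) auto
    finally show ?thesis
      using ws(3)[of n] ws(3)[of k] il[of k] il[of n] rpos[of n] rpos[of k] by simp
  qed
  have "Cauchy ws"
  proof (rule metric_CauchyI)
    fix \<epsilon> :: real assume e: "0 < \<epsilon>"
    have "(\<lambda>n. 4 * (l - i n) + 4 * r n) \<longlonglongrightarrow> 4 * (l - l) + 4 * 0"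
      by (intro tendsto_intros l r0)
    then have "eventually (\<lambda>n. 4 * (l - i n) + 4 * r n < \<epsilon>\<^sup>2 / 2) sequentially"
      using e by (intro order_tendstoD(2)) auto
    moreover have "eventually (\<lambda>n. 4 * r n < \<epsilon>\<^sup>2 / 2) sequentially"
      using e order_tendstoD(2)[OF tendsto_mult_right_zero[OF r0, of 4], of "\<epsilon>\<^sup>2 / 2"] by simp
    ultimately have "eventually (\<lambda>n. 4 * (l - i n) + 4 * r n < \<epsilon>\<^sup>2 / 2 \<and> 4 * r n < \<epsilon>\<^sup>2 / 2) sequentially"
      by eventually_elim auto
    then obtain N where N: "\<And>n. n \<ge> N \<Longrightarrow> 4 * (l - i n) + 4 * r n < \<epsilon>\<^sup>2 / 2 \<and> 4 * r n < \<epsilon>\<^sup>2 / 2"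
      unfolding eventually_sequentially by blast
    have lt: "norm (ws n - ws k) < \<epsilon>" if "N \<le> n" "n \<le> k" for n k
    proof (rule power_less_imp_less_base[of _ 2])
      show "(norm (ws n - ws k))\<^sup>2 < \<epsilon>\<^sup>2" using est[OF that(2)] N[of n] N[of k] that by auto
    qed (use e in simp)
    show "\<exists>M. \<forall>m\<ge>M. \<forall>n\<ge>M. dist (ws m) (ws n) < \<epsilon>"
    proof (intro exI allI impI)
      fix m n assume "N \<le> m" "N \<le> n"
      then show "dist (ws m) (ws n) < \<epsilon>"
        using lt[of m n] lt[of n m] by (cases "m \<le> n") (auto simp: dist_norm norm_minus_commute)
    qed
  qed
  then obtain w where w: "ws \<longlonglongrightarrow> w"
    using complete ws(2) dom_subset unfolding complete_def by blast
  \<comment> \<open>Lower semicontinuity is available for e only, so the bound on the penalised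
    value is solved for e; the quadratic part converges.\<close>
  have c: "(\<lambda>n. (i n + r n - (norm (x - ws n))\<^sup>2) / (2 * \<mu>)) \<longlonglongrightarrow> (l + 0 - (norm (x - w))\<^sup>2) / (2 * \<mu>)"
    using lam by (intro tendsto_intros l r0 w) auto
  have "e (ws n) \<le> (i n + r n - (norm (x - ws n))\<^sup>2) / (2 * \<mu>)" for n
    using ws(3)[of n] lam unfolding P_def penal_def by (simp add: field_simps)
  from lsc[OF ws(2) w this c] have w2: "w \<in> Y" "e w \<le> (l + 0 - (norm (x - w))\<^sup>2) / (2 * \<mu>)" by auto
  then have "penal \<mu> x w \<le> l" using lam unfolding penal_def by (simp add: field_simps)
  then show ?thesis using that[of w ws] w2(1) w ws(1) lB by simp
qed

text \<open>Expanding |x - w|^2 about y turns the subgradient inequality for (x - y) / \<mu> into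
  minimality with quadratic growth. The growth term makes the resolvent single-valued and is summed
  in the energy estimates later.\<close>

lemma subgrad_iff_variational:
  assumes "0 < \<mu>" "x \<in> X"
  shows "(\<exists>a\<in>subgrad X Y e y. x = y + \<mu> *\<^sub>R a) \<longleftrightarrow>
    y \<in> Y \<and> (\<forall>w\<in>Y. (norm (y - w))\<^sup>2 + penal \<mu> x y \<le> penal \<mu> x w)"
proof -
  have id: "(norm (x - w))\<^sup>2 = (norm (x - y))\<^sup>2 + (norm (y - w))\<^sup>2 - 2 * ((x - y) \<bullet> (w - y))" for w
    by (simp add: power2_norm_eq_inner inner_diff_left inner_diff_right inner_commute)
  have eq: "((norm (y - w))\<^sup>2 + penal \<mu> x y \<le> penal \<mu> x w) \<longleftrightarrow>
      e y + (inverse \<mu> *\<^sub>R (x - y)) \<bullet> (w - y) \<le> e w" for w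
  proof -
    have "(2 * \<mu> * r + 2 * d \<le> 2 * \<mu> * s) \<longleftrightarrow> r + inverse \<mu> * d \<le> s" for r s d :: real
    proof -
      have d: "2 * d = 2 * \<mu> * (inverse \<mu> * d)" using assms(1) by simp
      show ?thesis unfolding d distrib_left[symmetric] using assms(1) by simp
    qed
    from this[of "e y" "(x - y) \<bullet> (w - y)" "e w"] show ?thesis
      unfolding penal_def id[of w] inner_scaleR_left by (simp add: algebra_simps)
  qed
  show ?thesis (is "?l = ?r")
  proof
    assume ?l
    then obtain a where a: "a \<in> subgrad X Y e y" "x = y + \<mu> *\<^sub>R a" by blast
    then have "a = inverse \<mu> *\<^sub>R (x - y)" using assms by simp
    then show ?r using a(1) unfolding eq subgrad_def by auto
  next
    assume r: ?r
    have "y \<in> X" using r dom_subset by blast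
    then have "inverse \<mu> *\<^sub>R (x - y) \<in> X"
      using subspace assms by (simp add: subspace_diff subspace_scale)
    then have "inverse \<mu> *\<^sub>R (x - y) \<in> subgrad X Y e y" using r unfolding eq subgrad_def by auto
    then show ?l using assms by (intro bexI[where x="inverse \<mu> *\<^sub>R (x - y)"]) auto
  qed
qed

lemma minimizer_exists:
  assumes lam: "0 < \<mu>"
  obtains y where "y \<in> Y" "\<And>w. w \<in> Y \<Longrightarrow> (norm (y - w))\<^sup>2 + penal \<mu> x y \<le> penal \<mu> x w"
proof -
  define B where "B = Inf (penal \<mu> x ` Y)"
  have bdd: "bdd_below (penal \<mu> x ` Y)"
    using penal_nonneg[OF lam] by (intro bdd_belowI2[where m=0]) auto
  have "\<exists>y\<in>X \<inter> Y. penal \<mu> x y \<le> B + inverse (real (Suc n))" for n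
    using cInf_lessD[of "penal \<mu> x ` Y" "B + inverse (real (Suc n))"] dom_ne dom_subset
    unfolding B_def by (auto intro: less_imp_le)
  then obtain y ws where y: "y \<in> Y" "penal \<mu> x y \<le> B"
    using nested_minimum[OF lam subspace_imp_convex[OF subspace], of x B]
    unfolding decseq_def by (metis order_refl)
  have "(norm (y - w))\<^sup>2 + penal \<mu> x y \<le> penal \<mu> x w" if w: "w \<in> Y" for w
  proof -
    \<comment> \<open>Minimality is tested on the segment from y to w; dividing by t and letting t
      tend to 0 recovers the quadratic term with its full coefficient.\<close>
    have le: "(1 - t) * (norm (y - w))\<^sup>2 \<le> penal \<mu> x w - penal \<mu> x y" if t: "0 < t" "t < 1" for t
    proof -
      have "(1 - t) *\<^sub>R y + t *\<^sub>R w \<in> Y" using convex_dom y(1) w t unfolding convex_alt by auto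
      then have "penal \<mu> x y \<le> penal \<mu> x ((1 - t) *\<^sub>R y + t *\<^sub>R w)"
        using y(2) cInf_lower[OF _ bdd] unfolding B_def by fastforce
      also have "\<dots> \<le> (1 - t) * penal \<mu> x y + t * penal \<mu> x w - t * (1 - t) * (norm (y - w))\<^sup>2"
        using t w y lam by (intro penal_strongly_convex) auto
      finally have "t * ((1 - t) * (norm (y - w))\<^sup>2) \<le> t * (penal \<mu> x w - penal \<mu> x y)"
        by (simp add: algebra_simps)
      then show ?thesis using t by simp
    qed
    have "((\<lambda>t. (1 - t) * (norm (y - w))\<^sup>2) \<longlongrightarrow> (1 - 0) * (norm (y - w))\<^sup>2) (at_right 0)"
      by (intro tendsto_intros)
    moreover have "eventually (\<lambda>t. (1 - t) * (norm (y - w))\<^sup>2 \<le> penal \<mu> x w - penal \<mu> x y) (at_right 0)"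
      using le unfolding eventually_at_right_field by (intro exI[where x=1]) auto
    ultimately have "(1 - 0) * (norm (y - w))\<^sup>2 \<le> penal \<mu> x w - penal \<mu> x y"
      by (intro tendsto_upperbound) auto
    then show ?thesis by simp
  qed
  with y(1) that show ?thesis by blast
qed

lemma resolvent_eqI:
  assumes "0 < \<mu>" "x \<in> X" "y \<in> Y" "\<And>w. w \<in> Y \<Longrightarrow> (norm (y - w))\<^sup>2 + penal \<mu> x y \<le> penal \<mu> x w"
  shows "J \<mu> x = y"
  unfolding resolvent_def subgrad_iff_variational[OF assms(1,2)]
proof (rule the_equality)
  fix z assume "z \<in> Y \<and> (\<forall>w\<in>Y. (norm (z - w))\<^sup>2 + penal \<mu> x z \<le> penal \<mu> x w)"
  then have "(norm (z - y))\<^sup>2 + (norm (y - z))\<^sup>2 \<le> 0"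
    using assms(3) assms(4)[of z] by fastforce
  then show "z = y" by (simp add: norm_minus_commute)
qed (use assms in blast)

lemma resolvent_variational:
  assumes "0 < \<mu>" "x \<in> X"
  shows resolvent_in_dom: "J \<mu> x \<in> Y"
    and resolvent_min: "w \<in> Y \<Longrightarrow> (norm (J \<mu> x - w))\<^sup>2 + penal \<mu> x (J \<mu> x) \<le> penal \<mu> x w"
  using minimizer_exists[OF assms(1), of x] resolvent_eqI[OF assms] by metis+

lemma resolvent_in_space: "0 < \<mu> \<Longrightarrow> x \<in> X \<Longrightarrow> J \<mu> x \<in> X"
  using resolvent_in_dom dom_subset by blast

lemma subgrad_monotone:
  assumes "a \<in> subgrad X Y e x" "b \<in> subgrad X Y e y"
  shows "0 \<le> (a - b) \<bullet> (x - y)"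
proof -
  have "e x + a \<bullet> (y - x) \<le> e y" "e y + b \<bullet> (x - y) \<le> e x"
    using assms unfolding subgrad_def by auto
  then show ?thesis by (simp add: inner_diff_left inner_diff_right)
qed

lemma resolvent_nonexpansive:
  assumes "0 < \<mu>" "x \<in> X" "y \<in> X"
  shows "norm (J \<mu> x - J \<mu> y) \<le> norm (x - y)"
proof -
  obtain a where a: "a \<in> subgrad X Y e (J \<mu> x)" "x = J \<mu> x + \<mu> *\<^sub>R a"
    using subgrad_iff_variational[OF assms(1,2)] resolvent_variational[OF assms(1,2)] by blast
  obtain b where b: "b \<in> subgrad X Y e (J \<mu> y)" "y = J \<mu> y + \<mu> *\<^sub>R b"
    using subgrad_iff_variational[OF assms(1,3)] resolvent_variational[OF assms(1,3)] by blast
  let ?d = "J \<mu> x - J \<mu> y"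
  have "(norm ?d)\<^sup>2 \<le> (norm ?d)\<^sup>2 + \<mu> * ((a - b) \<bullet> ?d)"
    using subgrad_monotone[OF a(1) b(1)] assms(1) by simp
  also have "\<dots> = (?d + \<mu> *\<^sub>R (a - b)) \<bullet> ?d"
    by (simp add: power2_norm_eq_inner inner_left_distrib)
  also have "?d + \<mu> *\<^sub>R (a - b) = (J \<mu> x + \<mu> *\<^sub>R a) - (J \<mu> y + \<mu> *\<^sub>R b)"
    by (simp add: algebra_simps)
  also have "\<dots> = x - y" using a(2) b(2) by simp
  also have "(x - y) \<bullet> ?d \<le> norm (x - y) * norm ?d" by (rule norm_cauchy_schwarz)
  finally have "norm ?d * norm ?d \<le> norm (x - y) * norm ?d" by (simp add: power2_eq_square)
  then show ?thesis by (cases "norm ?d = 0") auto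
qed

text \<open>The point v is the resolvent of v + \<mu> a, so nonexpansiveness compares
  \<open>J \<mu> v\<close> with v.\<close>

lemma resolvent_dist_le:
  assumes "0 < \<mu>" "a \<in> subgrad X Y e v"
  shows "norm (J \<mu> v - v) \<le> \<mu> * norm a"
proof -
  have v: "v \<in> X" "a \<in> X" using assms(2) dom_subset unfolding subgrad_def by auto
  then have va: "v + \<mu> *\<^sub>R a \<in> X" using subspace by (simp add: subspace_add subspace_scale)
  have "J \<mu> (v + \<mu> *\<^sub>R a) = v"
    using subgrad_iff_variational[OF assms(1) va, of v] assms(2) resolvent_eqI[OF assms(1) va, of v] by blast
  then have "norm (J \<mu> v - v) = norm (J \<mu> v - J \<mu> (v + \<mu> *\<^sub>R a))" by simp
  also have "\<dots> \<le> norm (v - (v + \<mu> *\<^sub>R a))" by (rule resolvent_nonexpansive[OF assms(1) v(1) va])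
  finally show ?thesis using assms(1) by simp
qed

end

section \<open>The product formula\<close>

text \<open>At the last time r before b with f \<le> 0 the value is 0 while f is positive just after
  r, which contradicts a negative right derivative. Right derivatives at zeros of f are exactly what
  a strong solution offers.\<close>

lemma nonpos_of_right_derivative:
  fixes f :: "real \<Rightarrow> real"
  assumes cont: "continuous_on {0..} f" and init: "f 0 \<le> 0"
    and deriv: "\<And>t. 0 \<le> t \<Longrightarrow> f t = 0 \<Longrightarrow> \<exists>d<0. (f has_real_derivative d) (at_right t)"
    and b: "0 \<le> b"
  shows "f b \<le> 0"
proof (rule ccontr)
  assume "\<not> f b \<le> 0"
  then have fb: "0 < f b" by simp
  define A where "A = {t\<in>{0..b}. f t \<le> 0}"
  have cb: "continuous_on {0..b} f" by (rule continuous_on_subset[OF cont]) auto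
  have "closed A"
    unfolding A_def using continuous_closed_preimage[OF cb, of "{..0}"]
    by (simp add: vimage_def Int_def conj_commute)
  moreover have ne: "A \<noteq> {}" using init b unfolding A_def by auto
  moreover have bdd: "bdd_above A" unfolding A_def by (auto intro: bdd_aboveI[where M=b])
  ultimately have r: "Sup A \<in> A" using closed_contains_Sup by blast
  define r where "r = Sup A"
  have r0: "0 \<le> r" "r \<le> b" "f r \<le> 0" using r unfolding r_def A_def by auto
  then have rb: "r < b" using fb by (cases "r = b") auto
  have pos: "0 < f t" if "r < t" "t \<le> b" for t
  proof (rule ccontr)
    assume "\<not> 0 < f t"
    then have "t \<in> A" using that r0 unfolding A_def by auto
    then show False using cSup_upper[OF _ bdd, of t] that unfolding r_def by simp
  qed
  have ev: "eventually (\<lambda>t. 0 < f t) (at_right r)"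
    using pos rb unfolding eventually_at_right_field by force
  have lim: "(f \<longlongrightarrow> f r) (at_right r)"
    using cont r0 unfolding continuous_on_def
    by (intro tendsto_within_subset[of f _ r "{0..}" "{r<..}"]) auto
  have "0 \<le> f r"
    using ev by (intro tendsto_lowerbound[OF lim]) (auto elim: eventually_mono)
  then have "f r = 0" using r0 by simp
  then obtain d where d: "d < 0" "(f has_real_derivative d) (at_right r)" using deriv r0 by blast
  have "((\<lambda>t. (f t - f r) / (t - r)) \<longlongrightarrow> d) (at_right r)"
    using d(2) by (simp add: has_field_derivative_iff)
  then have "eventually (\<lambda>t. (f t - f r) / (t - r) < 0) (at_right r)"
    using d(1) order_tendstoD(2) by blast
  moreover have "eventually (\<lambda>t. r < t) (at_right r)" by (simp add: eventually_at_right_less)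
  ultimately have "eventually (\<lambda>t. False) (at_right r)"
    using ev by eventually_elim (use \<open>f r = 0\<close> in \<open>auto simp: field_simps\<close>)
  then show False by simp
qed

lemma funpow_dist_le:
  fixes f :: "'a::real_normed_vector \<Rightarrow> 'a"
  assumes maps: "\<And>x. x \<in> X \<Longrightarrow> f x \<in> X"
    and nonexp: "\<And>x y. x \<in> X \<Longrightarrow> y \<in> X \<Longrightarrow> norm (f x - f y) \<le> norm (x - y)"
    and "v \<in> X" "w \<in> X"
  shows funpow_in: "(f ^^ n) v \<in> X"
    and funpow_nonexpansive: "norm ((f ^^ n) v - (f ^^ n) w) \<le> norm (v - w)"
    and funpow_displacement: "norm ((f ^^ n) v - v) \<le> real n * norm (f v - v)"
proof -
  have mem: "(f ^^ n) x \<in> X" if "x \<in> X" for x n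
    using that maps by (induction n) auto
  then show "(f ^^ n) v \<in> X" using assms by blast
  show "norm ((f ^^ n) v - (f ^^ n) w) \<le> norm (v - w)"
  proof (induction n)
    case (Suc n)
    then show ?case using nonexp[OF mem mem, of v w n n] assms by simp
  qed simp
  show "norm ((f ^^ n) v - v) \<le> real n * norm (f v - v)"
  proof (induction n)
    case (Suc n)
    have "norm (f ((f ^^ n) v) - f v) \<le> norm ((f ^^ n) v - v)"
      using nonexp[OF mem] assms by blast
    moreover have "norm ((f ^^ Suc n) v - v) \<le> norm (f ((f ^^ n) v) - f v) + norm (f v - v)"
      using norm_triangle_ineq[of "f ((f ^^ n) v) - f v" "f v - v"] by simp
    ultimately show ?case using Suc by (simp add: algebra_simps)
  qed simp
qed

section \<open>One step of the splitting scheme and its implicit Euler companion\<close>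

locale splitting =
  closed_convex_fun X Y e + Kf: closed_convex_fun X K "\<lambda>_. 0"
  for X Y K :: "'a::real_inner set" and e :: "'a \<Rightarrow> real" +
  assumes meet: "Y \<inter> K \<noteq> {}"
begin

text \<open>This instance is the functional E + I_K; its resolvent \<open>EK.J\<close> is the
  implicit Euler step of the limit problem.\<close>

sublocale EK: closed_convex_fun X "Y \<inter> K" e
proof
  show "subspace X" "Topological_Spaces.complete X" by (rule subspace complete)+
  show "Y \<inter> K \<subseteq> X" using dom_subset by auto
  show "Y \<inter> K \<noteq> {}" by (rule meet)
  show "Convex.convex (Y \<inter> K)" using convex_dom Kf.convex_dom by (rule convex_Int)
next
  fix xs :: "nat \<Rightarrow> 'a" and x c C
  assume a: "\<And>n. xs n \<in> Y \<inter> K" "xs \<longlonglongrightarrow> x" "\<And>n. e (xs n) \<le> c n" "c \<longlonglongrightarrow> C"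
  then show "x \<in> Y \<inter> K \<and> e x \<le> C"
    using lsc[of xs x c C] Kf.lsc[of xs x "\<lambda>_. 0" 0] by auto
qed (use convex nonneg in auto)

lemma closed_K: "closed K"
  unfolding closed_sequential_limits using Kf.lsc[of _ _ "\<lambda>_. 0" 0] by auto

lemma complete_K: "Topological_Spaces.complete K"
  using complete_Int_closed[OF complete closed_K] Kf.dom_subset by (simp add: Int_absorb1)

definition F :: "real \<Rightarrow> 'a \<Rightarrow> 'a" where
  "F \<tau> x = Kf.J \<tau> (J \<tau> x)"

lemma F_in_K: "0 < \<tau> \<Longrightarrow> x \<in> X \<Longrightarrow> F \<tau> x \<in> K"
  unfolding F_def by (simp add: Kf.resolvent_in_dom resolvent_in_space)

lemma F_nonexpansive:
  assumes "0 < \<tau>" "x \<in> X" "y \<in> X"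
  shows "norm (F \<tau> x - F \<tau> y) \<le> norm (x - y)"
  unfolding F_def using assms
  by (intro order_trans[OF Kf.resolvent_nonexpansive resolvent_nonexpansive] resolvent_in_space)

text \<open>The variational inequalities of the two resolvents are added with a common competitor w,
  and the distance from the half step to w cancels. The increment of the half step is kept: it will
  show that leaving K costs little.\<close>

lemma F_step:
  assumes "0 < \<tau>" "x \<in> X" "w \<in> Y \<inter> K"
  shows "(norm (F \<tau> x - w))\<^sup>2 + (norm (J \<tau> x - x))\<^sup>2 + 2 * \<tau> * e (J \<tau> x) \<le>
    (norm (x - w))\<^sup>2 + 2 * \<tau> * e w"
proof -
  have "(norm (J \<tau> x - w))\<^sup>2 + penal \<tau> x (J \<tau> x) \<le> penal \<tau> x w"
    using assms by (intro resolvent_min) auto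
  moreover have "(norm (F \<tau> x - w))\<^sup>2 + Kf.penal \<tau> (J \<tau> x) (F \<tau> x) \<le> Kf.penal \<tau> (J \<tau> x) w"
    unfolding F_def using assms by (intro Kf.resolvent_min resolvent_in_space) auto
  moreover have "0 \<le> (norm (J \<tau> x - F \<tau> x))\<^sup>2" by simp
  ultimately show ?thesis unfolding penal_def Kf.penal_def norm_minus_commute[of x "J \<tau> x"]
    by linarith
qed

lemma F_displacement:
  assumes "0 < \<tau>" "v \<in> K" "a \<in> subgrad X Y e v"
  shows "norm (F \<tau> v - v) \<le> \<tau> * norm a"
proof -
  have v: "v \<in> X" using assms Kf.dom_subset by blast
  \<comment> \<open>Zero is a subgradient of the indicator at v, so the projection moves v by
    nothing and only the first resolvent contributes.\<close>
  have "0 \<in> subgrad X K (\<lambda>_. 0) v"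
    using assms subspace by (simp add: subgrad_def subspace_0)
  then have "Kf.J \<tau> v = v" using Kf.resolvent_dist_le[OF assms(1)] by fastforce
  then have "norm (F \<tau> v - v) \<le> norm (J \<tau> v - v)"
    unfolding F_def
    using Kf.resolvent_nonexpansive[OF assms(1) resolvent_in_space[OF assms(1) v] v] by simp
  also have "\<dots> \<le> \<tau> * norm a" by (rule resolvent_dist_le[OF assms(1,3)])
  finally show ?thesis .
qed

text \<open>One step of size \<open>\<mu>\<close> of the implicit Euler scheme for the Yosida-type operator \<open>(I - F \<tau>) / \<tau>\<close>.\<close>

definition G :: "real \<Rightarrow> real \<Rightarrow> 'a \<Rightarrow> 'a" where
  "G \<mu> \<tau> x = (THE z. z \<in> K \<and> (\<tau> / (\<tau> + \<mu>)) *\<^sub>R x + (\<mu> / (\<tau> + \<mu>)) *\<^sub>R F \<tau> z = z)"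

context
  fixes \<mu> \<tau> :: real
  assumes mu: "0 < \<mu>" and tau: "0 < \<tau>"
begin

text \<open>The Euler equation \<tau> (z - x) = \<mu> (F \<tau> z - z), solved for its explicit z,
  is a fixed point problem on the complete convex set K with contraction factor \<mu> / (\<tau> +
  \<mu>).\<close>

lemma G_fixpoint:
  assumes x: "x \<in> K"
  shows G_in_K: "G \<mu> \<tau> x \<in> K"
    and G_eq: "(\<tau> / (\<tau> + \<mu>)) *\<^sub>R x + (\<mu> / (\<tau> + \<mu>)) *\<^sub>R F \<tau> (G \<mu> \<tau> x) = G \<mu> \<tau> x"
proof -
  let ?f = "\<lambda>z. (\<tau> / (\<tau> + \<mu>)) *\<^sub>R x + (\<mu> / (\<tau> + \<mu>)) *\<^sub>R F \<tau> z"
  have KX: "K \<subseteq> X" by (rule Kf.dom_subset)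
  have sum: "\<tau> / (\<tau> + \<mu>) + \<mu> / (\<tau> + \<mu>) = 1"
    using mu tau by (simp add: add_divide_distrib[symmetric])
  have "\<exists>!z\<in>K. ?f z = z"
  proof (rule Banach_fix[OF complete_K Kf.dom_ne, of "\<mu> / (\<tau> + \<mu>)"])
    show "0 \<le> \<mu> / (\<tau> + \<mu>)" "\<mu> / (\<tau> + \<mu>) < 1" using mu tau by (auto simp: field_simps)
    show "?f ` K \<subseteq> K"
      using x F_in_K[OF tau] KX mu tau sum
      by (auto intro!: convexD[OF Kf.convex_dom])
    fix z z' assume z: "z \<in> K" "z' \<in> K"
    have "dist (?f z) (?f z') = \<mu> / (\<tau> + \<mu>) * norm (F \<tau> z - F \<tau> z')"
      using mu tau by (simp add: dist_norm flip: scaleR_diff_right)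
    also have "\<dots> \<le> \<mu> / (\<tau> + \<mu>) * dist z z'"
      unfolding dist_norm using mu tau z KX by (intro mult_left_mono F_nonexpansive) auto
    finally show "dist (?f z) (?f z') \<le> \<mu> / (\<tau> + \<mu>) * dist z z'" .
  qed
  then have "G \<mu> \<tau> x \<in> K \<and> ?f (G \<mu> \<tau> x) = G \<mu> \<tau> x"
    unfolding G_def by (rule theI')
  then show "G \<mu> \<tau> x \<in> K" "?f (G \<mu> \<tau> x) = G \<mu> \<tau> x" by auto
qed

lemma G_increment:
  assumes x: "x \<in> K"
  shows "\<tau> *\<^sub>R (G \<mu> \<tau> x - x) = \<mu> *\<^sub>R (F \<tau> (G \<mu> \<tau> x) - G \<mu> \<tau> x)"
proof -
  let ?z = "G \<mu> \<tau> x"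
  have "(\<tau> + \<mu>) *\<^sub>R ?z = (\<tau> + \<mu>) *\<^sub>R ((\<tau> / (\<tau> + \<mu>)) *\<^sub>R x + (\<mu> / (\<tau> + \<mu>)) *\<^sub>R F \<tau> ?z)"
    by (simp only: G_eq[OF x])
  also have "\<dots> = \<tau> *\<^sub>R x + \<mu> *\<^sub>R F \<tau> ?z"
    using mu tau by (simp add: scaleR_add_right)
  finally show ?thesis by (simp add: algebra_simps)
qed

lemma G_nonexpansive:
  assumes "x \<in> K" "y \<in> K"
  shows "norm (G \<mu> \<tau> x - G \<mu> \<tau> y) \<le> norm (x - y)"
proof -
  let ?d = "norm (G \<mu> \<tau> x - G \<mu> \<tau> y)"
  have KX: "K \<subseteq> X" by (rule Kf.dom_subset)
  have "(\<tau> + \<mu>) *\<^sub>R z = \<tau> *\<^sub>R z0 + \<mu> *\<^sub>R p"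
    if "\<tau> *\<^sub>R (z - z0) = \<mu> *\<^sub>R (p - z)" for z z0 p :: 'a
    using that by (simp add: algebra_simps)
  from this[OF G_increment[OF assms(1)]] this[OF G_increment[OF assms(2)]]
  have "(\<tau> + \<mu>) *\<^sub>R (G \<mu> \<tau> x - G \<mu> \<tau> y) = \<tau> *\<^sub>R (x - y) + \<mu> *\<^sub>R (F \<tau> (G \<mu> \<tau> x) - F \<tau> (G \<mu> \<tau> y))"
    by (simp add: scaleR_diff_right)
  then have "norm ((\<tau> + \<mu>) *\<^sub>R (G \<mu> \<tau> x - G \<mu> \<tau> y)) \<le>
      norm (\<tau> *\<^sub>R (x - y)) + norm (\<mu> *\<^sub>R (F \<tau> (G \<mu> \<tau> x) - F \<tau> (G \<mu> \<tau> y)))"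
    using norm_triangle_ineq by metis
  then have "(\<tau> + \<mu>) * ?d \<le> \<tau> * norm (x - y) + \<mu> * norm (F \<tau> (G \<mu> \<tau> x) - F \<tau> (G \<mu> \<tau> y))"
    using mu tau by simp
  also have "\<dots> \<le> \<tau> * norm (x - y) + \<mu> * ?d"
    using mu tau G_in_K assms KX by (intro add_left_mono mult_left_mono F_nonexpansive) auto
  finally have "\<tau> * ?d \<le> \<tau> * norm (x - y)" by (simp add: algebra_simps)
  then show ?thesis using tau by simp
qed

text \<open>Inserting \<open>F \<tau> v\<close> into the Euler equation and absorbing the
  nonexpansive part on the left gives a bound free of \<tau>, which is needed because \<tau> tends
  to 0 with \<mu> fixed.\<close>

lemma G_displacement:
  assumes "v \<in> K" "a \<in> subgrad X Y e v"
  shows "norm (G \<mu> \<tau> v - v) \<le> \<mu> * norm a"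
proof -
  let ?z = "G \<mu> \<tau> v"
  have KX: "K \<subseteq> X" by (rule Kf.dom_subset)
  have "(\<tau> + \<mu>) *\<^sub>R (?z - v) = \<mu> *\<^sub>R ((F \<tau> ?z - F \<tau> v) + (F \<tau> v - v))"
    using G_increment[OF assms(1)] by (simp add: algebra_simps)
  then have "(\<tau> + \<mu>) * norm (?z - v) = \<mu> * norm ((F \<tau> ?z - F \<tau> v) + (F \<tau> v - v))"
    using mu tau norm_scaleR[of "\<tau> + \<mu>" "?z - v"]
      norm_scaleR[of \<mu> "(F \<tau> ?z - F \<tau> v) + (F \<tau> v - v)"] by simp
  also have "\<dots> \<le> \<mu> * (norm (?z - v) + \<tau> * norm a)"
    using mu tau assms G_in_K KX
    by (intro mult_left_mono norm_triangle_mono F_nonexpansive F_displacement) auto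
  finally have "\<tau> * norm (?z - v) \<le> \<tau> * (\<mu> * norm a)" by (simp add: algebra_simps)
  then show ?thesis using tau by simp
qed

text \<open>Expanding |F \<tau> z - w|^2 about z and replacing \<mu> (F \<tau> z - z) by \<tau> (z -
  x) gives a lower bound for the quantity that \<open>F_step\<close> bounds from above. The last
  term on the left carries no factor \<tau>, hence it forces \<open>J \<tau> z\<close> towards z as
  \<tau> tends to 0.\<close>

lemma G_estimate:
  fixes x w :: 'a
  defines "z \<equiv> G \<mu> \<tau> x"
  assumes x: "x \<in> K" and w: "w \<in> Y \<inter> K"
  shows "\<tau> * ((norm (z - x))\<^sup>2 + (norm (z - w))\<^sup>2 + 2 * \<mu> * e (J \<tau> z)) + \<mu> * (norm (J \<tau> z - z))\<^sup>2
    \<le> \<tau> * penal \<mu> x w"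
proof -
  have zX: "z \<in> X" using G_in_K[OF x] Kf.dom_subset unfolding z_def by blast
  let ?p = "F \<tau> z"
  have inc: "\<mu> *\<^sub>R (?p - z) = \<tau> *\<^sub>R (z - x)" using G_increment[OF x] unfolding z_def by simp
  have "\<mu> * ((norm (?p - w))\<^sup>2 - (norm (z - w))\<^sup>2) =
      \<mu> * (norm (?p - z))\<^sup>2 + 2 * ((\<mu> *\<^sub>R (?p - z)) \<bullet> (z - w))"
    by (simp add: power2_norm_eq_inner inner_diff_left inner_diff_right inner_commute algebra_simps)
  also have "\<dots> \<ge> 2 * \<tau> * ((z - x) \<bullet> (z - w))" unfolding inc using mu by simp
  also have "2 * \<tau> * ((z - x) \<bullet> (z - w)) =
      \<tau> * ((norm (z - x))\<^sup>2 + (norm (z - w))\<^sup>2 - (norm (x - w))\<^sup>2)"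
    by (simp add: power2_norm_eq_inner inner_diff_left inner_diff_right inner_commute algebra_simps)
  finally have 1: "\<tau> * ((norm (z - x))\<^sup>2 + (norm (z - w))\<^sup>2 - (norm (x - w))\<^sup>2) \<le>
      \<mu> * ((norm (?p - w))\<^sup>2 - (norm (z - w))\<^sup>2)" .
  have "\<mu> * ((norm (?p - w))\<^sup>2 - (norm (z - w))\<^sup>2) \<le>
      \<mu> * (2 * \<tau> * e w - 2 * \<tau> * e (J \<tau> z) - (norm (J \<tau> z - z))\<^sup>2)"
    using F_step[OF tau zX w] mu by (intro mult_left_mono) auto
  with 1 show ?thesis unfolding penal_def by (simp add: algebra_simps)
qed

text \<open>By the fixed point equation the difference at (n+1, j+1) is bounded by the convex
  combination, with weights \<alpha> and \<beta>, of those at (n+1, j) and (n, j+1). The function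
  \<phi> satisfies this recursion with equality and dominates the linear displacement bounds on both
  axes, so a double induction closes.\<close>

lemma kobayashi_estimate:
  assumes v: "v \<in> K" "a \<in> subgrad X Y e v"
  shows "(norm ((F \<tau> ^^ n) v - (G \<mu> \<tau> ^^ j) v))\<^sup>2 \<le>
    (norm a)\<^sup>2 * ((real n * \<tau> - real j * \<mu>)\<^sup>2 + real n * \<tau>\<^sup>2 + real j * \<mu>\<^sup>2)"
proof -
  define \<phi> where "\<phi> n j = (real n * \<tau> - real j * \<mu>)\<^sup>2 + real n * \<tau>\<^sup>2 + real j * \<mu>\<^sup>2" for n j
  define \<alpha> where "\<alpha> = \<tau> / (\<tau> + \<mu>)"
  define \<beta> where "\<beta> = \<mu> / (\<tau> + \<mu>)"
  have ab: "\<alpha> + \<beta> = 1" "0 \<le> \<alpha>" "0 \<le> \<beta>" "\<alpha> * \<mu> = \<beta> * \<tau>"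
    using mu tau unfolding \<alpha>_def \<beta>_def by (auto simp: add_divide_distrib[symmetric])
  have KX: "K \<subseteq> X" by (rule Kf.dom_subset)
  have FX: "(F \<tau> ^^ n) v \<in> X" for n
    using v KX F_in_K[OF tau] by (intro funpow_in[where X=X and w=v] F_nonexpansive[OF tau]) auto
  have GK: "(G \<mu> \<tau> ^^ n) v \<in> K" for n
    using v G_in_K by (intro funpow_in[where X=K and w=v] G_nonexpansive) auto
  have F0: "norm ((F \<tau> ^^ n) v - v) \<le> real n * (\<tau> * norm a)" for n
  proof -
    have "norm ((F \<tau> ^^ n) v - v) \<le> real n * norm (F \<tau> v - v)"
      using v KX F_in_K[OF tau] by (intro funpow_displacement[where X=X and w=v] F_nonexpansive[OF tau]) auto
    also have "\<dots> \<le> real n * (\<tau> * norm a)"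
      using F_displacement[OF tau v] by (intro mult_left_mono) auto
    finally show ?thesis .
  qed
  have G0: "norm (v - (G \<mu> \<tau> ^^ j) v) \<le> real j * (\<mu> * norm a)" for j
  proof -
    have "norm ((G \<mu> \<tau> ^^ j) v - v) \<le> real j * norm (G \<mu> \<tau> v - v)"
      using v G_in_K by (intro funpow_displacement[where X=K and w=v] G_nonexpansive) auto
    also have "\<dots> \<le> real j * (\<mu> * norm a)"
      using G_displacement[OF v] by (intro mult_left_mono) auto
    finally show ?thesis by (simp add: norm_minus_commute)
  qed
  have sq: "\<And>p q::real. 0 \<le> p \<Longrightarrow> p \<le> q \<Longrightarrow> p\<^sup>2 \<le> q\<^sup>2" by (simp add: power_mono)
  have "(norm ((F \<tau> ^^ n) v - (G \<mu> \<tau> ^^ j) v))\<^sup>2 \<le> (norm a)\<^sup>2 * \<phi> n j" for n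
  proof (induction j arbitrary: n)
    case 0
    have "(norm ((F \<tau> ^^ n) v - v))\<^sup>2 \<le> (real n * (\<tau> * norm a))\<^sup>2" by (intro sq F0) auto
    also have "\<dots> = (norm a)\<^sup>2 * (real n * \<tau>)\<^sup>2" by (simp add: power_mult_distrib)
    also have "\<dots> \<le> (norm a)\<^sup>2 * \<phi> n 0" unfolding \<phi>_def by (intro mult_left_mono) auto
    finally show ?case by simp
  next
    case (Suc j)
    note outer = Suc
    show ?case
    proof (induction n)
      case 0
      have "(norm (v - (G \<mu> \<tau> ^^ Suc j) v))\<^sup>2 \<le> (real (Suc j) * (\<mu> * norm a))\<^sup>2" by (intro sq G0) auto
      also have "\<dots> = (norm a)\<^sup>2 * (real (Suc j) * \<mu>)\<^sup>2" by (simp add: power_mult_distrib)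
      also have "\<dots> \<le> (norm a)\<^sup>2 * \<phi> 0 (Suc j)" unfolding \<phi>_def by (intro mult_left_mono) auto
      finally show ?case by simp
    next
      case (Suc n)
      let ?x = "(F \<tau> ^^ n) v" and ?y = "(G \<mu> \<tau> ^^ j) v"
      let ?r = "norm (F \<tau> ?x - ?y)" and ?s = "norm (?x - G \<mu> \<tau> ?y)"
      have "F \<tau> ?x = \<alpha> *\<^sub>R F \<tau> ?x + \<beta> *\<^sub>R F \<tau> ?x"
        using ab(1) by (simp flip: scaleR_add_left)
      then have "F \<tau> ?x - G \<mu> \<tau> ?y =
          (\<alpha> *\<^sub>R F \<tau> ?x + \<beta> *\<^sub>R F \<tau> ?x) - (\<alpha> *\<^sub>R ?y + \<beta> *\<^sub>R F \<tau> (G \<mu> \<tau> ?y))"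
        using G_eq[OF GK[of j]] unfolding \<alpha>_def \<beta>_def by simp
      also have "\<dots> = \<alpha> *\<^sub>R (F \<tau> ?x - ?y) + \<beta> *\<^sub>R (F \<tau> ?x - F \<tau> (G \<mu> \<tau> ?y))"
        by (simp add: algebra_simps)
      finally have "norm (F \<tau> ?x - G \<mu> \<tau> ?y) \<le> \<alpha> * ?r + \<beta> * norm (F \<tau> ?x - F \<tau> (G \<mu> \<tau> ?y))"
        using norm_triangle_ineq[of "\<alpha> *\<^sub>R (F \<tau> ?x - ?y)" "\<beta> *\<^sub>R (F \<tau> ?x - F \<tau> (G \<mu> \<tau> ?y))"] ab by simp
      also have "\<dots> \<le> \<alpha> * ?r + \<beta> * ?s"
        using FX G_in_K[OF GK] KX ab by (intro add_left_mono mult_left_mono F_nonexpansive[OF tau]) auto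
      finally have "(norm (F \<tau> ?x - G \<mu> \<tau> ?y))\<^sup>2 \<le> (\<alpha> * ?r + \<beta> * ?s)\<^sup>2" by (intro sq) auto
      also have "\<dots> \<le> \<alpha> * ?r\<^sup>2 + \<beta> * ?s\<^sup>2"
      proof -
        have "\<alpha> * ?r\<^sup>2 + \<beta> * ?s\<^sup>2 - (\<alpha> * ?r + \<beta> * ?s)\<^sup>2 = \<alpha> * \<beta> * (?r - ?s)\<^sup>2"
        proof -
          have b: "\<beta> = 1 - \<alpha>" using ab(1) by simp
          show ?thesis unfolding b by (simp add: power2_eq_square algebra_simps)
        qed
        moreover have "0 \<le> \<alpha> * \<beta> * (?r - ?s)\<^sup>2" using ab by simp
        ultimately show ?thesis by linarith
      qed
      also have "\<dots> \<le> \<alpha> * ((norm a)\<^sup>2 * \<phi> (Suc n) j) + \<beta> * ((norm a)\<^sup>2 * \<phi> n (Suc j))"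
        using outer[of "Suc n"] Suc ab by (intro add_mono mult_left_mono) auto
      also have "\<dots> = (norm a)\<^sup>2 * (\<alpha> * \<phi> (Suc n) j + \<beta> * \<phi> n (Suc j))" by (simp add: algebra_simps)
      \<comment> \<open>Lowering one index changes \<phi> by 2d\<mu> or by -2d\<tau>, since the
        terms n\<tau>^2 and j\<mu>^2 absorb the squares of the increments; the two changes cancel
        because \<alpha>\<mu> = \<beta>\<tau>.\<close>
      also have "\<alpha> * \<phi> (Suc n) j + \<beta> * \<phi> n (Suc j) = \<phi> (Suc n) (Suc j)"
      proof -
        define d where "d = real (Suc n) * \<tau> - real (Suc j) * \<mu>"
        let ?P = "\<phi> (Suc n) (Suc j)"
        have e: "real (Suc n) * \<tau> - real j * \<mu> = d + \<mu>" "real n * \<tau> - real (Suc j) * \<mu> = d - \<tau>"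
          unfolding d_def by (auto simp: algebra_simps)
        have e': "\<phi> (Suc n) j = ?P + 2 * d * \<mu>" "\<phi> n (Suc j) = ?P - 2 * d * \<tau>"
          unfolding \<phi>_def e d_def[symmetric] by (simp_all add: power2_eq_square algebra_simps)
        have "\<alpha> * \<phi> (Suc n) j + \<beta> * \<phi> n (Suc j) = (\<alpha> + \<beta>) * ?P + 2 * d * (\<alpha> * \<mu> - \<beta> * \<tau>)"
          unfolding e' by (simp add: algebra_simps)
        then show ?thesis using ab by simp
      qed
      finally show ?case by simp
    qed
  qed
  then show ?thesis unfolding \<phi>_def .
qed

end

end

section \<open>The limit of the Euler steps as the splitting step tends to zero\<close>

context splitting
begin

text \<open>Near-minimisers over shrinking neighbourhoods of \<open>K\<close> converge, by strong convexity, to a point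
  of \<open>K\<close>; so leaving \<open>K\<close> slightly cannot lower the penalised energy by a fixed amount.\<close>

lemma penal_near_K:
  assumes mu: "0 < \<mu>" and x: "x \<in> X" and eps: "0 < \<epsilon>"
  obtains \<delta> where "0 < \<delta>"
    "\<And>y z. \<lbrakk>y \<in> Y; z \<in> K; norm (y - z) < \<delta>\<rbrakk> \<Longrightarrow> penal \<mu> x (EK.J \<mu> x) - \<epsilon> < penal \<mu> x y"
proof -
  define B where "B = penal \<mu> x (EK.J \<mu> x) - \<epsilon>"
  have "\<exists>\<delta>>0. \<forall>y z. y \<in> Y \<longrightarrow> z \<in> K \<longrightarrow> norm (y - z) < \<delta> \<longrightarrow> B < penal \<mu> x y"
  proof (rule ccontr)
    assume neg: "\<not> ?thesis"
    define A where "A n = {y. \<exists>z\<in>K. norm (y - z) \<le> inverse (real (Suc n))}" for n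
    \<comment> \<open>Written as a Minkowski sum of K with a ball, the neighbourhood inherits
      convexity.\<close>
    have A_eq: "A n = (\<Union>z\<in>K. \<Union>b\<in>cball 0 (inverse (real (Suc n))). {z + b})" for n
    proof (intro set_eqI iffI)
      fix y assume "y \<in> A n"
      then obtain z where "z \<in> K" "norm (y - z) \<le> inverse (real (Suc n))" unfolding A_def by auto
      then show "y \<in> (\<Union>z\<in>K. \<Union>b\<in>cball 0 (inverse (real (Suc n))). {z + b})"
        by (intro UN_I[of z] UN_I[of "y - z"]) auto
    next
      fix y assume "y \<in> (\<Union>z\<in>K. \<Union>b\<in>cball 0 (inverse (real (Suc n))). {z + b})"
      then obtain z b where "y = z + b" "z \<in> K" "b \<in> cball 0 (inverse (real (Suc n)))" by blast
      then show "y \<in> A n" unfolding A_def by (intro CollectI bexI[of _ z]) auto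
    qed
    have conv: "Convex.convex (A n)" for n
      unfolding A_eq by (intro convex_sums Kf.convex_dom convex_cball)
    have dec: "decseq A"
    proof (rule decseq_SucI)
      fix n
      have "inverse (real (Suc (Suc n))) \<le> inverse (real (Suc n))" by (intro le_imp_inverse_le) auto
      then show "A (Suc n) \<subseteq> A n" unfolding A_def by (blast intro: order_trans)
    qed
    have ex: "\<exists>y\<in>A n \<inter> Y. penal \<mu> x y \<le> B + inverse (real (Suc n))" for n
    proof -
      have "0 < inverse (real (Suc n))" by simp
      then obtain y z where yz: "y \<in> Y" "z \<in> K" "norm (y - z) < inverse (real (Suc n))" "penal \<mu> x y \<le> B"
        using neg by (metis not_less)
      have "y \<in> A n \<inter> Y" unfolding A_def using yz(1-3) less_imp_le by blast
      moreover have "penal \<mu> x y \<le> B + inverse (real (Suc n))"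
        using yz(4) \<open>0 < inverse (real (Suc n))\<close> by linarith
      ultimately show ?thesis by blast
    qed
    obtain w ws where w: "w \<in> Y" "penal \<mu> x w \<le> B" "ws \<longlonglongrightarrow> w" "\<And>n. ws n \<in> A n"
      by (rule nested_minimum[OF mu conv dec ex]) (use that in blast)
    obtain zs where zs: "\<And>n. zs n \<in> K" "\<And>n. norm (ws n - zs n) \<le> inverse (real (Suc n))"
    proof -
      have "\<forall>n. \<exists>z. z \<in> K \<and> norm (ws n - z) \<le> inverse (real (Suc n))"
        using w(4) unfolding A_def by blast
      then show ?thesis using that by metis
    qed
    have "(\<lambda>n. ws n - zs n) \<longlonglongrightarrow> 0"
      using zs(2) by (intro Lim_null_comparison[OF _ LIMSEQ_inverse_real_of_nat]) auto
    from tendsto_diff[OF w(3) this] have "zs \<longlonglongrightarrow> w" by simp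
    then have "w \<in> K" using closed_K zs(1) unfolding closed_sequential_limits by blast
    then have "penal \<mu> x (EK.J \<mu> x) \<le> penal \<mu> x w"
      using EK.resolvent_min[OF mu x, of w] w(1) zero_le_power2[of "norm (EK.J \<mu> x - w)"]
      by (auto intro: order_trans[rotated])
    then show False using w(2) eps unfolding B_def by simp
  qed
  then show ?thesis using that unfolding B_def by blast
qed

text \<open>With z the Euler step, y = \<open>J \<tau> z\<close> and R the minimal penalised value,
  \<open>G_estimate\<close> gives |y - z| \<le> sqrt (\<tau>R/\<mu>). So y is close to K, and by
  \<open>penal_near_K\<close> its penalised value exceeds R - \<eta>^2/2; the other half of \<eta>^2
  pays for replacing |x - z|^2 by |x - y|^2. What remains bounds |z - m|^2.\<close>

lemma G_tendsto_resolvent: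
  assumes mu: "0 < \<mu>" and x: "x \<in> K"
  shows "((\<lambda>\<tau>. G \<mu> \<tau> x) \<longlongrightarrow> EK.J \<mu> x) (at_right 0)"
proof (rule tendstoI)
  fix \<eta> :: real assume eta: "0 < \<eta>"
  have xX: "x \<in> X" using x Kf.dom_subset by blast
  define m where "m = EK.J \<mu> x"
  define R where "R = penal \<mu> x m"
  have mY: "m \<in> Y \<inter> K" unfolding m_def by (rule EK.resolvent_in_dom[OF mu xX])
  then have R: "0 \<le> R" unfolding R_def by (intro penal_nonneg mu) auto
  obtain \<delta> where d: "0 < \<delta>"
    "\<And>y z. \<lbrakk>y \<in> Y; z \<in> K; norm (y - z) < \<delta>\<rbrakk> \<Longrightarrow> R - \<eta>\<^sup>2 / 2 < penal \<mu> x y"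
    using penal_near_K[OF mu xX, of "\<eta>\<^sup>2 / 2"] eta unfolding R_def m_def by auto
  define r where "r \<tau> = sqrt (\<tau> * R / \<mu>)" for \<tau>
  have r: "(r \<longlongrightarrow> 0) (at_right 0)"
    unfolding r_def by (rule tendsto_eq_intros refl | use mu in simp)+
  then have "((\<lambda>\<tau>. 2 * sqrt R * r \<tau> + (r \<tau>)\<^sup>2) \<longlongrightarrow> 2 * sqrt R * 0 + 0\<^sup>2) (at_right 0)"
    by (intro tendsto_intros)
  then have "eventually (\<lambda>\<tau>. 2 * sqrt R * r \<tau> + (r \<tau>)\<^sup>2 < \<eta>\<^sup>2 / 2) (at_right 0)"
    using eta by (intro order_tendstoD(2)) auto
  moreover have "eventually (\<lambda>\<tau>. r \<tau> < \<delta>) (at_right 0)"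
    using order_tendstoD(2)[OF r d(1)] .
  moreover note eventually_at_right_less[of "0::real"]
  ultimately show "eventually (\<lambda>\<tau>. dist (G \<mu> \<tau> x) (EK.J \<mu> x) < \<eta>) (at_right 0)"
  proof eventually_elim
    case (elim \<tau>)
    define z where "z = G \<mu> \<tau> x"
    define y where "y = J \<tau> z"
    have zK: "z \<in> K" unfolding z_def using G_in_K[OF mu elim(3) x] .
    then have zX: "z \<in> X" using Kf.dom_subset by blast
    have yY: "y \<in> Y" unfolding y_def using resolvent_in_dom[OF elim(3) zX] .
    have main: "\<tau> * ((norm (z - x))\<^sup>2 + (norm (z - m))\<^sup>2 + 2 * \<mu> * e y) + \<mu> * (norm (y - z))\<^sup>2 \<le> \<tau> * R"
      using G_estimate[OF mu elim(3) x mY] unfolding z_def y_def R_def .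
    have ey: "0 \<le> 2 * \<mu> * e y" using nonneg[OF yY] mu by simp
    have "0 \<le> \<tau> * ((norm (z - x))\<^sup>2 + (norm (z - m))\<^sup>2 + 2 * \<mu> * e y)"
      using elim(3) ey by simp
    then have "\<mu> * (norm (y - z))\<^sup>2 \<le> \<tau> * R" using main by linarith
    then have "(norm (y - z))\<^sup>2 \<le> \<tau> * R / \<mu>" using mu by (simp add: field_simps)
    then have yz: "norm (y - z) \<le> r \<tau>" unfolding r_def by (rule real_le_rsqrt)
    have "0 \<le> \<mu> * (norm (y - z))\<^sup>2" using mu by simp
    then have "\<tau> * ((norm (z - x))\<^sup>2 + (norm (z - m))\<^sup>2 + 2 * \<mu> * e y) \<le> \<tau> * R" using main by linarith
    then have le: "(norm (z - x))\<^sup>2 + (norm (z - m))\<^sup>2 + 2 * \<mu> * e y \<le> R" using elim(3) by simp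
    then have "(norm (z - x))\<^sup>2 \<le> R" using ey zero_le_power2[of "norm (z - m)"] by linarith
    then have zx: "norm (z - x) \<le> sqrt R" by (rule real_le_rsqrt)
    have "norm (x - y) \<le> norm (z - x) + norm (y - z)"
      using norm_triangle_ineq[of "x - z" "z - y"] by (simp add: norm_minus_commute)
    then have "(norm (x - y))\<^sup>2 \<le> (norm (z - x) + norm (y - z))\<^sup>2" by (intro power_mono) auto
    also have "\<dots> = (norm (z - x))\<^sup>2 + 2 * norm (z - x) * norm (y - z) + (norm (y - z))\<^sup>2"
      by (simp add: power2_sum)
    also have "\<dots> \<le> (norm (z - x))\<^sup>2 + 2 * sqrt R * r \<tau> + (r \<tau>)\<^sup>2"
      using zx yz R by (intro add_mono mult_mono power_mono) auto
    finally have "(norm (x - y))\<^sup>2 < (norm (z - x))\<^sup>2 + \<eta>\<^sup>2 / 2" using elim(1) by linarith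
    moreover have "R - \<eta>\<^sup>2 / 2 < (norm (x - y))\<^sup>2 + 2 * \<mu> * e y"
      using d(2)[OF yY zK] yz elim(2) unfolding penal_def by linarith
    ultimately have "(norm (z - m))\<^sup>2 < \<eta>\<^sup>2" using le by linarith
    then have "norm (z - m) < \<eta>" using eta by (simp add: power_less_imp_less_base)
    then show ?case unfolding z_def m_def dist_norm .
  qed
qed

lemma EK_iterate_in_K: "0 < \<mu> \<Longrightarrow> v \<in> K \<Longrightarrow> (EK.J \<mu> ^^ j) v \<in> K"
  using EK.resolvent_in_dom Kf.dom_subset by (induction j) auto

text \<open>Each \<open>G \<mu> \<tau>\<close> is nonexpansive, so the error of the previous iterate
  passes through a step unamplified, whatever \<tau> is.\<close>

lemma G_iterates_tendsto:
  assumes mu: "0 < \<mu>" and v: "v \<in> K"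
  shows "((\<lambda>\<tau>. (G \<mu> \<tau> ^^ j) v) \<longlongrightarrow> (EK.J \<mu> ^^ j) v) (at_right 0)"
proof (induction j)
  case (Suc j)
  let ?z = "(EK.J \<mu> ^^ j) v"
  have z: "?z \<in> K" by (rule EK_iterate_in_K[OF mu v])
  have "((\<lambda>\<tau>. G \<mu> \<tau> ((G \<mu> \<tau> ^^ j) v) - G \<mu> \<tau> ?z) \<longlongrightarrow> 0) (at_right 0)"
  proof (rule Lim_null_comparison)
    show "((\<lambda>\<tau>. norm ((G \<mu> \<tau> ^^ j) v - ?z)) \<longlongrightarrow> 0) (at_right 0)"
      using Suc by (simp add: tendsto_norm_zero LIM_zero)
    from eventually_at_right_less[of "0::real"]
    show "eventually (\<lambda>\<tau>. norm (G \<mu> \<tau> ((G \<mu> \<tau> ^^ j) v) - G \<mu> \<tau> ?z) \<le> norm ((G \<mu> \<tau> ^^ j) v - ?z)) (at_right 0)"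
    proof eventually_elim
      case (elim \<tau>)
      have "(G \<mu> \<tau> ^^ j) v \<in> K"
        using v G_in_K[OF mu elim]
        by (intro funpow_in[where X=K and w=v] G_nonexpansive[OF mu elim]) auto
      then show ?case using z by (intro G_nonexpansive[OF mu elim])
    qed
  qed
  from tendsto_add[OF this G_tendsto_resolvent[OF mu z]] show ?case by simp
qed simp

section \<open>The generated semigroup compared with iterated resolvents\<close>

definition Cop :: "'a \<Rightarrow> 'a set" where
  "Cop = op_sum (subgrad X Y e) (subgrad X K (\<lambda>_. 0))"

text \<open>This inclusion is the link between the two sides: derivatives of the trajectory become
  subgradients of E + I_K and can be tested by monotonicity against the resolvent
  increments.\<close>

lemma Cop_subset: "c \<in> Cop v \<Longrightarrow> c \<in> subgrad X (Y \<inter> K) e v"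
proof -
  assume "c \<in> Cop v"
  then obtain a b where ab: "c = a + b" "a \<in> subgrad X Y e v" "b \<in> subgrad X K (\<lambda>_. 0) v"
    unfolding Cop_def op_sum_def by blast
  then show ?thesis using subspace unfolding subgrad_def
    by (auto simp: inner_add_left intro!: subspace_add) (smt (verit, best))
qed

lemma subgrad_Cop: "a \<in> subgrad X Y e v \<Longrightarrow> v \<in> K \<Longrightarrow> a \<in> Cop v"
proof -
  assume a: "a \<in> subgrad X Y e v" "v \<in> K"
  then have "0 \<in> subgrad X K (\<lambda>_. 0) v" using subspace by (simp add: subgrad_def subspace_0)
  then have "a + 0 \<in> Cop v" using a unfolding Cop_def op_sum_def by blast
  then show ?thesis by simp
qed

text \<open>Zero belongs to \<partial>I_K at every point of K, so the constraint removes no further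
  points from the domain.\<close>

lemma Cop_dom: "{v. Cop v \<noteq> {}} = {v \<in> K. subgrad X Y e v \<noteq> {}}"
proof -
  have "v \<in> K \<and> subgrad X Y e v \<noteq> {}" if "c \<in> Cop v" for c v
    using that unfolding Cop_def op_sum_def subgrad_def by auto
  then show ?thesis using subgrad_Cop by blast
qed

lemma generated_strong_solution:
  assumes S: "generates_semigroup Cop S" and v: "Cop v \<noteq> {}"
  shows "S 0 v = v"
    and "continuous_on {0..} (\<lambda>t. S t v)"
    and "0 \<le> t \<Longrightarrow> \<exists>c\<in>Cop (S t v). ((\<lambda>s. S s v) has_vector_derivative - c) (at_right t)"
proof -
  have Q: "v \<in> closure {v. Cop v \<noteq> {}}"
    by (rule subsetD[OF closure_subset]) (use v in simp)
  have "\<forall>v\<in>closure {v. Cop v \<noteq> {}}. S 0 v = v"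
    using S unfolding generates_semigroup_def Let_def by (elim conjE)
  then show "S 0 v = v" using Q by (rule bspec)
  have "\<forall>v\<in>closure {v. Cop v \<noteq> {}}. continuous_on {0..} (\<lambda>t. S t v)"
    using S unfolding generates_semigroup_def Let_def by (elim conjE)
  then show "continuous_on {0..} (\<lambda>t. S t v)" using Q by (rule bspec)
  have *: "\<forall>v\<in>{v. Cop v \<noteq> {}}. \<forall>t\<ge>0. \<exists>c\<in>Cop (S t v). ((\<lambda>s. S s v) has_vector_derivative - c) (at_right t)"
    using S unfolding generates_semigroup_def Let_def by (elim conjE)
  show "\<exists>c\<in>Cop (S t v). ((\<lambda>s. S s v) has_vector_derivative - c) (at_right t)" if "0 \<le> t"
    using bspec[OF *, of v] v that by blast
qed

lemma norm_sq_right_derivative: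
  fixes u :: "real \<Rightarrow> 'a"
  assumes "(u has_vector_derivative - c) (at_right t)"
  shows "((\<lambda>s. (norm (u s - z))\<^sup>2) has_real_derivative - 2 * (c \<bullet> (u t - z))) (at_right t)"
proof -
  have "((\<lambda>s. u s - z) has_derivative (\<lambda>h. h *\<^sub>R (- c))) (at_right t)"
    using assms unfolding has_vector_derivative_def by (auto intro!: derivative_eq_intros)
  from has_derivative_inner[OF this this]
  show ?thesis unfolding has_field_derivative_def power2_norm_eq_inner
    by (rule has_derivative_eq_rhs) (auto simp: inner_commute)
qed

text \<open>Monotonicity against the fixed subgradient a at v limits the growth rate of |S t v - v|
  to |a|. Squared distances are compared, since the norm itself is not differentiable at
  zero.\<close>

lemma semigroup_displacement:
  assumes S: "generates_semigroup Cop S" and v: "v \<in> K" "a \<in> subgrad X Y e v" and s: "0 \<le> s"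
  shows "norm (S s v - v) \<le> norm a * s"
proof (rule field_le_epsilon)
  fix \<epsilon>0 :: real assume e0: "0 < \<epsilon>0"
  define \<epsilon> where "\<epsilon> = \<epsilon>0 / (s + 1)"
  have e: "0 < \<epsilon>" "\<epsilon> * (s + 1) = \<epsilon>0" using e0 s unfolding \<epsilon>_def by auto
  have Cv: "Cop v \<noteq> {}" using subgrad_Cop v by blast
  note sol = generated_strong_solution[OF S Cv]
  \<comment> \<open>The intercept \<epsilon> keeps the barrier positive at a touching time, the
    extra slope \<epsilon> makes the derivative of f there strictly negative.\<close>
  define f where "f t = (norm (S t v - v))\<^sup>2 - ((norm a + \<epsilon>) * t + \<epsilon>)\<^sup>2" for t
  have "f s \<le> 0"
  proof (rule nonpos_of_right_derivative[OF _ _ _ s])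
    show "continuous_on {0..} f" unfolding f_def by (intro continuous_intros sol(2))
    show "f 0 \<le> 0" unfolding f_def by (simp add: sol(1))
    fix t assume t: "0 \<le> (t::real)" "f t = 0"
    define r where "r = (norm a + \<epsilon>) * t + \<epsilon>"
    have r: "0 < r" using t e unfolding r_def by (simp add: add_nonneg_pos)
    then have nr: "norm (S t v - v) = r" using t(2) unfolding f_def r_def[symmetric] by (simp add: power2_eq_iff_nonneg)
    obtain c where c: "c \<in> Cop (S t v)" "((\<lambda>s. S s v) has_vector_derivative - c) (at_right t)"
      using sol(3)[OF t(1)] by blast
    have "0 \<le> (c - a) \<bullet> (S t v - v)"
      using EK.subgrad_monotone[OF Cop_subset[OF c(1)] Cop_subset[OF subgrad_Cop[OF v(2,1)]]] .
    then have "- 2 * (c \<bullet> (S t v - v)) \<le> 2 * ((- a) \<bullet> (S t v - v))"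
      by (simp add: inner_diff_left)
    also have "\<dots> \<le> 2 * (norm (- a) * norm (S t v - v))" by (intro mult_left_mono norm_cauchy_schwarz) auto
    finally have le: "- 2 * (c \<bullet> (S t v - v)) \<le> 2 * (norm a * r)" unfolding nr norm_minus_cancel .
    have "(f has_real_derivative - 2 * (c \<bullet> (S t v - v)) - 2 * r * (norm a + \<epsilon>)) (at_right t)"
    proof -
      have "((\<lambda>t. ((norm a + \<epsilon>) * t + \<epsilon>)\<^sup>2) has_real_derivative 2 * r * (norm a + \<epsilon>)) (at_right t)"
        unfolding r_def by (auto intro!: derivative_eq_intros)
      from DERIV_diff[OF norm_sq_right_derivative[OF c(2), of v] this]
      show ?thesis unfolding f_def .
    qed
    moreover have "- 2 * (c \<bullet> (S t v - v)) - 2 * r * (norm a + \<epsilon>) < 0"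
    proof -
      have "2 * r * (norm a + \<epsilon>) = 2 * (norm a * r) + 2 * (r * \<epsilon>)" by (simp add: algebra_simps)
      then show ?thesis using le mult_pos_pos[OF r e(1)] by linarith
    qed
    ultimately show "\<exists>d<0. (f has_real_derivative d) (at_right t)" by blast
  qed
  then have "norm (S s v - v) \<le> (norm a + \<epsilon>) * s + \<epsilon>"
    unfolding f_def using s e by (simp add: abs_le_square_iff[symmetric])
  then show "norm (S s v - v) \<le> norm a * s + \<epsilon>0" using e(2) by (simp add: algebra_simps)
qed

text \<open>The bound is Kobayashi's with n\<tau> replaced by s and n\<tau>^2 by 0. Monotonicity
  against b = (z - z') / \<mu> yields a differential inequality for |S t v - z'|^2 with source |S t
  v - z|^2, and \<phi> solves it with equality: \<phi> j - \<phi> (j+1) is \<mu> times the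
  derivative of \<phi> (j+1).\<close>

lemma semigroup_euler_estimate:
  assumes S: "generates_semigroup Cop S" and v: "v \<in> K" "a \<in> subgrad X Y e v"
    and mu: "0 < \<mu>" and s: "0 \<le> s"
  shows "(norm (S s v - (EK.J \<mu> ^^ j) v))\<^sup>2 \<le> (norm a)\<^sup>2 * ((s - real j * \<mu>)\<^sup>2 + real j * \<mu>\<^sup>2)"
  using s
proof (induction j arbitrary: s)
  case 0
  have "(norm (S s v - v))\<^sup>2 \<le> (norm a * s)\<^sup>2"
    using semigroup_displacement[OF S v] 0 by (intro power_mono) auto
  then show ?case by (simp add: power_mult_distrib)
next
  case (Suc j)
  have Cv: "Cop v \<noteq> {}" using subgrad_Cop v by blast
  note sol = generated_strong_solution[OF S Cv]
  have vX: "v \<in> X" using v Kf.dom_subset by blast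
  define z where "z = (EK.J \<mu> ^^ j) v"
  define z' where "z' = EK.J \<mu> z"
  have zX: "z \<in> X" unfolding z_def using EK_iterate_in_K[OF mu v(1)] Kf.dom_subset by blast
  obtain b where b: "b \<in> subgrad X (Y \<inter> K) e z'" "z = z' + \<mu> *\<^sub>R b"
    using EK.subgrad_iff_variational[OF mu zX, of z'] EK.resolvent_variational[OF mu zX]
    unfolding z'_def by blast
  define \<phi> where "\<phi> k t = (norm a)\<^sup>2 * ((t - real k * \<mu>)\<^sup>2 + real k * \<mu>\<^sup>2)" for k t
  have IH: "(norm (S t v - z))\<^sup>2 \<le> \<phi> j t" if "0 \<le> t" for t
    using Suc.IH[OF that] unfolding z_def \<phi>_def .
  have "(norm (S s v - z'))\<^sup>2 \<le> \<phi> (Suc j) s + \<epsilon>" if e: "0 < \<epsilon>" for \<epsilon>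
  proof -
    \<comment> \<open>The shift by \<epsilon> makes the derivative at a touching time strictly
      negative, as the comparison principle demands.\<close>
    define f where "f t = (norm (S t v - z'))\<^sup>2 - \<phi> (Suc j) t - \<epsilon>" for t
    have "f s \<le> 0"
    proof (rule nonpos_of_right_derivative[OF _ _ _ Suc.prems])
      show "continuous_on {0..} f" unfolding f_def \<phi>_def by (intro continuous_intros sol(2))
      have a0: "a \<in> subgrad X (Y \<inter> K) e v" by (intro Cop_subset subgrad_Cop v)
      have "norm ((EK.J \<mu> ^^ Suc j) v - v) \<le> real (Suc j) * norm (EK.J \<mu> v - v)"
        using EK.resolvent_in_space[OF mu] EK.resolvent_nonexpansive[OF mu] vX
        by (intro funpow_displacement[where X=X and w=v]) auto
      also have "\<dots> \<le> real (Suc j) * (\<mu> * norm a)"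
        using EK.resolvent_dist_le[OF mu a0] by (intro mult_left_mono) auto
      finally have "(norm (v - z'))\<^sup>2 \<le> (real (Suc j) * (\<mu> * norm a))\<^sup>2"
        unfolding z'_def z_def by (intro power_mono) (auto simp: norm_minus_commute)
      also have "\<dots> = (norm a)\<^sup>2 * (0 - real (Suc j) * \<mu>)\<^sup>2" by (simp add: power_mult_distrib)
      also have "\<dots> \<le> \<phi> (Suc j) 0"
        unfolding \<phi>_def by (intro mult_left_mono) auto
      finally show "f 0 \<le> 0" using e unfolding f_def by (simp add: sol(1))
      fix t assume t: "0 \<le> (t::real)" "f t = 0"
      obtain c where c: "c \<in> Cop (S t v)" "((\<lambda>s. S s v) has_vector_derivative - c) (at_right t)"
        using sol(3)[OF t(1)] by blast
      define d where "d = t - real (Suc j) * \<mu>"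
      have "0 \<le> (c - b) \<bullet> (S t v - z')" using EK.subgrad_monotone[OF Cop_subset[OF c(1)] b(1)] .
      then have "\<mu> * (- 2 * (c \<bullet> (S t v - z'))) \<le> - 2 * ((\<mu> *\<^sub>R b) \<bullet> (S t v - z'))"
        using mu by (simp add: inner_diff_left)
      also have "\<mu> *\<^sub>R b = z - z'" using b(2) by simp
      also have "- 2 * ((z - z') \<bullet> (S t v - z')) =
          (norm (S t v - z))\<^sup>2 - (norm (S t v - z'))\<^sup>2 - (norm (z - z'))\<^sup>2"
        by (simp add: power2_norm_eq_inner inner_diff_left inner_diff_right inner_commute algebra_simps)
      also have "\<dots> \<le> \<phi> j t - (\<phi> (Suc j) t + \<epsilon>)"
        using IH[OF t(1)] t(2) zero_le_power2[of "norm (z - z')"] unfolding f_def by linarith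
      also have "\<phi> j t - (\<phi> (Suc j) t + \<epsilon>) = \<mu> * ((norm a)\<^sup>2 * (2 * d)) - \<epsilon>"
      proof -
        have e: "t - real j * \<mu> = d + \<mu>" unfolding d_def by (simp add: algebra_simps)
        show ?thesis unfolding \<phi>_def e d_def[symmetric] by (simp add: power2_eq_square algebra_simps)
      qed
      finally have "\<mu> * (- 2 * (c \<bullet> (S t v - z')) - (norm a)\<^sup>2 * (2 * d)) < 0"
        using e unfolding right_diff_distrib by linarith
      then have neg: "- 2 * (c \<bullet> (S t v - z')) - (norm a)\<^sup>2 * (2 * d) < 0"
        using mu by (metis mult_nonneg_nonneg not_less less_imp_le)
      have "(f has_real_derivative - 2 * (c \<bullet> (S t v - z')) - (norm a)\<^sup>2 * (2 * d)) (at_right t)"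
      proof -
        have "((\<lambda>t. \<phi> (Suc j) t + \<epsilon>) has_real_derivative (norm a)\<^sup>2 * (2 * d)) (at_right t)"
          unfolding \<phi>_def d_def by (auto intro!: derivative_eq_intros)
        from DERIV_diff[OF norm_sq_right_derivative[OF c(2), of z'] this]
        show ?thesis unfolding f_def by (simp add: diff_diff_eq)
      qed
      with neg show "\<exists>d<0. (f has_real_derivative d) (at_right t)" by blast
    qed
    then show ?thesis unfolding f_def by simp
  qed
  then have "(norm (S s v - z'))\<^sup>2 \<le> \<phi> (Suc j) s" by (rule field_le_epsilon)
  then show ?case unfolding z'_def z_def \<phi>_def by simp
qed

end

section \<open>Uniform convergence on bounded time intervals\<close>

context splitting
begin

lemma product_formula_strong:
  assumes S: "generates_semigroup Cop S" and v: "v \<in> K" "a \<in> subgrad X Y e v"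
    and T: "0 < T" and eps: "0 < \<epsilon>"
  shows "eventually (\<lambda>\<tau>. \<forall>t\<in>{0..T}. norm ((F \<tau> ^^ nat \<lfloor>t / \<tau>\<rfloor>) v - S t v) \<le> \<epsilon>) (at_right 0)"
proof -
  define M where "M = (norm a)\<^sup>2"
  have M: "0 \<le> M" unfolding M_def by simp
  \<comment> \<open>For \<tau> < \<mu> this expression bounds both quadratic estimates: rounding t
    to the two grids costs at most 2\<mu>, and n\<tau>^2 and j\<mu>^2 are each at most
    T\<mu>.\<close>
  have "((\<lambda>\<mu>. M * (4 * \<mu>\<^sup>2 + 2 * T * \<mu>)) \<longlongrightarrow> M * (4 * 0\<^sup>2 + 2 * T * 0)) (at_right 0)"
    by (intro tendsto_intros)
  then have "eventually (\<lambda>\<mu>. M * (4 * \<mu>\<^sup>2 + 2 * T * \<mu>) < (\<epsilon> / 3)\<^sup>2) (at_right 0)"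
    using eps by (intro order_tendstoD(2)) auto
  moreover note eventually_at_right_less[of "0::real"]
  ultimately have "eventually (\<lambda>\<mu>. M * (4 * \<mu>\<^sup>2 + 2 * T * \<mu>) < (\<epsilon> / 3)\<^sup>2 \<and> 0 < \<mu>) (at_right 0)"
    by eventually_elim auto
  then obtain \<mu> where mu: "0 < \<mu>" "M * (4 * \<mu>\<^sup>2 + 2 * T * \<mu>) < (\<epsilon> / 3)\<^sup>2"
    using eventually_happens[of _ "at_right (0::real)"] trivial_limit_at_right_real by blast
  define N where "N = nat \<lfloor>T / \<mu>\<rfloor>"
  \<comment> \<open>Once \<mu> is fixed only finitely many indices j occur, so convergence for each
    j is already uniform in t.\<close>
  have "eventually (\<lambda>\<tau>. \<forall>j\<in>{..N}. dist ((G \<mu> \<tau> ^^ j) v) ((EK.J \<mu> ^^ j) v) < \<epsilon> / 3) (at_right 0)"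
    using tendstoD[OF G_iterates_tendsto[OF mu(1) v(1)], of "\<epsilon> / 3"] eps
    by (intro eventually_ball_finite) auto
  moreover have "eventually (\<lambda>\<tau>. \<tau> \<in> {0<..<\<mu>}) (at_right 0)"
    using mu(1) by (intro eventually_at_rightI)
  ultimately show ?thesis
  proof eventually_elim
    case (elim \<tau>)
    then have tau: "0 < \<tau>" "\<tau> < \<mu>" by auto
    show ?case
    proof
      fix t assume t: "t \<in> {0..T}"
      define n where "n = nat \<lfloor>t / \<tau>\<rfloor>"
      define j where "j = nat \<lfloor>t / \<mu>\<rfloor>"
      have fl: "real (nat \<lfloor>t / h\<rfloor>) * h \<le> t" "t \<le> real (nat \<lfloor>t / h\<rfloor>) * h + h" if "0 < h" for h
      proof -
        have "real (nat \<lfloor>t / h\<rfloor>) = of_int \<lfloor>t / h\<rfloor>" using t that by simp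
        then have "real (nat \<lfloor>t / h\<rfloor>) \<le> t / h" "t / h \<le> real (nat \<lfloor>t / h\<rfloor>) + 1" by linarith+
        then show "real (nat \<lfloor>t / h\<rfloor>) * h \<le> t" "t \<le> real (nat \<lfloor>t / h\<rfloor>) * h + h"
          using that by (auto simp: field_simps)
      qed
      note n = fl[OF tau(1), folded n_def] and j = fl[OF mu(1), folded j_def]
      have jN: "j \<le> N"
        unfolding j_def N_def using t mu(1) by (intro nat_mono floor_mono divide_right_mono) auto
      have tT: "t * \<mu> \<le> T * \<mu>" using t mu(1) by (intro mult_right_mono) auto
      have "real j * \<mu>\<^sup>2 \<le> t * \<mu>"
        using mult_right_mono[OF j(1), of \<mu>] mu(1) by (simp add: power2_eq_square mult.assoc)
      then have j2: "real j * \<mu>\<^sup>2 \<le> T * \<mu>" using tT by linarith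
      have "real n * \<tau>\<^sup>2 \<le> t * \<tau>"
        using mult_right_mono[OF n(1), of \<tau>] tau(1) by (simp add: power2_eq_square mult.assoc)
      also have "t * \<tau> \<le> t * \<mu>" using t tau by (intro mult_left_mono) auto
      finally have n2: "real n * \<tau>\<^sup>2 \<le> T * \<mu>" using tT by linarith
      have "\<bar>real n * \<tau> - real j * \<mu>\<bar> \<le> 2 * \<mu>" using n j tau by linarith
      then have "(real n * \<tau> - real j * \<mu>)\<^sup>2 \<le> (2 * \<mu>)\<^sup>2" by (rule power2_le_iff_abs_le[THEN iffD2, rotated]) (use mu in simp)
      then have d1: "(real n * \<tau> - real j * \<mu>)\<^sup>2 + real n * \<tau>\<^sup>2 + real j * \<mu>\<^sup>2 \<le> 4 * \<mu>\<^sup>2 + 2 * T * \<mu>"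
        using n2 j2 by simp
      have "\<bar>t - real j * \<mu>\<bar> \<le> 2 * \<mu>" using j mu by linarith
      then have "(t - real j * \<mu>)\<^sup>2 \<le> (2 * \<mu>)\<^sup>2" by (rule power2_le_iff_abs_le[THEN iffD2, rotated]) (use mu in simp)
      moreover have "0 \<le> T * \<mu>" using T mu by simp
      ultimately have d2: "(t - real j * \<mu>)\<^sup>2 + real j * \<mu>\<^sup>2 \<le> 4 * \<mu>\<^sup>2 + 2 * T * \<mu>"
        using j2 by simp
      have small: "norm z \<le> \<epsilon> / 3" if "(norm z)\<^sup>2 \<le> M * d" "d \<le> 4 * \<mu>\<^sup>2 + 2 * T * \<mu>" for d and z :: 'a
      proof (rule power2_le_imp_le)
        have "M * d \<le> M * (4 * \<mu>\<^sup>2 + 2 * T * \<mu>)" using that(2) M by (rule mult_left_mono)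
        then show "(norm z)\<^sup>2 \<le> (\<epsilon> / 3)\<^sup>2" using that(1) mu(2) by linarith
      qed (use eps in simp)
      let ?f = "(F \<tau> ^^ n) v" and ?g = "(G \<mu> \<tau> ^^ j) v" and ?z = "(EK.J \<mu> ^^ j) v"
      have 1: "norm (?f - ?g) \<le> \<epsilon> / 3"
        using kobayashi_estimate[OF mu(1) tau(1) v, of n j] d1 unfolding M_def[symmetric] by (rule small)
      have 2: "norm (?g - ?z) \<le> \<epsilon> / 3" using elim jN unfolding dist_norm by (auto intro: less_imp_le)
      have 3: "norm (S t v - ?z) \<le> \<epsilon> / 3"
        using semigroup_euler_estimate[OF S v mu(1), of t j] t d2 unfolding M_def[symmetric]
        by (intro small) auto
      have "norm (?f - S t v) \<le> norm (?f - ?g) + norm (?g - ?z) + norm (S t v - ?z)"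
        using norm_triangle_ineq[of "?f - ?g" "?g - ?z"]
          norm_triangle_ineq4[of "(?f - ?g) + (?g - ?z)" "S t v - ?z"] by simp
      then show "norm ((F \<tau> ^^ nat \<lfloor>t / \<tau>\<rfloor>) v - S t v) \<le> \<epsilon>"
        using 1 2 3 unfolding n_def by linarith
    qed
  qed
qed

text \<open>Iterates of \<open>F \<tau>\<close> and the semigroup are both nonexpansive, so
  exchanging v for a nearby point w of the domain costs |v - w| twice.\<close>

theorem product_formula:
  assumes S: "generates_semigroup Cop S"
    and dense: "K \<subseteq> closure {v \<in> K. subgrad X Y e v \<noteq> {}}"
    and v: "v \<in> K" and T: "0 < T" and eps: "0 < \<epsilon>"
  shows "eventually (\<lambda>\<tau>. \<forall>t\<in>{0..T}. norm ((F \<tau> ^^ nat \<lfloor>t / \<tau>\<rfloor>) v - S t v) \<le> \<epsilon>) (at_right 0)"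
proof -
  have "v \<in> closure {v \<in> K. subgrad X Y e v \<noteq> {}}" using dense v by blast
  then obtain w where w: "w \<in> K" "subgrad X Y e w \<noteq> {}" "dist w v < \<epsilon> / 3"
    using closure_approachableD[of v "{v \<in> K. subgrad X Y e v \<noteq> {}}" "\<epsilon> / 3"] eps
    by (auto simp: dist_commute)
  then obtain a where a: "a \<in> subgrad X Y e w" by blast
  have wv: "norm (w - v) < \<epsilon> / 3" using w(3) unfolding dist_norm .
  have Q: "v \<in> closure {v. Cop v \<noteq> {}}" "w \<in> closure {v. Cop v \<noteq> {}}"
    using dense v w(1) unfolding Cop_dom by blast+
  have con: "norm (S t v - S t w) \<le> norm (v - w)" if "0 \<le> t" for t
  proof -
    have "\<forall>t\<ge>0. \<forall>v\<in>closure {v. Cop v \<noteq> {}}. \<forall>w\<in>closure {v. Cop v \<noteq> {}}. norm (S t v - S t w) \<le> norm (v - w)"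
      using S unfolding generates_semigroup_def Let_def by (elim conjE)
    then show ?thesis using Q that by simp
  qed
  have "eventually (\<lambda>\<tau>. \<forall>t\<in>{0..T}. norm ((F \<tau> ^^ nat \<lfloor>t / \<tau>\<rfloor>) w - S t w) \<le> \<epsilon> / 3) (at_right 0)"
    using product_formula_strong[OF S w(1) a T, of "\<epsilon> / 3"] eps by simp
  moreover note eventually_at_right_less[of "0::real"]
  ultimately show ?thesis
  proof eventually_elim
    case (elim \<tau>)
    show ?case
    proof
      fix t assume t: "t \<in> {0..T}"
      let ?n = "nat \<lfloor>t / \<tau>\<rfloor>"
      have KX: "K \<subseteq> X" by (rule Kf.dom_subset)
      have 1: "norm ((F \<tau> ^^ ?n) v - (F \<tau> ^^ ?n) w) \<le> norm (v - w)"
        using v w(1) KX F_in_K[OF elim(2)]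
        by (intro funpow_nonexpansive[where X=X] F_nonexpansive[OF elim(2)]) auto
      have 2: "norm ((F \<tau> ^^ ?n) w - S t w) \<le> \<epsilon> / 3" using elim(1) t by blast
      have 3: "norm (S t v - S t w) \<le> norm (v - w)" using con t by simp
      have "norm ((F \<tau> ^^ ?n) v - S t v) \<le>
          norm ((F \<tau> ^^ ?n) v - (F \<tau> ^^ ?n) w) + norm ((F \<tau> ^^ ?n) w - S t w) + norm (S t v - S t w)"
        using norm_triangle_ineq[of "(F \<tau> ^^ ?n) v - (F \<tau> ^^ ?n) w" "(F \<tau> ^^ ?n) w - S t w"]
          norm_triangle_ineq4[of "(F \<tau> ^^ ?n) v - S t w" "S t v - S t w"] by simp
      then show "norm ((F \<tau> ^^ ?n) v - S t v) \<le> \<epsilon>"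
        using 1 2 3 wv norm_minus_commute[of v w] by linarith
    qed
  qed
qed

end

section \<open>The space of square-integrable functions\<close>

lemma l2_rel_refl_iff: "l2_rel f f \<longleftrightarrow> square_integrable f"
  by (auto simp: l2_rel_def)

lemma square_integrable_rep: "square_integrable (rep_l2 v)"
  using Quotient_rep_reflp[OF Quotient_l2, of v] by (simp add: l2_rel_refl_iff)

lemma measurable_rep [measurable]: "rep_l2 v \<in> borel_measurable borel"
  using square_integrable_rep[of v] by (simp add: square_integrable_def)

lemma abs_rep_l2: "abs_l2 (rep_l2 v) = v"
  by (rule Quotient_abs_rep[OF Quotient_l2])

lemma rep_abs_l2:
  assumes "square_integrable f"
  shows "AE x in lborel. rep_l2 (abs_l2 f) x = f x"
  using Quotient_rep_abs[OF Quotient_l2, of f] assms by (simp add: l2_rel_refl_iff l2_rel_def)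

lemma abs_l2_eqI:
  assumes "square_integrable f" "square_integrable g" "AE x in lborel. f x = g x"
  shows "abs_l2 f = abs_l2 g"
  using Quotient_rel_abs[OF Quotient_l2, of f g] assms by (simp add: l2_rel_def)

lemma abs_l2_add:
  "square_integrable f \<Longrightarrow> square_integrable g \<Longrightarrow> abs_l2 f + abs_l2 g = abs_l2 (\<lambda>x. f x + g x)"
  by (rule plus_l2.abs_eq) (simp_all add: l2_rel_refl_iff)

lemma abs_l2_diff:
  "square_integrable f \<Longrightarrow> square_integrable g \<Longrightarrow> abs_l2 f - abs_l2 g = abs_l2 (\<lambda>x. f x - g x)"
  by (rule minus_l2.abs_eq) (simp_all add: l2_rel_refl_iff)

lemma abs_l2_scale: "square_integrable f \<Longrightarrow> c *\<^sub>R abs_l2 f = abs_l2 (\<lambda>x. c * f x)"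
  by (rule scaleR_l2.abs_eq) (simp add: l2_rel_refl_iff)

lemma abs_l2_inner:
  "square_integrable f \<Longrightarrow> square_integrable g \<Longrightarrow> inner (abs_l2 f) (abs_l2 g) = (\<integral>x. f x * g x \<partial>lborel)"
  by (rule inner_l2.abs_eq) (simp_all add: l2_rel_refl_iff)

lemma abs_l2_norm: "square_integrable f \<Longrightarrow> (norm (abs_l2 f))\<^sup>2 = (\<integral>x. (f x)\<^sup>2 \<partial>lborel)"
  unfolding power2_norm_eq_inner by (simp add: abs_l2_inner power2_eq_square)

lemma rep_l2_add: "AE x in lborel. rep_l2 (v + w) x = rep_l2 v x + rep_l2 w x"
  using rep_abs_l2[OF square_integrable_add[OF square_integrable_rep square_integrable_rep], of v w]
    abs_l2_add[OF square_integrable_rep square_integrable_rep, of v w] by (simp add: abs_rep_l2)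

lemma rep_l2_scale: "AE x in lborel. rep_l2 (c *\<^sub>R v) x = c * rep_l2 v x"
  using rep_abs_l2[OF square_integrable_scale[OF square_integrable_rep], of c v]
    abs_l2_scale[OF square_integrable_rep, of c v] by (simp add: abs_rep_l2)

lemma rep_l2_zero: "AE x in lborel. rep_l2 0 x = 0"
  using rep_abs_l2[OF square_integrable_zero] by (simp add: zero_l2.abs_eq[symmetric])

lemma square_integrable_le:
  assumes "square_integrable g" "f \<in> borel_measurable lborel" "\<And>x. \<bar>f x\<bar> \<le> \<bar>g x\<bar>"
  shows "square_integrable f"
proof -
  have le: "norm ((f x)\<^sup>2) \<le> norm ((g x)\<^sup>2)" for x
    using assms(3)[of x] unfolding abs_le_square_iff by simp
  have m: "(\<lambda>x. (f x)\<^sup>2) \<in> borel_measurable lborel" using assms(2) by (rule borel_measurable_power)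
  have "integrable lborel (\<lambda>x. (g x)\<^sup>2)" using assms(1) unfolding square_integrable_def by blast
  from Bochner_Integration.integrable_bound[OF this m AE_I2[OF le]]
  have "integrable lborel (\<lambda>x. (f x)\<^sup>2)" .
  then show ?thesis using assms(2) unfolding square_integrable_def by blast
qed

lemma norm_abs_l2_le:
  assumes "square_integrable f" "square_integrable g" "AE x in lborel. \<bar>f x\<bar> \<le> \<bar>g x\<bar>"
  shows "norm (abs_l2 f) \<le> norm (abs_l2 g)"
proof (rule power2_le_imp_le)
  show "(norm (abs_l2 f))\<^sup>2 \<le> (norm (abs_l2 g))\<^sup>2"
    unfolding abs_l2_norm[OF assms(1)] abs_l2_norm[OF assms(2)]
  proof (rule integral_mono_AE)
    show "AE x in lborel. (f x)\<^sup>2 \<le> (g x)\<^sup>2"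
      using assms(3) by eventually_elim (simp only: abs_le_square_iff)
  qed (use assms(1,2) in \<open>auto simp: square_integrable_def\<close>)
qed simp

text \<open>Riesz-Fischer: along a subsequence with \<open>\<parallel>f\<^sub>k - f\<^sub>l\<parallel>\<^sup>2 < 4\<^sup>-\<^sup>k\<close> for \<open>l \<ge> k\<close>, the weighted
  series \<open>\<Sum> 2\<^sup>k \<bar>f\<^sub>k\<^sub>+\<^sub>1 - f\<^sub>k\<bar>\<^sup>2\<close> has finite integral, so \<open>f\<^sub>k(x)\<close> is Cauchy for almost every \<open>x\<close>.\<close>

lemma complete_l2: "complete (UNIV :: l2 set)"
proof (rule completeI)
  fix xs :: "nat \<Rightarrow> l2" assume xs: "Cauchy xs"
  have "\<exists>N. \<forall>m\<ge>N. \<forall>n\<ge>N. (norm (xs m - xs n))\<^sup>2 < (1/4) ^ k" for k :: nat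
  proof -
    have "0 < sqrt ((1/4) ^ k)" by simp
    then obtain N where N: "\<forall>m\<ge>N. \<forall>n\<ge>N. norm (xs m - xs n) < sqrt ((1/4) ^ k)"
      using xs unfolding Cauchy_def dist_norm by blast
    have "(norm (xs m - xs n))\<^sup>2 < (1/4) ^ k" if "m \<ge> N" "n \<ge> N" for m n
      using N that power_strict_mono[of "norm (xs m - xs n)" "sqrt ((1/4) ^ k)" 2] by auto
    then show ?thesis by blast
  qed
  then obtain N where N: "\<And>k m n. m \<ge> N k \<Longrightarrow> n \<ge> N k \<Longrightarrow> (norm (xs m - xs n))\<^sup>2 < (1/4) ^ k"
    by metis
  \<comment> \<open>The sum exceeds \<open>N k\<close>, and the summand k makes p strictly
    increasing.\<close>
  define p where "p k = (\<Sum>i\<le>k. N i) + k" for k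
  have pN: "N k \<le> p k" for k
    unfolding p_def using member_le_sum[of k "{..k}" N] by simp
  have pmono: "p k \<le> p l" if "k \<le> l" for k l
    unfolding p_def using that by (intro add_mono sum_mono2) auto
  define f where "f k = rep_l2 (xs (p k))" for k
  have f_meas [measurable]: "f k \<in> borel_measurable borel" for k unfolding f_def by measurable
  have d: "(norm (xs (p k) - xs (p l)))\<^sup>2 \<le> (1/4) ^ k" if "k \<le> l" for k l
    using N[of k "p k" "p l"] pN[of k] pmono[OF that] by auto
  have sq: "square_integrable (\<lambda>x. f k x - f l x)" for k l
    unfolding f_def by (intro square_integrable_diff square_integrable_rep)
  have dI: "(\<integral>\<^sup>+x. ennreal ((f k x - f l x)\<^sup>2) \<partial>lborel) \<le> ennreal ((1/4) ^ k)" if "k \<le> l" for k l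
  proof -
    have "xs (p k) - xs (p l) = abs_l2 (\<lambda>x. f k x - f l x)"
      unfolding f_def by (simp add: abs_l2_diff[symmetric] square_integrable_rep abs_rep_l2)
    then have "(\<integral>x. (f k x - f l x)\<^sup>2 \<partial>lborel) \<le> (1/4) ^ k"
      using d[OF that] abs_l2_norm[OF sq] by simp
    then show ?thesis
      using sq[of k l] unfolding square_integrable_def
      by (subst nn_integral_eq_integral) (auto intro!: ennreal_leI)
  qed
  have "(\<integral>\<^sup>+x. (\<Sum>k. ennreal (2 ^ k * (f k x - f (Suc k) x)\<^sup>2)) \<partial>lborel) =
      (\<Sum>k. \<integral>\<^sup>+x. ennreal (2 ^ k * (f k x - f (Suc k) x)\<^sup>2) \<partial>lborel)"
    by (intro nn_integral_suminf) measurable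
  also have "\<dots> \<le> (\<Sum>k. ennreal ((1/2) ^ k))"
  proof (intro suminf_le summableI)
    fix k
    have "(\<integral>\<^sup>+x. ennreal (2 ^ k * (f k x - f (Suc k) x)\<^sup>2) \<partial>lborel) =
        ennreal (2 ^ k) * (\<integral>\<^sup>+x. ennreal ((f k x - f (Suc k) x)\<^sup>2) \<partial>lborel)"
      by (simp add: ennreal_mult nn_integral_cmult)
    also have "\<dots> \<le> ennreal (2 ^ k) * ennreal ((1/4) ^ k)"
      by (intro mult_left_mono dI) auto
    also have "\<dots> = ennreal ((1/2) ^ k)"
      by (simp add: ennreal_mult[symmetric] power_mult_distrib[symmetric])
    finally show "(\<integral>\<^sup>+x. ennreal (2 ^ k * (f k x - f (Suc k) x)\<^sup>2) \<partial>lborel) \<le> ennreal ((1/2) ^ k)" .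
  qed
  also have "\<dots> < \<infinity>"
    by (subst suminf_ennreal2) (auto intro: summable_geometric)
  finally have "AE x in lborel. (\<Sum>k. ennreal (2 ^ k * (f k x - f (Suc k) x)\<^sup>2)) \<noteq> \<infinity>"
    by (intro nn_integral_noteq_infinite) auto
  then have conv: "AE x in lborel. convergent (\<lambda>k. f k x)"
  proof eventually_elim
    case (elim x)
    define h where "h k = ennreal (2 ^ k * (f k x - f (Suc k) x)\<^sup>2)" for k
    have h: "suminf h < top" using elim unfolding h_def by (simp add: less_top)
    define C where "C = enn2real (suminf h)"
    have le: "2 ^ k * (f k x - f (Suc k) x)\<^sup>2 \<le> C" for k
    proof -
      have "h k \<le> suminf h" using sum_le_suminf[of h "{k}"] by simp
      from enn2real_mono[OF this h] have "enn2real (h k) \<le> C" unfolding C_def .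
      moreover have "enn2real (h k) = 2 ^ k * (f k x - f (Suc k) x)\<^sup>2"
        unfolding h_def by (rule enn2real_ennreal) simp
      ultimately show ?thesis by simp
    qed
    have C: "0 \<le> C" unfolding C_def by simp
    \<comment> \<open>A bound on the weighted terms of the series means geometric decay of the
      increments at x, so the telescoping sum converges.\<close>
    have b: "\<bar>f (Suc k) x - f k x\<bar> \<le> sqrt C * (sqrt (1/2)) ^ k" for k
    proof (rule power2_le_imp_le)
      have "(f (Suc k) x - f k x)\<^sup>2 \<le> C * (1/2) ^ k"
        using le[of k] by (simp add: power2_commute field_simps)
      then show "\<bar>f (Suc k) x - f k x\<bar>\<^sup>2 \<le> (sqrt C * (sqrt (1/2)) ^ k)\<^sup>2"
        using C by (simp add: power_mult_distrib power_mult[symmetric] mult.commute[of k]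
            del: power_mult) (simp add: power_mult real_sqrt_divide power_divide)
    qed (use C in simp)
    have "summable (\<lambda>k. sqrt C * (sqrt (1/2)) ^ k)"
      by (intro summable_mult summable_geometric) (simp add: real_sqrt_divide)
    then have "summable (\<lambda>k. f (Suc k) x - f k x)"
      by (rule summable_comparison_test') (use b in auto)
    then have "convergent (\<lambda>n. f n x - f 0 x)"
      using sum_lessThan_telescope[of "\<lambda>n. f n x"]
      unfolding summable_iff_convergent by simp
    then show ?case
      using convergent_add_const_right_iff[of "\<lambda>n. f n x" "- f 0 x"] by simp
  qed
  define g where "g x = lim (\<lambda>k. f k x)" for x
  have [measurable]: "g \<in> borel_measurable borel"
    unfolding g_def by (rule borel_measurable_lim_metric) measurable
  \<comment> \<open>Fatou's lemma in l carries the bound over to the pointwise limit.\<close>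
  have gI: "(\<integral>\<^sup>+x. ennreal ((f k x - g x)\<^sup>2) \<partial>lborel) \<le> ennreal ((1/4) ^ k)" for k
  proof -
    have "(\<integral>\<^sup>+x. ennreal ((f k x - g x)\<^sup>2) \<partial>lborel) =
        (\<integral>\<^sup>+x. liminf (\<lambda>l. ennreal ((f k x - f l x)\<^sup>2)) \<partial>lborel)"
    proof (rule nn_integral_cong_AE)
      show "AE x in lborel. ennreal ((f k x - g x)\<^sup>2) = liminf (\<lambda>l. ennreal ((f k x - f l x)\<^sup>2))"
        using conv
      proof eventually_elim
        case (elim x)
        then have "(\<lambda>l. f l x) \<longlonglongrightarrow> g x" unfolding g_def by (simp add: convergent_LIMSEQ_iff)
        then have "(\<lambda>l. ennreal ((f k x - f l x)\<^sup>2)) \<longlonglongrightarrow> ennreal ((f k x - g x)\<^sup>2)"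
          by (intro tendsto_intros)
        from lim_imp_Liminf[OF _ this] show ?case by simp
      qed
    qed
    also have "\<dots> \<le> liminf (\<lambda>l. \<integral>\<^sup>+x. ennreal ((f k x - f l x)\<^sup>2) \<partial>lborel)"
      by (intro nn_integral_liminf) measurable
    also have "\<dots> \<le> liminf (\<lambda>l. ennreal ((1/4) ^ k))"
      by (intro Liminf_mono eventually_sequentiallyI[of k] dI)
    also have "\<dots> = ennreal ((1/4) ^ k)" by (simp add: Liminf_const)
    finally show ?thesis .
  qed
  have sqg: "square_integrable (\<lambda>x. f k x - g x)" for k
    unfolding square_integrable_def
  proof
    show "integrable lborel (\<lambda>x. (f k x - g x)\<^sup>2)"
      using gI[of k] by (intro integrableI_nonneg) (auto simp: le_less_trans[OF _ ennreal_less_top])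
  qed measurable
  have g: "square_integrable g"
    using square_integrable_diff[OF square_integrable_rep sqg, of "xs (p 0)" 0] unfolding f_def by simp
  have gk: "(norm (xs (p k) - abs_l2 g))\<^sup>2 \<le> (1/4) ^ k" for k
  proof -
    have "xs (p k) - abs_l2 g = abs_l2 (\<lambda>x. f k x - g x)"
      unfolding f_def by (simp add: abs_l2_diff[symmetric] square_integrable_rep g abs_rep_l2)
    then have "(norm (xs (p k) - abs_l2 g))\<^sup>2 = (\<integral>x. (f k x - g x)\<^sup>2 \<partial>lborel)"
      using abs_l2_norm[OF sqg] by simp
    also have "ennreal (\<integral>x. (f k x - g x)\<^sup>2 \<partial>lborel) \<le> ennreal ((1/4) ^ k)"
      using gI[of k] sqg[of k] unfolding square_integrable_def
      by (subst (asm) nn_integral_eq_integral) auto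
    then have "(\<integral>x. (f k x - g x)\<^sup>2 \<partial>lborel) \<le> (1/4) ^ k" by (simp add: ennreal_le_iff)
    finally show ?thesis .
  qed
  have "(\<lambda>k. (norm (xs (p k) - abs_l2 g))\<^sup>2) \<longlonglongrightarrow> 0"
  proof (rule Lim_null_comparison)
    show "(\<lambda>k. (1/4::real) ^ k) \<longlonglongrightarrow> 0" by (intro LIMSEQ_power_zero) simp
  qed (use gk in auto)
  then have "(\<lambda>k. norm (xs (p k) - abs_l2 g)) \<longlonglongrightarrow> 0"
    using tendsto_real_sqrt[of "\<lambda>k. (norm (xs (p k) - abs_l2 g))\<^sup>2" 0] by simp
  then have "(\<lambda>k. xs (p k)) \<longlonglongrightarrow> abs_l2 g"
    using Lim_null tendsto_norm_zero_iff by blast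
  moreover have "strict_mono p"
    unfolding p_def by (rule strict_mono_Suc_iff[THEN iffD2]) simp
  ultimately have "xs \<longlonglongrightarrow> abs_l2 g"
    using Cauchy_converges_subseq[OF xs, of p] by (simp add: o_def)
  then show "\<exists>l\<in>UNIV. xs \<longlonglongrightarrow> l" by blast
qed

section \<open>The constraint and the relaxed area\<close>

lemma abs_l2_eq_zero_iff:
  assumes "square_integrable f"
  shows "abs_l2 f = 0 \<longleftrightarrow> (AE x in lborel. f x = 0)"
proof
  assume "abs_l2 f = 0"
  then show "AE x in lborel. f x = 0"
    using rep_abs_l2[OF assms] rep_l2_zero by (auto elim: eventually_elim2)
next
  assume "AE x in lborel. f x = 0"
  then show "abs_l2 f = 0"
    unfolding zero_l2.abs_eq by (intro abs_l2_eqI assms square_integrable_zero)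
qed

text \<open>The superposition operator sending v to h(x, v(x)) is 1-Lipschitz in L2, so its zero set
  is closed. Restriction to the complement of D and the negative part on D are the two uses.\<close>

lemma closed_pointwise_zero:
  fixes h :: "real^2 \<Rightarrow> real \<Rightarrow> real"
  assumes meas: "\<And>f. f \<in> borel_measurable borel \<Longrightarrow> (\<lambda>x. h x (f x)) \<in> borel_measurable borel"
    and lip: "\<And>x a b. \<bar>h x a - h x b\<bar> \<le> \<bar>a - b\<bar>" and zero: "\<And>x. h x 0 = 0"
  shows "closed {v. AE x in lborel. h x (rep_l2 v x) = 0}"
proof -
  have sq: "square_integrable (\<lambda>x. h x (rep_l2 v x))" for v
    using meas[OF measurable_rep] lip[of _ _ 0]
    by (intro square_integrable_le[OF square_integrable_rep[of v]]) (auto simp: zero)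
  define H where "H v = abs_l2 (\<lambda>x. h x (rep_l2 v x))" for v
  have "norm (H v - H w) \<le> norm (v - w)" for v w
  proof -
    have "H v - H w = abs_l2 (\<lambda>x. h x (rep_l2 v x) - h x (rep_l2 w x))"
      unfolding H_def by (intro abs_l2_diff sq)
    also have "norm \<dots> \<le> norm (abs_l2 (\<lambda>x. rep_l2 v x - rep_l2 w x))"
      by (intro norm_abs_l2_le square_integrable_diff sq square_integrable_rep) (use lip in auto)
    also have "abs_l2 (\<lambda>x. rep_l2 v x - rep_l2 w x) = v - w"
      by (simp add: abs_l2_diff[symmetric] square_integrable_rep abs_rep_l2)
    finally show ?thesis .
  qed
  then have "1-lipschitz_on UNIV H"
    by (intro lipschitz_onI) (auto simp: dist_norm)
  then have "continuous_on UNIV H" by (rule lipschitz_on_continuous_on)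
  then have "closed {v. H v = 0}" by (intro closed_Collect_eq continuous_on_const)
  then show ?thesis unfolding H_def abs_l2_eq_zero_iff[OF sq] .
qed

locale finite_domain =
  fixes D :: "(real^2) set"
  assumes open_D: "open D" and ne_D: "D \<noteq> {}" and finite_D: "emeasure lborel D < \<infinity>"
begin

lemma sets_D [measurable]: "D \<in> sets borel"
  using open_D by simp

lemma square_integrable_indicator: "square_integrable (indicator D)"
proof -
  have "(\<lambda>x. (indicator D x :: real)\<^sup>2) = indicator D" by (auto simp: indicator_def)
  then show ?thesis unfolding square_integrable_def using finite_D by simp
qed

text \<open>Zero mean becomes orthogonality to this vector, which makes \<open>X1 D\<close> a closed
  subspace and lets the constant \<lambda> be removed by projection.\<close>

definition oneD :: l2 where "oneD = abs_l2 (indicator D)"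

lemma inner_oneD: "v \<bullet> oneD = (LINT x:D|lborel. rep_l2 v x)"
proof -
  have "v \<bullet> oneD = (\<integral>x. rep_l2 v x * indicator D x \<partial>lborel)"
    unfolding oneD_def by (subst (1) abs_rep_l2[symmetric], rule abs_l2_inner)
      (rule square_integrable_rep square_integrable_indicator)+
  then show ?thesis unfolding set_lebesgue_integral_def by (simp add: mult.commute)
qed

lemma norm_oneD: "(norm oneD)\<^sup>2 = measure lborel D"
proof -
  have "(\<lambda>x. (indicator D x :: real)\<^sup>2) = indicator D" by (auto simp: indicator_def)
  then show ?thesis unfolding oneD_def abs_l2_norm[OF square_integrable_indicator] by simp
qed

lemma measure_D_pos: "0 < measure lborel D"
proof -
  have "D \<notin> null_sets lborel"
    using open_not_negligible[OF open_D ne_D] null_sets_completionI[of D lborel]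
    unfolding negligible_iff_null_sets by blast
  then have "emeasure lborel D \<noteq> 0" by (auto simp: null_sets_def)
  then show ?thesis using finite_D by (simp add: measure_def enn2real_positive_iff zero_less_iff_neq_zero)
qed

lemma X1_eq: "X1 D = {v \<in> L2_on D. v \<bullet> oneD = 0}"
  unfolding X1_def inner_oneD ..

lemma L2_on_eq: "L2_on D = {v. AE x in lborel. (1 - indicator D x) * rep_l2 v x = 0}"
  unfolding L2_on_def by (simp add: indicator_def imp_conv_disj disj_commute)

lemma closed_L2_on: "closed (L2_on D)"
  unfolding L2_on_eq
proof (rule closed_pointwise_zero)
  fix x :: "real^2" and a b :: real
  show "\<bar>(1 - indicator D x) * a - (1 - indicator D x) * b\<bar> \<le> \<bar>a - b\<bar>" by (auto simp: indicator_def)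
qed auto

lemma subspace_L2_on: "subspace (L2_on D)"
proof (rule subspaceI)
  show "0 \<in> L2_on D" unfolding L2_on_def using rep_l2_zero by (auto elim: eventually_mono)
next
  fix v w assume "v \<in> L2_on D" "w \<in> L2_on D"
  then have "AE x in lborel. x \<notin> D \<longrightarrow> rep_l2 v x = 0" "AE x in lborel. x \<notin> D \<longrightarrow> rep_l2 w x = 0"
    unfolding L2_on_def by auto
  then show "v + w \<in> L2_on D"
    unfolding L2_on_def mem_Collect_eq using rep_l2_add[of v w] by eventually_elim auto
next
  fix c v assume "v \<in> L2_on D"
  then have "AE x in lborel. x \<notin> D \<longrightarrow> rep_l2 v x = 0" unfolding L2_on_def by auto
  then show "c *\<^sub>R v \<in> L2_on D"
    unfolding L2_on_def mem_Collect_eq using rep_l2_scale[of c v] by eventually_elim auto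
qed

lemma subspace_X1: "subspace (X1 D)"
proof -
  have "X1 D = L2_on D \<inter> {v. v \<bullet> oneD = 0}" unfolding X1_eq by auto
  then show ?thesis
    using subspace_L2_on subspace_hyperplane[of oneD] by (auto intro!: subspace_inter simp: inner_commute)
qed

lemma closed_X1: "closed (X1 D)"
proof -
  have "closed {v. v \<bullet> oneD = 0}" by (intro closed_Collect_eq continuous_intros)
  then show ?thesis unfolding X1_eq using closed_L2_on by (simp add: Collect_conj_eq closed_Int)
qed

lemma complete_X1: "complete (X1 D)"
  using complete_Int_closed[OF complete_l2 closed_X1] by simp

lemma closed_nonneg_on: "closed {v. AE x in lborel. x \<in> D \<longrightarrow> 0 \<le> rep_l2 v x}"
proof -
  have "closed {v. AE x in lborel. indicator D x * min 0 (rep_l2 v x) = 0}"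
    by (rule closed_pointwise_zero) (auto simp: indicator_def min_def)
  moreover have "(indicator D x * min 0 a = 0) \<longleftrightarrow> (x \<in> D \<longrightarrow> 0 \<le> a)" for x and a :: real
    by (auto simp: indicator_def min_def)
  ultimately show ?thesis by simp
qed

text \<open>Values of size at least 1 occur only on a compact set, so \<phi> is bounded on D, and D
  has finite measure.\<close>

lemma C0_square_integrable:
  assumes "\<phi> \<in> C0 D"
  shows "square_integrable (\<lambda>x. indicator D x * \<phi> x)"
proof -
  have cont: "continuous_on D \<phi>" and cpt: "compact {x\<in>D. 1 \<le> \<bar>\<phi> x\<bar>}" using assms unfolding C0_def by auto
  have "compact (\<phi> ` {x\<in>D. 1 \<le> \<bar>\<phi> x\<bar>})"
    by (intro compact_continuous_image cpt continuous_on_subset[OF cont]) auto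
  then obtain B where B: "\<And>x. x \<in> D \<Longrightarrow> 1 \<le> \<bar>\<phi> x\<bar> \<Longrightarrow> \<bar>\<phi> x\<bar> \<le> B"
    using compact_imp_bounded[THEN bounded_iff[THEN iffD1]] by fastforce
  have meas: "(\<lambda>x. indicator D x * \<phi> x) \<in> borel_measurable lborel"
    using borel_measurable_continuous_on_indicator[OF sets_D cont] by simp
  have "\<bar>indicator D x * \<phi> x\<bar> \<le> \<bar>max 1 B * indicator D x\<bar>" for x
    using B[of x] by (cases "1 \<le> \<bar>\<phi> x\<bar>") (auto simp: indicator_def)
  then show ?thesis
    by (rule square_integrable_le[OF square_integrable_scale[OF square_integrable_indicator] meas])
qed

end

section \<open>Convexity and lower semicontinuity of the relaxed area\<close>

definition admissible :: "(real^2) set \<Rightarrow> (real^2 \<Rightarrow> real) set" where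
  "admissible D = {\<phi> \<in> C0 D. C1_on D \<phi>}"

definition graph_area :: "(real^2) set \<Rightarrow> (real^2 \<Rightarrow> real) \<Rightarrow> ennreal" where
  "graph_area D \<phi> = (\<integral>\<^sup>+x\<in>D. ennreal (sqrt (1 + (norm (gradient \<phi> x))\<^sup>2)) \<partial>lborel)"

lemma gradient_eqI: "GDERIV f x :> d \<Longrightarrow> gradient f x = d"
  unfolding gradient_def
proof (rule the_equality)
  fix d' assume "GDERIV f x :> d" "GDERIV f x :> d'"
  then have "(\<lambda>h. h \<bullet> d) = (\<lambda>h. h \<bullet> d')"
    unfolding gderiv_def by (rule has_derivative_unique)
  then have "(d - d') \<bullet> d = (d - d') \<bullet> d'" by metis
  then have "(d - d') \<bullet> (d - d') = 0" by (simp add: inner_diff_right)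
  then show "d' = d" by simp
qed

lemma gderiv_gradient:
  fixes f :: "'a::euclidean_space \<Rightarrow> real"
  assumes "f differentiable (at x)"
  shows "GDERIV f x :> gradient f x"
proof -
  obtain f' where f': "(f has_derivative f') (at x)" using assms unfolding differentiable_def by blast
  then have "linear f'" by (rule has_derivative_linear)
  then have "f' = (\<lambda>h. h \<bullet> adjoint f' 1)" using adjoint_works[of f' _ 1] by auto
  then have "GDERIV f x :> adjoint f' 1" using f' unfolding gderiv_def by metis
  then show ?thesis using gradient_eqI by metis
qed

text \<open>The root is the norm of the pair (1, a), so this is the triangle inequality.\<close>

lemma sqrt_one_plus_convex:
  fixes a b :: "'a::real_inner"
  assumes "0 \<le> t" "t \<le> 1"
  shows "sqrt (1 + (norm ((1 - t) *\<^sub>R a + t *\<^sub>R b))\<^sup>2) \<le>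
    (1 - t) * sqrt (1 + (norm a)\<^sup>2) + t * sqrt (1 + (norm b)\<^sup>2)"
proof -
  have eq: "sqrt (1 + (norm c)\<^sup>2) = norm (1::real, c)" for c :: 'a by (simp add: norm_Pair)
  have "(1, (1 - t) *\<^sub>R a + t *\<^sub>R b) = (1 - t) *\<^sub>R (1::real, a) + t *\<^sub>R (1, b)" by simp
  then have "norm (1::real, (1 - t) *\<^sub>R a + t *\<^sub>R b) \<le> norm ((1 - t) *\<^sub>R (1::real, a)) + norm (t *\<^sub>R (1::real, b))"
    by (metis norm_triangle_ineq)
  then show ?thesis unfolding eq using assms by (simp del: scaleR_Pair)
qed

context finite_domain
begin

text \<open>Where both functions are below e / M the combination is below e. Its superlevel set is
  thus relatively closed in D and contained in a compact subset of D.\<close>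

lemma C0_lincomb:
  assumes "\<phi> \<in> C0 D" "\<psi> \<in> C0 D"
  shows "(\<lambda>x. a * \<phi> x + b * \<psi> x) \<in> C0 D"
proof -
  let ?f = "\<lambda>x. a * \<phi> x + b * \<psi> x"
  define M where "M = \<bar>a\<bar> + \<bar>b\<bar> + 1"
  have M: "0 < M" "\<bar>a\<bar> + \<bar>b\<bar> \<le> M" unfolding M_def by auto
  have cont: "continuous_on D \<phi>" "continuous_on D \<psi>" using assms unfolding C0_def by auto
  then have cf: "continuous_on D ?f" by (intro continuous_intros)
  have "compact {x\<in>D. e \<le> \<bar>?f x\<bar>}" if e: "0 < e" for e
  proof -
    let ?C = "{x\<in>D. e / M \<le> \<bar>\<phi> x\<bar>} \<union> {x\<in>D. e / M \<le> \<bar>\<psi> x\<bar>}"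
    have C: "compact ?C" using assms e M unfolding C0_def by (intro compact_Un) auto
    have sub: "{x\<in>D. e \<le> \<bar>?f x\<bar>} \<subseteq> ?C"
    proof
      fix x assume x: "x \<in> {x\<in>D. e \<le> \<bar>?f x\<bar>}"
      show "x \<in> ?C"
      proof (rule ccontr)
        assume "x \<notin> ?C"
        then have s: "\<bar>\<phi> x\<bar> < e / M" "\<bar>\<psi> x\<bar> < e / M" using x by auto
        have "e \<le> \<bar>a * \<phi> x\<bar> + \<bar>b * \<psi> x\<bar>" using x abs_triangle_ineq[of "a * \<phi> x" "b * \<psi> x"] by simp
        also have "\<dots> \<le> \<bar>a\<bar> * (e / M) + \<bar>b\<bar> * (e / M)"
          unfolding abs_mult using s by (intro add_mono mult_left_mono) auto
        also have "\<dots> = (\<bar>a\<bar> + \<bar>b\<bar>) * (e / M)" by (rule distrib_right[symmetric])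
        also have "\<dots> < M * (e / M)" using e M unfolding M_def by (intro mult_strict_right_mono) auto
        finally show False using M by simp
      qed
    qed
    have "closedin (top_of_set D) {x\<in>D. e \<le> \<bar>?f x\<bar>}"
      using continuous_closedin_preimage[OF continuous_on_rabs[OF cf] closed_atLeast[of e]]
      by (simp add: vimage_def Int_def)
    then obtain T where T: "closed T" "{x\<in>D. e \<le> \<bar>?f x\<bar>} = D \<inter> T"
      unfolding closedin_closed by auto
    then have "{x\<in>D. e \<le> \<bar>?f x\<bar>} = ?C \<inter> T" using sub by blast
    then show ?thesis using compact_Int_closed[OF C T(1)] by simp
  qed
  then show ?thesis unfolding C0_def using cf by blast
qed

lemma gradient_lincomb:
  fixes \<phi> \<psi> :: "real^2 \<Rightarrow> real"
  assumes "\<phi> differentiable (at x)" "\<psi> differentiable (at x)"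
  shows "gradient (\<lambda>x. a * \<phi> x + b * \<psi> x) x = a *\<^sub>R gradient \<phi> x + b *\<^sub>R gradient \<psi> x"
proof (rule gradient_eqI)
  show "GDERIV (\<lambda>x. a * \<phi> x + b * \<psi> x) x :> a *\<^sub>R gradient \<phi> x + b *\<^sub>R gradient \<psi> x"
    using gderiv_gradient[OF assms(1)] gderiv_gradient[OF assms(2)] unfolding gderiv_def
    by (auto intro!: derivative_eq_intros simp: inner_add_right)
qed

lemma admissible_lincomb:
  assumes "\<phi> \<in> admissible D" "\<psi> \<in> admissible D"
  shows "(\<lambda>x. a * \<phi> x + b * \<psi> x) \<in> admissible D"
proof -
  have d: "\<And>x. x \<in> D \<Longrightarrow> \<phi> differentiable (at x)" "\<And>x. x \<in> D \<Longrightarrow> \<psi> differentiable (at x)"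
    and c: "continuous_on D (gradient \<phi>)" "continuous_on D (gradient \<psi>)"
    using assms unfolding admissible_def C1_on_def by auto
  have "continuous_on D (gradient (\<lambda>x. a * \<phi> x + b * \<psi> x))"
    by (rule continuous_on_eq[of _ "\<lambda>x. a *\<^sub>R gradient \<phi> x + b *\<^sub>R gradient \<psi> x"])
       (auto intro!: continuous_intros c simp: gradient_lincomb d)
  moreover have "(\<lambda>x. a * \<phi> x + b * \<psi> x) differentiable (at x)" if "x \<in> D" for x
    using d[OF that] by simp
  moreover have "(\<lambda>x. a * \<phi> x + b * \<psi> x) \<in> C0 D"
    using assms unfolding admissible_def by (intro C0_lincomb) auto
  ultimately show ?thesis unfolding admissible_def C1_on_def by blast
qed

lemma L2_of_lincomb:
  assumes "\<phi> \<in> C0 D" "\<psi> \<in> C0 D"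
  shows "L2_of D (\<lambda>x. a * \<phi> x + b * \<psi> x) = a *\<^sub>R L2_of D \<phi> + b *\<^sub>R L2_of D \<psi>"
proof -
  note sq = C0_square_integrable[OF assms(1)] C0_square_integrable[OF assms(2)]
  show ?thesis
    unfolding L2_of_def abs_l2_scale[OF sq(1)] abs_l2_scale[OF sq(2)]
      abs_l2_add[OF square_integrable_scale[OF sq(1)] square_integrable_scale[OF sq(2)]]
    by (simp add: algebra_simps)
qed

lemma measurable_area_integrand:
  assumes "\<phi> \<in> admissible D"
  shows "(\<lambda>x. ennreal (sqrt (1 + (norm (gradient \<phi> x))\<^sup>2)) * indicator D x) \<in> borel_measurable lborel"
proof -
  have cont: "continuous_on D (\<lambda>x. sqrt (1 + (norm (gradient \<phi> x))\<^sup>2))"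
    using assms unfolding admissible_def C1_on_def by (intro continuous_intros) auto
  have "(\<lambda>x. ennreal (indicator D x *\<^sub>R sqrt (1 + (norm (gradient \<phi> x))\<^sup>2))) \<in> borel_measurable lborel"
    using measurable_compose[OF borel_measurable_continuous_on_indicator[OF sets_D cont] measurable_ennreal]
    by (simp only: measurable_lborel2)
  also have "(\<lambda>x. ennreal (indicator D x *\<^sub>R sqrt (1 + (norm (gradient \<phi> x))\<^sup>2))) =
      (\<lambda>x. ennreal (sqrt (1 + (norm (gradient \<phi> x))\<^sup>2)) * indicator D x)"
    by (auto simp: indicator_def)
  finally show ?thesis .
qed

lemma graph_area_convex:
  assumes "\<phi> \<in> admissible D" "\<psi> \<in> admissible D" "0 \<le> t" "t \<le> 1"
  shows "graph_area D (\<lambda>x. (1 - t) * \<phi> x + t * \<psi> x) \<le>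
    ennreal (1 - t) * graph_area D \<phi> + ennreal t * graph_area D \<psi>"
proof -
  let ?s = "\<lambda>\<phi> x. ennreal (sqrt (1 + (norm (gradient \<phi> x))\<^sup>2)) * indicator D x"
  note [measurable] = measurable_area_integrand[OF assms(1)] measurable_area_integrand[OF assms(2)]
  have "graph_area D (\<lambda>x. (1 - t) * \<phi> x + t * \<psi> x) \<le>
      (\<integral>\<^sup>+x. ennreal (1 - t) * ?s \<phi> x + ennreal t * ?s \<psi> x \<partial>lborel)"
    unfolding graph_area_def
  proof (intro nn_integral_mono)
    fix x
    show "?s (\<lambda>x. (1 - t) * \<phi> x + t * \<psi> x) x \<le> ennreal (1 - t) * ?s \<phi> x + ennreal t * ?s \<psi> x"
    proof (cases "x \<in> D")
      case True
      then have d: "\<phi> differentiable (at x)" "\<psi> differentiable (at x)"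
        using assms unfolding admissible_def C1_on_def by auto
      have "ennreal (sqrt (1 + (norm ((1 - t) *\<^sub>R gradient \<phi> x + t *\<^sub>R gradient \<psi> x))\<^sup>2)) \<le>
        ennreal ((1 - t) * sqrt (1 + (norm (gradient \<phi> x))\<^sup>2) + t * sqrt (1 + (norm (gradient \<psi> x))\<^sup>2))"
        by (intro ennreal_leI sqrt_one_plus_convex assms)
      then show ?thesis
        using True assms(3,4) by (simp add: gradient_lincomb[OF d] ennreal_mult ennreal_plus)
    qed simp
  qed
  also have "\<dots> = ennreal (1 - t) * graph_area D \<phi> + ennreal t * graph_area D \<psi>"
    unfolding graph_area_def by (subst nn_integral_add) (simp_all add: nn_integral_cmult)
  finally show ?thesis .
qed

lemma smooth_area_eq: "smooth_area D w = (INF \<phi>\<in>{\<phi> \<in> admissible D. w = L2_of D \<phi>}. graph_area D \<phi>)"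
  unfolding smooth_area_def admissible_def graph_area_def by (simp add: conj_assoc)

text \<open>Together with \<open>area_leI\<close> this trades the \<open>Liminf\<close> for smooth
  functions close to w in L2; every property of the relaxed area is transferred from
  \<open>graph_area\<close> through this pair.\<close>

lemma area_lessD:
  assumes "area D w < c" "0 < \<epsilon>"
  obtains \<phi> where "\<phi> \<in> admissible D" "dist (L2_of D \<phi>) w < \<epsilon>" "graph_area D \<phi> < c"
proof -
  have "eventually (\<lambda>z. dist z w < \<epsilon>) (nhds w)" using assms(2) by (auto simp: eventually_nhds_metric)
  then have "(INF z\<in>{z. dist z w < \<epsilon>}. smooth_area D z) \<le> area D w"
    unfolding area_def Liminf_def by (intro SUP_upper) auto
  then have "(INF z\<in>{z. dist z w < \<epsilon>}. smooth_area D z) < c" using assms(1) by simp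
  then obtain z where z: "dist z w < \<epsilon>" "smooth_area D z < c" by (auto simp: INF_less_iff)
  then show ?thesis using that unfolding smooth_area_eq INF_less_iff by auto
qed

lemma area_leI:
  assumes "\<And>\<epsilon>. 0 < \<epsilon> \<Longrightarrow> \<exists>\<phi>\<in>admissible D. dist (L2_of D \<phi>) w < \<epsilon> \<and> graph_area D \<phi> \<le> c"
  shows "area D w \<le> c"
  unfolding area_def Liminf_def
proof (rule SUP_least)
  fix P assume "P \<in> {P. eventually P (nhds w)}"
  then obtain \<epsilon> where e: "0 < \<epsilon>" "\<And>z. dist z w < \<epsilon> \<Longrightarrow> P z" by (auto simp: eventually_nhds_metric)
  obtain \<phi> where p: "\<phi> \<in> admissible D" "dist (L2_of D \<phi>) w < \<epsilon>" "graph_area D \<phi> \<le> c"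
    using assms[OF e(1)] by blast
  have "Inf (smooth_area D ` Collect P) \<le> smooth_area D (L2_of D \<phi>)"
    using e(2)[OF p(2)] by (intro INF_lower) simp
  also have "\<dots> \<le> graph_area D \<phi>" unfolding smooth_area_eq using p(1) by (intro INF_lower) simp
  finally show "Inf (smooth_area D ` Collect P) \<le> c" using p(3) by simp
qed

text \<open>A recovery function for some late \<open>ws n\<close> is also close to w, so it serves
  as a competitor in the relaxation at w.\<close>

lemma area_lsc:
  assumes w: "ws \<longlonglongrightarrow> w" and le: "\<And>n. area D (ws n) \<le> ennreal (c n)"
    and c: "\<And>n. 0 \<le> c n" "c \<longlonglongrightarrow> C"
  shows "area D w \<le> ennreal C"
proof (rule ennreal_le_epsilon)
  fix \<eta> :: real assume eta: "0 < \<eta>"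
  have C: "0 \<le> C" using c by (intro LIMSEQ_le_const) auto
  show "area D w \<le> ennreal C + ennreal \<eta>"
  proof (rule area_leI)
    fix \<epsilon> :: real assume e: "0 < \<epsilon>"
    have "eventually (\<lambda>n. c n < C + \<eta>) sequentially" "eventually (\<lambda>n. dist (ws n) w < \<epsilon> / 2) sequentially"
      using eta order_tendstoD(2)[OF c(2), of "C + \<eta>"] tendstoD[OF w half_gt_zero[OF e]] by auto
    then have "eventually (\<lambda>n. c n < C + \<eta> \<and> dist (ws n) w < \<epsilon> / 2) sequentially" by eventually_elim auto
    then obtain n where n: "c n < C + \<eta>" "dist (ws n) w < \<epsilon> / 2"
      using eventually_happens[of _ sequentially] sequentially_bot by blast
    have "area D (ws n) < ennreal (C + \<eta>)"
      using le[of n] n(1) c(1)[of n] by (auto intro: le_less_trans ennreal_lessI)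
    then obtain \<phi> where p: "\<phi> \<in> admissible D" "dist (L2_of D \<phi>) (ws n) < \<epsilon> / 2" "graph_area D \<phi> < ennreal (C + \<eta>)"
      using area_lessD[of "ws n" _ "\<epsilon> / 2"] e by (metis half_gt_zero)
    have "dist (L2_of D \<phi>) w < \<epsilon>" using p(2) n(2) dist_triangle_half_r[of "ws n" "L2_of D \<phi>" \<epsilon> w]
      by (simp add: dist_commute)
    then show "\<exists>\<phi>\<in>admissible D. dist (L2_of D \<phi>) w < \<epsilon> \<and> graph_area D \<phi> \<le> ennreal C + ennreal \<eta>"
      using p C eta by (auto simp flip: ennreal_plus intro!: bexI[of _ \<phi>])
  qed
qed

lemma area_convex:
  assumes "area D v \<le> ennreal a" "area D w \<le> ennreal b" "0 \<le> a" "0 \<le> b" and t: "0 \<le> t" "t \<le> 1"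
  shows "area D ((1 - t) *\<^sub>R v + t *\<^sub>R w) \<le> ennreal ((1 - t) * a + t * b)"
proof (rule ennreal_le_epsilon)
  fix \<eta> :: real assume eta: "0 < \<eta>"
  show "area D ((1 - t) *\<^sub>R v + t *\<^sub>R w) \<le> ennreal ((1 - t) * a + t * b) + ennreal \<eta>"
  proof (rule area_leI)
    fix \<epsilon> :: real assume e: "0 < \<epsilon>"
    have "area D v < ennreal (a + \<eta>)" "area D w < ennreal (b + \<eta>)"
      using assms eta by (auto intro: le_less_trans ennreal_lessI)
    then obtain \<phi> \<psi> where p: "\<phi> \<in> admissible D" "dist (L2_of D \<phi>) v < \<epsilon>" "graph_area D \<phi> < ennreal (a + \<eta>)"
      and q: "\<psi> \<in> admissible D" "dist (L2_of D \<psi>) w < \<epsilon>" "graph_area D \<psi> < ennreal (b + \<eta>)"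
      using area_lessD[OF _ e] by metis
    let ?f = "\<lambda>x. (1 - t) * \<phi> x + t * \<psi> x"
    have f: "?f \<in> admissible D" by (intro admissible_lincomb p q)
    have eq: "L2_of D ?f = (1 - t) *\<^sub>R L2_of D \<phi> + t *\<^sub>R L2_of D \<psi>"
      using p(1) q(1) unfolding admissible_def by (intro L2_of_lincomb) auto
    have "L2_of D ?f - ((1 - t) *\<^sub>R v + t *\<^sub>R w) = (1 - t) *\<^sub>R (L2_of D \<phi> - v) + t *\<^sub>R (L2_of D \<psi> - w)"
      unfolding eq by (simp add: algebra_simps)
    then have "dist (L2_of D ?f) ((1 - t) *\<^sub>R v + t *\<^sub>R w) \<le> (1 - t) * norm (L2_of D \<phi> - v) + t * norm (L2_of D \<psi> - w)"
      using norm_triangle_ineq[of "(1 - t) *\<^sub>R (L2_of D \<phi> - v)" "t *\<^sub>R (L2_of D \<psi> - w)"] t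
      unfolding dist_norm by simp
    also have "\<dots> < \<epsilon>"
      using p(2) q(2) t unfolding dist_norm by (intro convex_bound_lt) auto
    finally have d: "dist (L2_of D ?f) ((1 - t) *\<^sub>R v + t *\<^sub>R w) < \<epsilon>" .
    have "graph_area D ?f \<le> ennreal (1 - t) * graph_area D \<phi> + ennreal t * graph_area D \<psi>"
      by (rule graph_area_convex[OF p(1) q(1) t])
    also have "\<dots> \<le> ennreal (1 - t) * ennreal (a + \<eta>) + ennreal t * ennreal (b + \<eta>)"
      using p(3) q(3) by (intro add_mono mult_left_mono) auto
    also have "\<dots> = ennreal ((1 - t) * (a + \<eta>) + t * (b + \<eta>))"
      using t assms(3,4) eta by (simp add: ennreal_mult ennreal_plus)
    also have "(1 - t) * (a + \<eta>) + t * (b + \<eta>) = ((1 - t) * a + t * b) + \<eta>" by (simp add: algebra_simps)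
    also have "ennreal (((1 - t) * a + t * b) + \<eta>) = ennreal ((1 - t) * a + t * b) + ennreal \<eta>"
      using t assms(3,4) eta by (intro ennreal_plus) auto
    finally show "\<exists>\<phi>\<in>admissible D. dist (L2_of D \<phi>) ((1 - t) *\<^sub>R v + t *\<^sub>R w) < \<epsilon> \<and>
        graph_area D \<phi> \<le> ennreal ((1 - t) * a + t * b) + ennreal \<eta>"
      using f d by blast
  qed
qed

end

text \<open>Nonnegativity excludes -\<infinity>, and at points of value +\<infinity> the subgradient
  inequality is void; so the functional may be replaced by a real function on its effective
  domain.\<close>

lemma subdifferential_eq_subgrad:
  assumes "\<And>v. 0 \<le> \<phi> v"
  shows "subdifferential X \<phi> = subgrad X {v \<in> X. \<phi> v \<noteq> \<infinity>} (\<lambda>v. real_of_ereal (\<phi> v))"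
proof -
  have fin: "(\<bar>\<phi> v\<bar> \<noteq> \<infinity>) = (\<phi> v \<noteq> \<infinity>)" for v
    using assms[of v] by (cases "\<phi> v") auto
  have le: "(\<phi> v + ereal r \<le> \<phi> w) = (\<phi> w \<noteq> \<infinity> \<longrightarrow> real_of_ereal (\<phi> v) + r \<le> real_of_ereal (\<phi> w))"
    if "\<phi> v \<noteq> \<infinity>" for v w r
    using assms[of v] assms[of w] that by (cases "\<phi> v"; cases "\<phi> w") auto
  show ?thesis
    unfolding subdifferential_def subgrad_def fin using le by (intro ext Collect_cong) auto
qed

lemma subdifferential_convex_indicator:
  assumes "K \<subseteq> X"
  shows "subdifferential X (convex_indicator K) = subgrad X K (\<lambda>_. 0)"
proof -
  have "{v \<in> X. convex_indicator K v \<noteq> \<infinity>} = K" using assms by (auto simp: convex_indicator_def)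
  then show ?thesis
    by (subst subdifferential_eq_subgrad) (auto simp: convex_indicator_def subgrad_def fun_eq_iff)
qed

section \<open>The droplet energy and the constraint as closed convex functionals\<close>

locale droplet = finite_domain D for D +
  fixes \<gamma>LG \<rho> g :: real and ustar :: "real^2 \<Rightarrow> real"
  assumes gamma: "0 < \<gamma>LG" and rho: "0 < \<rho>" and grav: "0 < g" and ustar_C0: "ustar \<in> C0 D"
begin

abbreviation U0 :: l2 where "U0 \<equiv> L2_of D ustar"

definition Ydom :: "l2 set" where "Ydom = {v \<in> X1 D. area D (v + U0) \<noteq> top}"

definition efun :: "l2 \<Rightarrow> real" where
  "efun v = \<gamma>LG * enn2real (area D (v + U0)) + \<rho> * g * (norm (v + U0))\<^sup>2 / 2"

lemma energy_finite: "area D (v + U0) \<noteq> top \<Longrightarrow> energy D \<gamma>LG \<rho> g ustar v = ereal (efun v)"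
  unfolding energy_def efun_def by (cases "area D (v + U0)") auto

lemma energy_infinite: "area D (v + U0) = top \<Longrightarrow> energy D \<gamma>LG \<rho> g ustar v = \<infinity>"
  unfolding energy_def using gamma by simp

lemma energy_nonneg: "0 \<le> energy D \<gamma>LG \<rho> g ustar v"
  unfolding energy_def using gamma rho grav by (intro add_nonneg_nonneg) auto

lemma grad_E_eq: "grad_E D \<gamma>LG \<rho> g ustar = subgrad (X1 D) Ydom efun"
proof -
  have "{v \<in> X1 D. energy D \<gamma>LG \<rho> g ustar v \<noteq> \<infinity>} = Ydom"
    unfolding Ydom_def using energy_finite energy_infinite by fastforce
  moreover have "subgrad (X1 D) Ydom (\<lambda>v. real_of_ereal (energy D \<gamma>LG \<rho> g ustar v)) = subgrad (X1 D) Ydom efun"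
    unfolding subgrad_def Ydom_def by (auto simp: energy_finite)
  ultimately show ?thesis
    unfolding grad_E_def by (subst subdifferential_eq_subgrad) (auto simp: energy_nonneg)
qed

lemma constraint_set_subset: "constraint_set D ustar \<subseteq> X1 D"
  unfolding constraint_set_def by auto

lemma sub_IK_eq: "sub_IK D ustar = subgrad (X1 D) (constraint_set D ustar) (\<lambda>_. 0)"
  unfolding sub_IK_def by (rule subdifferential_convex_indicator[OF constraint_set_subset])

lemma constraint_set_eq:
  "constraint_set D ustar = X1 D \<inter> {v. U0 + v \<in> {w. AE x in lborel. x \<in> D \<longrightarrow> 0 \<le> rep_l2 w x}}"
  unfolding constraint_set_def by auto

lemma closed_constraint_set: "closed (constraint_set D ustar)"
proof -
  have "closed ((\<lambda>v. U0 + v) -` {w. AE x in lborel. x \<in> D \<longrightarrow> 0 \<le> rep_l2 w x})"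
    by (intro closed_vimage closed_nonneg_on continuous_intros)
  then show ?thesis unfolding constraint_set_eq using closed_X1 by (simp add: vimage_def closed_Int)
qed

lemma convex_constraint_set: "convex (constraint_set D ustar)"
  unfolding convex_alt
proof (intro ballI allI impI)
  fix v w t assume v: "v \<in> constraint_set D ustar" and w: "w \<in> constraint_set D ustar"
    and t: "0 \<le> (t::real) \<and> t \<le> 1"
  let ?u = "(1 - t) *\<^sub>R (U0 + v) + t *\<^sub>R (U0 + w)"
  have "(1 - t) *\<^sub>R v + t *\<^sub>R w \<in> X1 D"
    using v w constraint_set_subset subspace_X1 by (intro subspace_add subspace_scale) auto
  moreover have "AE x in lborel. x \<in> D \<longrightarrow> 0 \<le> rep_l2 ?u x"
  proof -
    have "AE x in lborel. x \<in> D \<longrightarrow> 0 \<le> rep_l2 (U0 + v) x" "AE x in lborel. x \<in> D \<longrightarrow> 0 \<le> rep_l2 (U0 + w) x"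
      using v w unfolding constraint_set_def by auto
    then show ?thesis
      using rep_l2_add[of "(1 - t) *\<^sub>R (U0 + v)" "t *\<^sub>R (U0 + w)"]
        rep_l2_scale[of "1 - t" "U0 + v"] rep_l2_scale[of t "U0 + w"]
      by eventually_elim (use t in auto)
  qed
  moreover have "?u = U0 + ((1 - t) *\<^sub>R v + t *\<^sub>R w)" by (simp add: algebra_simps)
  ultimately show "(1 - t) *\<^sub>R v + t *\<^sub>R w \<in> constraint_set D ustar"
    unfolding constraint_set_def by simp
qed

lemma closed_convex_fun_constraint:
  assumes "constraint_set D ustar \<noteq> {}"
  shows "closed_convex_fun (X1 D) (constraint_set D ustar) (\<lambda>_. 0)"
proof
  fix xs :: "nat \<Rightarrow> l2" and x and c :: "nat \<Rightarrow> real" and C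
  assume "\<And>n. xs n \<in> constraint_set D ustar" "xs \<longlonglongrightarrow> x" "\<And>n. 0 \<le> c n" "c \<longlonglongrightarrow> C"
  then show "x \<in> constraint_set D ustar \<and> 0 \<le> C"
    using closed_constraint_set LIMSEQ_le_const[of c C 0] unfolding closed_sequential_limits by blast
qed (use assms subspace_X1 complete_X1 constraint_set_subset convex_constraint_set in auto)

lemma shift_convex_comb: "(1 - t) *\<^sub>R v + t *\<^sub>R w + U0 = (1 - t) *\<^sub>R (v + U0) + t *\<^sub>R (w + U0)"
  by (simp add: algebra_simps)

lemma norm_sq_convex:
  fixes v w :: l2
  assumes "0 \<le> t" "t \<le> 1"
  shows "(norm ((1 - t) *\<^sub>R v + t *\<^sub>R w))\<^sup>2 \<le> (1 - t) * (norm v)\<^sup>2 + t * (norm w)\<^sup>2"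
proof -
  have "0 \<le> t * (1 - t) * (norm (v - w))\<^sup>2" using assms by simp
  then show ?thesis unfolding norm_convex_comb by linarith
qed

lemma area_Ydom: "v \<in> Ydom \<Longrightarrow> area D (v + U0) = ennreal (enn2real (area D (v + U0)))"
  unfolding Ydom_def by (simp add: less_top)

lemma area_convex_Ydom:
  assumes "0 \<le> t" "t \<le> 1" "v \<in> Ydom" "w \<in> Ydom"
  shows "area D ((1 - t) *\<^sub>R v + t *\<^sub>R w + U0) \<le>
    ennreal ((1 - t) * enn2real (area D (v + U0)) + t * enn2real (area D (w + U0)))"
  unfolding shift_convex_comb
  using area_Ydom[OF assms(3)] area_Ydom[OF assms(4)] assms(1,2) by (intro area_convex) auto

lemma convex_Ydom: "convex Ydom"
  unfolding convex_alt
proof (intro ballI allI impI)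
  fix v w t assume v: "v \<in> Ydom" and w: "w \<in> Ydom" and t: "0 \<le> (t::real) \<and> t \<le> 1"
  have "(1 - t) *\<^sub>R v + t *\<^sub>R w \<in> X1 D"
    using v w subspace_X1 unfolding Ydom_def by (intro subspace_add subspace_scale) auto
  then show "(1 - t) *\<^sub>R v + t *\<^sub>R w \<in> Ydom"
    unfolding Ydom_def using area_convex_Ydom[of t v w] t v w by (auto simp: top_unique)
qed

lemma closed_convex_fun_energy:
  assumes "Ydom \<noteq> {}"
  shows "closed_convex_fun (X1 D) Ydom efun"
proof
  show "Ydom \<subseteq> X1 D" unfolding Ydom_def by auto
next
  fix t :: real and v w assume t: "0 \<le> t" "t \<le> 1" "v \<in> Ydom" "w \<in> Ydom"
  let ?a = "enn2real (area D (v + U0))" and ?b = "enn2real (area D (w + U0))"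
  have nonneg: "0 \<le> (1 - t) * ?a + t * ?b" using t by simp
  have "enn2real (area D ((1 - t) *\<^sub>R v + t *\<^sub>R w + U0)) \<le> (1 - t) * ?a + t * ?b"
    using enn2real_mono[OF area_convex_Ydom[OF t] ennreal_less_top] unfolding enn2real_ennreal[OF nonneg] .
  then have "\<gamma>LG * enn2real (area D ((1 - t) *\<^sub>R v + t *\<^sub>R w + U0)) \<le> \<gamma>LG * ((1 - t) * ?a + t * ?b)"
    using gamma by (intro mult_left_mono) auto
  moreover have "\<rho> * g * (norm ((1 - t) *\<^sub>R v + t *\<^sub>R w + U0))\<^sup>2 \<le>
      \<rho> * g * ((1 - t) * (norm (v + U0))\<^sup>2 + t * (norm (w + U0))\<^sup>2)"
    unfolding shift_convex_comb using rho grav t by (intro mult_left_mono norm_sq_convex) auto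
  moreover have "(1 - t) * efun v + t * efun w = \<gamma>LG * ((1 - t) * ?a + t * ?b) +
      \<rho> * g * ((1 - t) * (norm (v + U0))\<^sup>2 + t * (norm (w + U0))\<^sup>2) / 2"
    unfolding efun_def by (simp add: field_simps)
  ultimately show "efun ((1 - t) *\<^sub>R v + t *\<^sub>R w) \<le> (1 - t) * efun v + t * efun w"
    unfolding efun_def[of "(1 - t) *\<^sub>R v + t *\<^sub>R w"] by linarith
next
  fix v assume "v \<in> Ydom"
  show "0 \<le> efun v" unfolding efun_def using gamma rho grav by simp
next
  fix xs :: "nat \<Rightarrow> l2" and x c C
  assume xs: "\<And>n. xs n \<in> Ydom" "xs \<longlonglongrightarrow> x" and c: "\<And>n. efun (xs n) \<le> c n" "c \<longlonglongrightarrow> C"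
  \<comment> \<open>Subtracting the gravity term, which is continuous in L2, isolates a bound on the
    area, to which semicontinuity of the relaxation applies.\<close>
  let ?c = "\<lambda>n. (c n - \<rho> * g * (norm (xs n + U0))\<^sup>2 / 2) / \<gamma>LG"
  have le: "enn2real (area D (xs n + U0)) \<le> ?c n" for n
    using c(1)[of n] gamma unfolding efun_def by (simp add: field_simps)
  have lim: "?c \<longlonglongrightarrow> (C - \<rho> * g * (norm (x + U0))\<^sup>2 / 2) / \<gamma>LG" (is "_ \<longlonglongrightarrow> ?C")
    using gamma by (intro tendsto_intros c xs) auto
  have c0: "0 \<le> ?c n" for n using le[of n] enn2real_nonneg order_trans by blast
  have "area D (x + U0) \<le> ennreal ?C"
  proof (rule area_lsc[OF _ _ c0 lim])
    show "(\<lambda>n. xs n + U0) \<longlonglongrightarrow> x + U0" by (intro tendsto_intros xs)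
    show "area D (xs n + U0) \<le> ennreal (?c n)" for n
      using area_Ydom[OF xs(1)[of n]] ennreal_leI[OF le[of n]] by simp
  qed
  moreover have "0 \<le> ?C" using c0 lim by (intro LIMSEQ_le_const[OF lim]) auto
  moreover have "x \<in> X1 D" using closed_X1 xs unfolding closed_sequential_limits Ydom_def by blast
  ultimately have "x \<in> Ydom \<and> enn2real (area D (x + U0)) \<le> ?C"
    unfolding Ydom_def using enn2real_mono[of "area D (x + U0)" "ennreal ?C"] by (auto simp: top_unique)
  then show "x \<in> Ydom \<and> efun x \<le> C"
    unfolding efun_def using gamma by (simp add: field_simps)
qed (use assms subspace_X1 complete_X1 convex_Ydom in auto)

end

section \<open>The subdifferential at test functions\<close>

lemma integral_lborel_translate:
  fixes f :: "'a::euclidean_space \<Rightarrow> real"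
  assumes "f \<in> borel_measurable borel"
  shows "(\<integral>x. f (c + x) \<partial>lborel) = (\<integral>x. f x \<partial>lborel)"
proof -
  have "(\<integral>x. f x \<partial>lborel) = (\<integral>x. f x \<partial>distr lborel borel ((+) c))"
    by (simp add: lborel_distr_plus)
  also have "\<dots> = (\<integral>x. f (c + x) \<partial>lborel)"
    using assms by (intro integral_distr) auto
  finally show ?thesis ..
qed

lemma integrable_compact_support:
  fixes f :: "'a::euclidean_space \<Rightarrow> real"
  assumes "compact C" "continuous_on UNIV f" "\<And>x. x \<notin> C \<Longrightarrow> f x = 0"
  shows "integrable lborel f"
proof -
  have "integrable lborel (\<lambda>x. indicator C x *\<^sub>R f x)"
    by (intro borel_integrable_compact assms continuous_on_subset[OF assms(2)]) auto
  moreover have "(\<lambda>x. indicator C x *\<^sub>R f x) = f"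
    using assms(3) by (auto simp: fun_eq_iff indicator_def split: split_of_bool)
  ultimately show ?thesis by simp
qed

lemma gderiv_continuous: "(\<And>x. GDERIV f x :> d x) \<Longrightarrow> continuous_on S f"
  unfolding gderiv_def by (meson continuous_at_imp_continuous_on has_derivative_continuous)

text \<open>By translation invariance the difference quotients of \<open>f\<close> have integral zero.\<close>

lemma integral_gradient_compact_support:
  fixes f :: "'a::euclidean_space \<Rightarrow> real"
  assumes C: "compact C" and supp: "\<And>x. x \<notin> C \<Longrightarrow> f x = 0"
    and deriv: "\<And>x. GDERIV f x :> d x" and cont: "continuous_on UNIV d"
  shows "(\<integral>x. d x \<bullet> a \<partial>lborel) = 0"
proof -
  obtain r where "\<forall>x\<in>C. norm x \<le> r" using compact_imp_bounded[OF C] unfolding bounded_iff by blast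
  then have r: "C \<subseteq> cball 0 r" by auto
  \<comment> \<open>Difference quotients shift points by at most |a|, so they vanish off
    \<open>cball 0 R\<close>; for x in that ball all sampled points lie in
    \<open>cball 0 R2\<close>, where the gradient is bounded. This yields the dominating function B
    |a| on \<open>cball 0 R\<close>.\<close>
  define R where "R = r + norm a"
  define R2 where "R2 = R + norm a"
  have "bounded (d ` cball 0 R2)"
    by (intro compact_imp_bounded compact_continuous_image continuous_on_subset[OF cont]) auto
  then obtain B where "\<forall>y\<in>d ` cball 0 R2. norm y \<le> B" unfolding bounded_iff by blast
  then have B: "norm (d x) \<le> B" if "x \<in> cball 0 R2" for x using that by blast
  have cf: "continuous_on UNIV f" by (rule gderiv_continuous[OF deriv])
  have mf [measurable]: "f \<in> borel_measurable borel" using cf by (rule borel_measurable_continuous_onI)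
  have md: "(\<lambda>x. d x \<bullet> a) \<in> borel_measurable borel"
    by (intro borel_measurable_continuous_onI continuous_intros cont)
  have If: "integrable lborel f" by (rule integrable_compact_support[OF C cf supp])
  define c where "c n = inverse (real (Suc n)) *\<^sub>R a" for n
  have nc: "norm (c n) \<le> norm a" for n
    unfolding c_def by (simp add: mult_left_le_one_le inverse_le_1_iff)
  define h where "h n x = real (Suc n) * (f (c n + x) - f x)" for n x
  have Ifc: "integrable lborel (\<lambda>x. f (c n + x))" for n
  proof (rule integrable_compact_support)
    show "compact ((+) (- c n) ` C)" using C by (rule compact_translation)
    show "continuous_on UNIV (\<lambda>x. f (c n + x))"
      by (rule continuous_on_compose2[OF cf]) (auto intro!: continuous_intros)
    fix x assume x: "x \<notin> (+) (- c n) ` C"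
    have "c n + x \<notin> C"
    proof
      assume "c n + x \<in> C"
      then have "- c n + (c n + x) \<in> (+) (- c n) ` C" by (rule imageI)
      then show False using x by simp
    qed
    then show "f (c n + x) = 0" by (rule supp)
  qed
  have Ih: "(\<integral>x. h n x \<partial>lborel) = 0" for n
    unfolding h_def using integral_lborel_translate[OF mf, of "c n"] If Ifc by simp
  have lim: "(\<lambda>n. h n x) \<longlonglongrightarrow> d x \<bullet> a" for x
  proof -
    have "((\<lambda>t. f (x + t *\<^sub>R a)) has_derivative (\<lambda>t. (t *\<^sub>R a) \<bullet> d x)) (at 0)"
    proof (rule has_derivative_compose[where g=f, unfolded o_def])
      show "((\<lambda>t. x + t *\<^sub>R a) has_derivative (\<lambda>t. t *\<^sub>R a)) (at 0)"
        by (auto intro!: derivative_eq_intros)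
      show "(f has_derivative (\<lambda>h. h \<bullet> d x)) (at (x + 0 *\<^sub>R a))" using deriv[of x] unfolding gderiv_def by simp
    qed
    then have "((\<lambda>t. f (x + t *\<^sub>R a)) has_real_derivative d x \<bullet> a) (at 0)"
      unfolding has_field_derivative_def by (rule has_derivative_eq_rhs) (auto simp: inner_commute)
    then have "((\<lambda>t. (f (x + t *\<^sub>R a) - f x) / t) \<longlongrightarrow> d x \<bullet> a) (at 0)"
      unfolding DERIV_def by simp
    moreover have "filterlim (\<lambda>n. inverse (real (Suc n))) (at 0) sequentially"
      unfolding filterlim_at using LIMSEQ_inverse_real_of_nat by auto
    ultimately have "(\<lambda>n. (f (x + inverse (real (Suc n)) *\<^sub>R a) - f x) / inverse (real (Suc n))) \<longlonglongrightarrow> d x \<bullet> a"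
      by (rule filterlim_compose)
    then show ?thesis unfolding h_def c_def by (simp add: divide_inverse mult.commute add.commute)
  qed
  have bound: "norm (h n x) \<le> B * norm a * indicator (cball 0 R) x" for n x
  proof (cases "x \<in> cball 0 R")
    case True
    have x: "x \<in> cball 0 R2" "c n + x \<in> cball 0 R2"
      using True nc[of n] norm_triangle_ineq[of "c n" x] unfolding R2_def by (auto intro: order_trans)
    have "norm (f (c n + x) - f x) \<le> B * norm (c n + x - x)"
    proof (rule differentiable_bound[OF convex_cball[of 0 R2] _ _ x(2,1)])
      fix y :: 'a assume y: "y \<in> cball 0 R2"
      show "(f has_derivative (\<lambda>h. h \<bullet> d y)) (at y within cball 0 R2)"
        using deriv[of y] unfolding gderiv_def by (rule has_derivative_at_withinI)
      have "norm (h \<bullet> d y) \<le> B * norm h" for h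
        using Cauchy_Schwarz_ineq2[of h "d y"] mult_right_mono[OF B[OF y], of "norm h"]
        by (simp add: mult.commute)
      then show "onorm (\<lambda>h. h \<bullet> d y) \<le> B" by (intro onorm_le)
    qed
    then have "real (Suc n) * \<bar>f (c n + x) - f x\<bar> \<le> real (Suc n) * (B * norm (c n))"
      by (intro mult_left_mono) auto
    also have "\<dots> = B * norm a" unfolding c_def by simp
    finally show ?thesis using True unfolding h_def by (simp add: abs_mult)
  next
    case False
    have "x \<notin> C"
    proof
      assume "x \<in> C"
      then have "norm x \<le> r" using r by auto
      then show False using False norm_ge_zero[of a] unfolding R_def by simp
    qed
    moreover have "c n + x \<notin> C"
    proof
      assume "c n + x \<in> C"
      then have "norm (c n + x) \<le> r" using r by auto
      then have "norm x \<le> r + norm a" using nc[of n] norm_triangle_ineq4[of "c n + x" "c n"] by simp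
      then show False using False unfolding R_def by simp
    qed
    ultimately show ?thesis using False supp unfolding h_def by simp
  qed
  have "(\<lambda>n. \<integral>x. h n x \<partial>lborel) \<longlonglongrightarrow> (\<integral>x. d x \<bullet> a \<partial>lborel)"
  proof (rule integral_dominated_convergence[where w="\<lambda>x. B * norm a * indicator (cball 0 R) x"])
    show "integrable lborel (\<lambda>x. B * norm a * indicator (cball 0 R) x)"
      by (intro integrable_mult_right integrable_real_indicator)
        (use emeasure_lborel_cball_finite[of 0 R] in auto)
    show "h n \<in> borel_measurable lborel" for n unfolding h_def by measurable
  qed (use lim bound md in auto)
  then show ?thesis using Ih by (simp add: LIMSEQ_const_iff)
qed

lemma gderiv_zero_outside:
  fixes f :: "'a::real_inner \<Rightarrow> real"
  assumes "closed C" "\<And>x. x \<notin> C \<Longrightarrow> f x = 0" "GDERIV f x :> d" "x \<notin> C"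
  shows "d = 0"
proof -
  have "((\<lambda>_. 0) has_derivative (\<lambda>h. h \<bullet> d)) (at x)"
    using assms(3) unfolding gderiv_def
  proof (rule has_derivative_transform_within_open)
    show "open (- C)" by (rule open_Compl[OF assms(1)])
  qed (use assms in auto)
  moreover have "((\<lambda>_. 0::real) has_derivative (\<lambda>h. 0)) (at x)" by simp
  ultimately have "(\<lambda>h. h \<bullet> d) = (\<lambda>h. 0)" by (rule has_derivative_unique)
  then have "d \<bullet> d = 0" by metis
  then show ?thesis by simp
qed

text \<open>The gradient is an explicit argument so that a second order of smoothness can be
  expressed by applying the predicate again to its components.\<close>

definition C1_compact :: "'a::euclidean_space set \<Rightarrow> ('a \<Rightarrow> real) \<Rightarrow> ('a \<Rightarrow> 'a) \<Rightarrow> bool" where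
  "C1_compact C f d \<longleftrightarrow> compact C \<and> (\<forall>x. x \<notin> C \<longrightarrow> f x = 0) \<and> (\<forall>x. GDERIV f x :> d x) \<and> continuous_on UNIV d"

lemma C1_compact_gradient_outside:
  "C1_compact C f d \<Longrightarrow> x \<notin> C \<Longrightarrow> d x = 0"
  unfolding C1_compact_def using gderiv_zero_outside compact_imp_closed by metis

lemma continuous_on_extend_zero:
  fixes f :: "'a::euclidean_space \<Rightarrow> 'b::real_normed_vector"
  assumes "open D" "closed C" "C \<subseteq> D" "continuous_on D f" "\<And>x. x \<in> D \<Longrightarrow> x \<notin> C \<Longrightarrow> f x = 0"
  shows "continuous_on UNIV (\<lambda>x. if x \<in> D then f x else 0)"
proof -
  have "continuous_on (D \<union> - C) (\<lambda>x. if x \<in> D then f x else 0)"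
    using assms by (intro continuous_on_cases_local_open open_subset) auto
  moreover have "D \<union> - C = UNIV" using assms(3) by auto
  ultimately show ?thesis by simp
qed

text \<open>Since f vanishes off the compact set C inside D, the product f \<phi> extends by zero to
  a C1 function on the plane, whatever \<phi> does near the boundary; its gradient then has integral
  zero.\<close>

lemma integration_by_parts:
  fixes f \<phi> :: "real^2 \<Rightarrow> real"
  assumes D: "open D" and CD: "C \<subseteq> D" and f: "C1_compact C f d" and \<phi>: "C1_on D \<phi>"
  shows "integrable lborel (\<lambda>x. indicator D x * (f x * (gradient \<phi> x \<bullet> a)))"
    and "integrable lborel (\<lambda>x. indicator D x * (\<phi> x * (d x \<bullet> a)))"
    and "(\<integral>x. indicator D x * (f x * (gradient \<phi> x \<bullet> a)) \<partial>lborel) =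
      - (\<integral>x. indicator D x * (\<phi> x * (d x \<bullet> a)) \<partial>lborel)"
proof -
  have C: "compact C" "closed C" and f0: "\<And>x. x \<notin> C \<Longrightarrow> f x = 0" and fd: "\<And>x. GDERIV f x :> d x"
    and cd: "continuous_on UNIV d"
    using f unfolding C1_compact_def by (auto intro: compact_imp_closed)
  have d0: "\<And>x. x \<notin> C \<Longrightarrow> d x = 0" using C1_compact_gradient_outside[OF f] .
  have cf: "continuous_on UNIV f" by (rule gderiv_continuous[OF fd])
  have g\<phi>: "\<And>x. x \<in> D \<Longrightarrow> GDERIV \<phi> x :> gradient \<phi> x" and cg: "continuous_on D (gradient \<phi>)"
    using \<phi> gderiv_gradient unfolding C1_on_def by auto
  have c\<phi>: "continuous_on D \<phi>"
    using \<phi> unfolding C1_on_def by (meson continuous_at_imp_continuous_on differentiable_imp_continuous_within)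
  let ?e = "\<lambda>h x. if x \<in> D then h x else (0::real)"
  have ind: "(\<lambda>x. indicator D x * h x) = ?e h" for h by (auto simp: indicator_def)
  have c1: "continuous_on UNIV (?e (\<lambda>x. f x * (gradient \<phi> x \<bullet> a)))"
    using f0 by (intro continuous_on_extend_zero[OF D C(2) CD] continuous_intros cg continuous_on_subset[OF cf]) auto
  have c2: "continuous_on UNIV (?e (\<lambda>x. \<phi> x * (d x \<bullet> a)))"
    using d0 by (intro continuous_on_extend_zero[OF D C(2) CD] continuous_intros c\<phi> continuous_on_subset[OF cd]) auto
  show I1: "integrable lborel (\<lambda>x. indicator D x * (f x * (gradient \<phi> x \<bullet> a)))"
    unfolding ind by (rule integrable_compact_support[OF C(1) c1]) (simp add: f0)
  show I2: "integrable lborel (\<lambda>x. indicator D x * (\<phi> x * (d x \<bullet> a)))"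
    unfolding ind by (rule integrable_compact_support[OF C(1) c2]) (simp add: d0)
  define p where "p = (\<lambda>x. if x \<in> D then f x *\<^sub>R gradient \<phi> x + \<phi> x *\<^sub>R d x else 0)"
  have "(\<integral>x. p x \<bullet> a \<partial>lborel) = 0"
  proof (rule integral_gradient_compact_support[OF C(1)])
    show "?e (\<lambda>x. f x * \<phi> x) x = 0" if "x \<notin> C" for x using f0[OF that] by simp
    show "continuous_on UNIV p"
      unfolding p_def using f0 d0
      by (intro continuous_on_extend_zero[OF D C(2) CD] continuous_intros cg c\<phi>
          continuous_on_subset[OF cd] continuous_on_subset[OF cf]) auto
    fix x
    show "GDERIV (?e (\<lambda>x. f x * \<phi> x)) x :> p x"
    proof (cases "x \<in> D")
      case True
      have "((\<lambda>x. f x * \<phi> x) has_derivative (\<lambda>h. h \<bullet> p x)) (at x)"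
        using fd[of x] g\<phi>[OF True] True unfolding gderiv_def p_def
        by (auto intro!: derivative_eq_intros simp: inner_add_right)
      then show ?thesis unfolding gderiv_def
        by (rule has_derivative_transform_within_open[OF _ D True]) simp
    next
      case False
      have "((\<lambda>_. 0) has_derivative (\<lambda>h. h \<bullet> p x)) (at x)" using False unfolding p_def by simp
      then show ?thesis unfolding gderiv_def
      proof (rule has_derivative_transform_within_open)
        show "open (- C)" "x \<in> - C" using C False CD by auto
      qed (use f0 in auto)
    qed
  qed
  moreover have "p x \<bullet> a = indicator D x * (f x * (gradient \<phi> x \<bullet> a)) + indicator D x * (\<phi> x * (d x \<bullet> a))" for x
    unfolding p_def by (auto simp: inner_add_left)
  ultimately show "(\<integral>x. indicator D x * (f x * (gradient \<phi> x \<bullet> a)) \<partial>lborel) =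
      - (\<integral>x. indicator D x * (\<phi> x * (d x \<bullet> a)) \<partial>lborel)"
    using I1 I2 by simp
qed

lemma C1_compactD:
  assumes "C1_compact C f d"
  shows "compact C" "closed C" "x \<notin> C \<Longrightarrow> f x = 0" "GDERIV f x :> d x" "continuous_on UNIV d"
    "continuous_on UNIV f"
  using assms gderiv_continuous[of f d] unfolding C1_compact_def by (auto intro: compact_imp_closed)

lemma C1_compact_square_integrable:
  fixes f :: "real^2 \<Rightarrow> real"
  assumes "compact C" "continuous_on UNIV f" "\<And>x. x \<notin> C \<Longrightarrow> f x = 0"
  shows "square_integrable f"
  unfolding square_integrable_def
  using assms by (auto intro!: integrable_compact_support[of C] borel_measurable_continuous_onI continuous_intros)

lemma C1_compact_admissible:
  assumes "C1_compact C \<psi> G" "C \<subseteq> D"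
  shows "\<psi> \<in> admissible D" "gradient \<psi> = G"
proof -
  note p = C1_compactD[OF assms(1)]
  show g: "gradient \<psi> = G" by (rule ext) (rule gradient_eqI[OF p(4)])
  have "compact {x\<in>D. e \<le> \<bar>\<psi> x\<bar>}" if "0 < e" for e
  proof -
    have "closed {x. e \<le> \<bar>\<psi> x\<bar>}" by (intro closed_Collect_le continuous_intros p(6))
    moreover have "{x\<in>D. e \<le> \<bar>\<psi> x\<bar>} = C \<inter> {x. e \<le> \<bar>\<psi> x\<bar>}"
    proof (intro set_eqI iffI)
      fix x assume x: "x \<in> {x\<in>D. e \<le> \<bar>\<psi> x\<bar>}"
      then have "\<psi> x \<noteq> 0" using that by auto
      then have "x \<in> C" using p(3) by blast
      then show "x \<in> C \<inter> {x. e \<le> \<bar>\<psi> x\<bar>}" using x by blast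
    qed (use assms(2) in auto)
    ultimately show ?thesis using compact_Int_closed[OF p(1)] by metis
  qed
  then have "\<psi> \<in> C0 D" unfolding C0_def using continuous_on_subset[OF p(6)] by blast
  moreover have "\<psi> differentiable (at x)" for x
    using p(4)[of x] unfolding gderiv_def differentiable_def by blast
  ultimately show "\<psi> \<in> admissible D"
    unfolding admissible_def C1_on_def using continuous_on_subset[OF p(5), of D] g by simp
qed

text \<open>Cauchy-Schwarz for the pairs (1, a) and (1, b), divided by the norm of the
  first.\<close>

lemma sqrt_one_plus_subgradient:
  fixes a b :: "'a::real_inner"
  shows "sqrt (1 + (norm a)\<^sup>2) + (a \<bullet> (b - a)) / sqrt (1 + (norm a)\<^sup>2) \<le> sqrt (1 + (norm b)\<^sup>2)"
proof -
  define s where "s = sqrt (1 + (norm a)\<^sup>2)"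
  have s: "0 < s" "s * s = 1 + (norm a)\<^sup>2"
    unfolding s_def by (simp_all add: add_pos_nonneg)
  have eq: "sqrt (1 + (norm c)\<^sup>2) = norm (1::real, c)" for c :: 'a by (simp add: norm_Pair)
  have "1 + a \<bullet> b = (1::real, a) \<bullet> (1, b)" by simp
  also have "\<dots> \<le> s * sqrt (1 + (norm b)\<^sup>2)"
    unfolding s_def eq by (rule norm_cauchy_schwarz)
  finally have "s * s + a \<bullet> (b - a) \<le> s * sqrt (1 + (norm b)\<^sup>2)"
    unfolding s(2) by (simp add: inner_diff_right power2_norm_eq_inner)
  then have "s * (s + (a \<bullet> (b - a)) / s) \<le> s * sqrt (1 + (norm b)\<^sup>2)"
    using s(1) by (simp add: distrib_left)
  then show ?thesis using s(1) unfolding s_def[symmetric] by simp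
qed

text \<open>The horizontal part of the unit normal of a graph with gradient G is again C1 with
  support in C, because the root is bounded away from zero. Its derivatives N' make the curvature
  available as a divergence.\<close>

lemma C1_compact_unit_normal:
  fixes G :: "'a::euclidean_space \<Rightarrow> 'a"
  assumes H: "\<And>i. i \<in> Basis \<Longrightarrow> C1_compact C (\<lambda>x. G x \<bullet> i) (H i)"
  obtains N' where "\<And>i. i \<in> Basis \<Longrightarrow> C1_compact C (\<lambda>x. G x \<bullet> i / sqrt (1 + (norm (G x))\<^sup>2)) (N' i)"
proof -
  define Q where "Q x = 1 + (\<Sum>j\<in>Basis. (G x \<bullet> j)\<^sup>2)" for x
  have Q: "Q x = 1 + (norm (G x))\<^sup>2" for x
    unfolding Q_def power2_norm_eq_inner by (subst euclidean_inner) (simp add: power2_eq_square)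
  have Q1: "0 < Q x" for x unfolding Q by (simp add: add_pos_nonneg)
  define dQ where "dQ x = (\<Sum>j\<in>Basis. (2 * (G x \<bullet> j)) *\<^sub>R H j x)" for x
  have Qd: "GDERIV Q x :> dQ x" for x
  proof -
    have "((\<lambda>x. G x \<bullet> j) has_derivative (\<lambda>h. h \<bullet> H j x)) (at x)" if "j \<in> Basis" for j
      using C1_compactD(4)[OF H[OF that]] unfolding gderiv_def .
    from has_derivative_power[OF this, of _ 2]
    have "((\<lambda>x. (G x \<bullet> j)\<^sup>2) has_derivative (\<lambda>h. h \<bullet> ((2 * (G x \<bullet> j)) *\<^sub>R H j x))) (at x)"
      if "j \<in> Basis" for j
      using that by (simp add: mult_ac)
    then have "((\<lambda>x. \<Sum>j\<in>Basis. (G x \<bullet> j)\<^sup>2) has_derivative (\<lambda>h. \<Sum>j\<in>Basis. h \<bullet> ((2 * (G x \<bullet> j)) *\<^sub>R H j x))) (at x)"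
      by (rule has_derivative_sum)
    then have "((\<lambda>x. 1 + (\<Sum>j\<in>Basis. (G x \<bullet> j)\<^sup>2)) has_derivative (\<lambda>h. 0 + (\<Sum>j\<in>Basis. h \<bullet> ((2 * (G x \<bullet> j)) *\<^sub>R H j x)))) (at x)"
      by (intro has_derivative_add has_derivative_const)
    then show ?thesis unfolding gderiv_def Q_def dQ_def by (simp add: inner_sum_right)
  qed
  have cG: "continuous_on UNIV (\<lambda>x. G x \<bullet> j)" if "j \<in> Basis" for j using C1_compactD(6)[OF H[OF that]] .
  have cQ: "continuous_on UNIV Q" unfolding Q_def by (intro continuous_intros cG)
  have cdQ: "continuous_on UNIV dQ"
    unfolding dQ_def by (intro continuous_intros cG C1_compactD(5)[OF H])
  define k' where "k' r = - (inverse (sqrt r) * inverse (sqrt r) * (inverse (sqrt r) / 2))" for r :: real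
  have k: "((\<lambda>r. inverse (sqrt r)) has_real_derivative k' r) (at r)" if "0 < r" for r
    unfolding k'_def using that by (auto intro!: derivative_eq_intros simp: divide_simps)
  define N' where "N' i x = (G x \<bullet> i) *\<^sub>R (k' (Q x) *\<^sub>R dQ x) + inverse (sqrt (Q x)) *\<^sub>R H i x" for i x
  have "C1_compact C (\<lambda>x. G x \<bullet> i / sqrt (1 + (norm (G x))\<^sup>2)) (N' i)" if i: "i \<in> Basis" for i
    unfolding C1_compact_def
  proof (intro conjI allI impI)
    show "compact C" using C1_compactD(1)[OF H[OF i]] .
    show "G x \<bullet> i / sqrt (1 + (norm (G x))\<^sup>2) = 0" if "x \<notin> C" for x
      using C1_compactD(3)[OF H[OF i] that] by simp
    have "sqrt (Q x) \<noteq> 0" for x using Q1[of x] by simp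
    then show "continuous_on UNIV (N' i)"
      unfolding N'_def k'_def by (intro continuous_intros cG i cQ cdQ C1_compactD(5)[OF H]) auto
    fix x
    have "GDERIV (\<lambda>x. inverse (sqrt (Q x))) x :> k' (Q x) *\<^sub>R dQ x"
      using GDERIV_DERIV_compose[OF Qd k[OF Q1]] .
    from GDERIV_mult[OF C1_compactD(4)[OF H[OF i]] this]
    show "GDERIV (\<lambda>x. G x \<bullet> i / sqrt (1 + (norm (G x))\<^sup>2)) x :> N' i x"
      unfolding N'_def divide_inverse Q[symmetric] by (simp add: add.commute)
  qed
  then show ?thesis using that by blast
qed

context finite_domain
begin

text \<open>The first variation of the area at a test function \<open>\<psi>\<close>: the curvature
  \<open>-\<nabla>\<cdot>(\<nabla>\<psi> / \<surd>(1 + \<bar>\<nabla>\<psi>\<bar>\<^sup>2))\<close> is a subgradient.\<close>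

lemma graph_area_subgradient:
  assumes psi: "C1_compact C \<psi> G" and H: "\<And>i. i \<in> Basis \<Longrightarrow> C1_compact C (\<lambda>x. G x \<bullet> i) (H i)"
    and CD: "C \<subseteq> D"
  obtains q A where "square_integrable q" "\<And>x. x \<notin> C \<Longrightarrow> q x = 0" "0 \<le> A"
    "graph_area D \<psi> = ennreal A"
    "\<And>\<phi>. \<phi> \<in> admissible D \<Longrightarrow> graph_area D \<phi> \<noteq> top \<Longrightarrow>
      A + abs_l2 q \<bullet> (L2_of D \<phi> - L2_of D \<psi>) \<le> enn2real (graph_area D \<phi>)"
proof -
  note p = C1_compactD[OF psi]
  have padm: "\<psi> \<in> admissible D" and gp: "gradient \<psi> = G" using C1_compact_admissible[OF psi CD] by auto
  have pC1: "C1_on D \<psi>" using padm unfolding admissible_def by auto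
  obtain N' where N': "\<And>i. i \<in> Basis \<Longrightarrow> C1_compact C (\<lambda>x. G x \<bullet> i / sqrt (1 + (norm (G x))\<^sup>2)) (N' i)"
    using C1_compact_unit_normal[OF H] by blast
  define s where "s x = sqrt (1 + (norm (G x))\<^sup>2)" for x
  have s1: "1 \<le> s x" for x unfolding s_def by simp
  define q where "q x = - (\<Sum>i\<in>Basis. N' i x \<bullet> i)" for x
  have q0: "q x = 0" if "x \<notin> C" for x
    unfolding q_def using C1_compact_gradient_outside[OF N' that] by simp
  have "continuous_on UNIV q" unfolding q_def by (intro continuous_intros C1_compactD(5)[OF N'])
  then have sq: "square_integrable q" by (rule C1_compact_square_integrable[OF p(1) _ q0])
  define A where "A = (\<integral>x. indicator D x * s x \<partial>lborel)"
  have cs: "continuous_on UNIV s" unfolding s_def by (intro continuous_intros p(5))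
  \<comment> \<open>Off C the integrand equals 1 on D, so s - 1 has compact support and the finite
    measure of D accounts for the rest.\<close>
  have Is: "integrable lborel (\<lambda>x. indicator D x * s x)"
  proof -
    have "integrable lborel (\<lambda>x. s x - 1)"
      using C1_compact_gradient_outside[OF psi]
      by (intro integrable_compact_support[OF p(1)] continuous_intros cs) (simp add: s_def)
    moreover have "integrable lborel (indicator D :: _ \<Rightarrow> real)" using finite_D by simp
    ultimately have "integrable lborel (\<lambda>x. (s x - 1) + indicator D x)" by (rule Bochner_Integration.integrable_add)
    moreover have "(s x - 1) + indicator D x = indicator D x * s x" for x
      using C1_compact_gradient_outside[OF psi, of x] CD by (auto simp: indicator_def s_def)
    ultimately show ?thesis by simp
  qed
  have area_eq: "graph_area D \<phi> = (\<integral>\<^sup>+x. ennreal (indicator D x * sqrt (1 + (norm (gradient \<phi> x))\<^sup>2)) \<partial>lborel)" for \<phi>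
    unfolding graph_area_def by (intro nn_integral_cong) (auto simp: indicator_def)
  have A: "graph_area D \<psi> = ennreal A"
    unfolding area_eq gp A_def s_def[symmetric]
    using Is s1 by (intro nn_integral_eq_integral) (auto simp: s_def)
  have A0: "0 \<le> A" unfolding A_def by (intro Bochner_Integration.integral_nonneg) (auto simp: s_def)
  have main: "A + abs_l2 q \<bullet> (L2_of D \<phi> - L2_of D \<psi>) \<le> enn2real (graph_area D \<phi>)"
    if \<phi>: "\<phi> \<in> admissible D" and fin: "graph_area D \<phi> \<noteq> top" for \<phi>
  proof -
    have C1: "C1_on D \<phi>" and C0: "\<phi> \<in> C0 D" "\<psi> \<in> C0 D" using \<phi> padm unfolding admissible_def by auto
    define P where "P i k x = indicator D x * ((G x \<bullet> i / s x) * (gradient k x \<bullet> i))" for i k x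
    define R where "R i k x = indicator D x * (k x * (N' i x \<bullet> i))" for i and k :: "real^2 \<Rightarrow> real" and x
    have ibp: "integrable lborel (P i k)" "integrable lborel (R i k)"
        "(\<integral>x. P i k x \<partial>lborel) = - (\<integral>x. R i k x \<partial>lborel)" if "i \<in> Basis" "C1_on D k" for i k
      unfolding P_def R_def s_def using integration_by_parts[OF open_D CD N'[OF that(1)] that(2), of i] by blast+
    \<comment> \<open>L is the pointwise tangent bound below the area integrand W at the gradient of
      \<phi>, split into coordinates so that each term can be integrated by parts.\<close>
    define L where "L x = indicator D x * s x + (\<Sum>i\<in>Basis. P i \<phi> x - P i \<psi> x)" for x
    define W where "W x = indicator D x * sqrt (1 + (norm (gradient \<phi> x))\<^sup>2)" for x
    have IL: "integrable lborel L"
      unfolding L_def by (intro Bochner_Integration.integrable_add Is Bochner_Integration.integrable_sum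
          Bochner_Integration.integrable_diff ibp C1 pC1)
    have mW: "W \<in> borel_measurable lborel"
    proof -
      have "continuous_on D (\<lambda>x. sqrt (1 + (norm (gradient \<phi> x))\<^sup>2))"
        using C1 unfolding C1_on_def by (intro continuous_intros) auto
      from borel_measurable_continuous_on_indicator[OF sets_D this] show ?thesis unfolding W_def by simp
    qed
    have W0: "0 \<le> W x" for x unfolding W_def by simp
    have IW: "integrable lborel W"
      using fin mW W0 unfolding area_eq W_def[symmetric]
      by (intro integrableI_nonneg) (auto simp: less_top)
    have "enn2real (graph_area D \<phi>) = (\<integral>x. W x \<partial>lborel)"
      unfolding area_eq W_def[symmetric] using nn_integral_eq_integral[OF IW] W0
      by (simp add: integral_nonneg)
    moreover have "(\<integral>x. L x \<partial>lborel) \<le> (\<integral>x. W x \<partial>lborel)"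
    proof (rule integral_mono[OF IL IW])
      fix x
      show "L x \<le> W x"
      proof (cases "x \<in> D")
        case True
        have "(\<Sum>i\<in>Basis. P i \<phi> x - P i \<psi> x) = (G x \<bullet> (gradient \<phi> x - G x)) / s x"
        proof -
          have "(\<Sum>i\<in>Basis. P i \<phi> x - P i \<psi> x) = (\<Sum>i\<in>Basis. (G x \<bullet> i) * ((gradient \<phi> x - G x) \<bullet> i) / s x)"
            unfolding P_def gp using True by (intro sum.cong) (simp_all add: inner_diff_left right_diff_distrib diff_divide_distrib)
          also have "\<dots> = (G x \<bullet> (gradient \<phi> x - G x)) / s x"
            unfolding sum_divide_distrib[symmetric] by (subst euclidean_inner[of "G x"]) simp
          finally show ?thesis .
        qed
        then show ?thesis
          using sqrt_one_plus_subgradient[of "G x" "gradient \<phi> x"] True unfolding L_def W_def s_def by simp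
      qed (simp add: L_def W_def P_def)
    qed
    moreover have "(\<integral>x. L x \<partial>lborel) = A + (\<Sum>i\<in>Basis. (\<integral>x. R i \<psi> x \<partial>lborel) - (\<integral>x. R i \<phi> x \<partial>lborel))"
    proof -
      have "(\<integral>x. L x \<partial>lborel) = A + (\<integral>x. (\<Sum>i\<in>Basis. P i \<phi> x - P i \<psi> x) \<partial>lborel)"
        unfolding L_def A_def
        by (intro Bochner_Integration.integral_add Is Bochner_Integration.integrable_sum
          Bochner_Integration.integrable_diff ibp C1 pC1)
      also have "(\<integral>x. (\<Sum>i\<in>Basis. P i \<phi> x - P i \<psi> x) \<partial>lborel) = (\<Sum>i\<in>Basis. (\<integral>x. P i \<phi> x - P i \<psi> x \<partial>lborel))"
        by (intro Bochner_Integration.integral_sum Bochner_Integration.integrable_diff ibp C1 pC1)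
      also have "\<dots> = (\<Sum>i\<in>Basis. (\<integral>x. R i \<psi> x \<partial>lborel) - (\<integral>x. R i \<phi> x \<partial>lborel))"
        by (intro sum.cong refl) (simp add: Bochner_Integration.integral_diff ibp C1 pC1)
      finally show ?thesis .
    qed
    moreover have "abs_l2 q \<bullet> L2_of D k = - (\<Sum>i\<in>Basis. \<integral>x. R i k x \<partial>lborel)" if k: "k \<in> C0 D" "C1_on D k" for k
    proof -
      have "abs_l2 q \<bullet> L2_of D k = (\<integral>x. q x * (indicator D x * k x) \<partial>lborel)"
        unfolding L2_of_def by (rule abs_l2_inner[OF sq C0_square_integrable[OF k(1)]])
      also have "\<dots> = (\<integral>x. - (\<Sum>i\<in>Basis. R i k x) \<partial>lborel)"
        unfolding q_def R_def by (simp add: sum_distrib_left sum_distrib_right mult_ac)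
      also have "\<dots> = - (\<integral>x. (\<Sum>i\<in>Basis. R i k x) \<partial>lborel)" by simp
      also have "(\<integral>x. (\<Sum>i\<in>Basis. R i k x) \<partial>lborel) = (\<Sum>i\<in>Basis. \<integral>x. R i k x \<partial>lborel)"
        by (intro Bochner_Integration.integral_sum ibp k)
      finally show ?thesis .
    qed
    ultimately show ?thesis
      using C0 C1 pC1 by (simp add: inner_diff_right sum_subtractf)
  qed
  show ?thesis by (rule that[OF sq q0 A0 A main])
qed

text \<open>The linear term is continuous in L2, so the inequality for smooth competitors passes to
  recovery functions of w and survives the relaxation. At \<psi> the relaxed area is at most the
  integral A, which is the favourable direction.\<close>

lemma area_subgradient:
  assumes "C1_compact C \<psi> G" "\<And>i. i \<in> Basis \<Longrightarrow> C1_compact C (\<lambda>x. G x \<bullet> i) (H i)" "C \<subseteq> D"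
  obtains q where "square_integrable q" "\<And>x. x \<notin> C \<Longrightarrow> q x = 0" "area D (L2_of D \<psi>) \<noteq> top"
    "\<And>w. area D w \<noteq> top \<Longrightarrow>
      enn2real (area D (L2_of D \<psi>)) + abs_l2 q \<bullet> (w - L2_of D \<psi>) \<le> enn2real (area D w)"
proof -
  obtain q A where q: "square_integrable q" "\<And>x. x \<notin> C \<Longrightarrow> q x = 0" "0 \<le> A" "graph_area D \<psi> = ennreal A"
    and sub: "\<And>\<phi>. \<phi> \<in> admissible D \<Longrightarrow> graph_area D \<phi> \<noteq> top \<Longrightarrow>
      A + abs_l2 q \<bullet> (L2_of D \<phi> - L2_of D \<psi>) \<le> enn2real (graph_area D \<phi>)"
    using graph_area_subgradient[OF assms] by blast
  have "area D (L2_of D \<psi>) \<le> ennreal A"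
  proof (rule area_leI)
    fix \<epsilon> :: real assume "0 < \<epsilon>"
    then show "\<exists>\<phi>\<in>admissible D. dist (L2_of D \<phi>) (L2_of D \<psi>) < \<epsilon> \<and> graph_area D \<phi> \<le> ennreal A"
      using C1_compact_admissible(1)[OF assms(1,3)] q(4) by (intro bexI[of _ \<psi>]) auto
  qed
  then have fin: "area D (L2_of D \<psi>) \<noteq> top" and le: "enn2real (area D (L2_of D \<psi>)) \<le> A"
    using enn2real_mono[of "area D (L2_of D \<psi>)" "ennreal A"] q(3) by (auto simp: top_unique)
  have "enn2real (area D (L2_of D \<psi>)) + abs_l2 q \<bullet> (w - L2_of D \<psi>) \<le> enn2real (area D w)"
    if w: "area D w \<noteq> top" for w
  proof (rule field_le_epsilon)
    fix \<eta> :: real assume eta: "0 < \<eta>"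
    let ?r = "enn2real (area D w)" and ?b = "abs_l2 q"
    define \<epsilon> where "\<epsilon> = \<eta> / 2 / (norm ?b + 1)"
    have nb: "0 < norm ?b + 1" by (simp add: add_nonneg_pos)
    have e: "0 < \<epsilon>" using eta nb unfolding \<epsilon>_def by simp
    have "\<epsilon> * (norm ?b + 1) = \<eta> / 2"
      using nb unfolding \<epsilon>_def by (intro nonzero_eq_divide_eq[THEN iffD1]) auto
    have "area D w = ennreal ?r" using w by (simp add: less_top)
    also have "\<dots> < ennreal (?r + \<eta> / 2)" using eta by (intro ennreal_lessI) (auto simp: add_nonneg_pos)
    finally have lt: "area D w < ennreal (?r + \<eta> / 2)" .
    obtain \<phi> where \<phi>: "\<phi> \<in> admissible D" "dist (L2_of D \<phi>) w < \<epsilon>" "graph_area D \<phi> < ennreal (?r + \<eta> / 2)"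
      by (rule area_lessD[OF lt e])
    have "enn2real (graph_area D \<phi>) \<le> ?r + \<eta> / 2"
      using enn2real_mono[OF less_imp_le[OF \<phi>(3)] ennreal_less_top] eta
        enn2real_ennreal[of "?r + \<eta> / 2"] by (simp del: ennreal_plus)
    moreover have "A + ?b \<bullet> (L2_of D \<phi> - L2_of D \<psi>) \<le> enn2real (graph_area D \<phi>)"
      using \<phi> by (intro sub) auto
    moreover have "?b \<bullet> (w - L2_of D \<phi>) \<le> \<eta> / 2"
    proof -
      have "?b \<bullet> (w - L2_of D \<phi>) \<le> norm ?b * norm (w - L2_of D \<phi>)" by (rule norm_cauchy_schwarz)
      also have "\<dots> \<le> (norm ?b + 1) * \<epsilon>"
        using \<phi>(2) by (intro mult_mono) (auto simp: dist_norm norm_minus_commute)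
      finally show ?thesis using \<open>\<epsilon> * (norm ?b + 1) = \<eta> / 2\<close> by (simp add: mult.commute)
    qed
    ultimately show "enn2real (area D (L2_of D \<psi>)) + ?b \<bullet> (w - L2_of D \<psi>) \<le> ?r + \<eta>"
      using le by (simp add: inner_diff_right)
  qed
  then show ?thesis using that[OF q(1,2) fin] by blast
qed

end

context droplet
begin

text \<open>The vector b is the L2 gradient of the energy, curvature plus gravity. Subtracting its
  mean over D moves it into \<open>X1 D\<close> without changing its pairing with differences in
  \<open>X1 D\<close>; this subtraction is the choice of \<lambda>.\<close>

lemma test_function_in_domain:
  assumes psi: "C1_compact C \<psi> G" and H: "\<And>i. i \<in> Basis \<Longrightarrow> C1_compact C (\<lambda>x. G x \<bullet> i) (H i)"
    and CD: "C \<subseteq> D" and X: "L2_of D \<psi> - U0 \<in> X1 D"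
  shows "subgrad (X1 D) Ydom efun (L2_of D \<psi> - U0) \<noteq> {}"
proof -
  obtain q where q: "square_integrable q" "\<And>x. x \<notin> C \<Longrightarrow> q x = 0" "area D (L2_of D \<psi>) \<noteq> top"
    and sub: "\<And>w. area D w \<noteq> top \<Longrightarrow>
      enn2real (area D (L2_of D \<psi>)) + abs_l2 q \<bullet> (w - L2_of D \<psi>) \<le> enn2real (area D w)"
    using area_subgradient[OF psi H CD] by blast
  let ?\<Psi> = "L2_of D \<psi>"
  define b where "b = \<gamma>LG *\<^sub>R abs_l2 q + (\<rho> * g) *\<^sub>R ?\<Psi>"
  define p where "p = b - ((b \<bullet> oneD) / (norm oneD)\<^sup>2) *\<^sub>R oneD"
  have one: "(norm oneD)\<^sup>2 \<noteq> 0" using norm_oneD measure_D_pos by simp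
  have supp: "abs_l2 (\<lambda>x. f x) \<in> L2_on D" if "square_integrable f" "\<And>x. x \<notin> D \<Longrightarrow> f x = 0" for f
    unfolding L2_on_def mem_Collect_eq using rep_abs_l2[OF that(1)] by eventually_elim (use that(2) in auto)
  have "\<psi> \<in> C0 D" using C1_compact_admissible(1)[OF psi CD] unfolding admissible_def by auto
  then have "?\<Psi> \<in> L2_on D" unfolding L2_of_def by (intro supp C0_square_integrable) auto
  moreover have "abs_l2 q \<in> L2_on D" using q CD by (intro supp) auto
  moreover have "oneD \<in> L2_on D" unfolding oneD_def by (intro supp square_integrable_indicator) auto
  ultimately have "p \<in> L2_on D"
    unfolding p_def b_def using subspace_L2_on by (intro subspace_diff subspace_add subspace_scale) auto
  moreover have "p \<bullet> oneD = 0"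
    unfolding p_def using one by (simp add: inner_diff_left power2_norm_eq_inner)
  ultimately have pX: "p \<in> X1 D" unfolding X1_eq by simp
  have vY: "?\<Psi> - U0 \<in> Ydom" unfolding Ydom_def using X q(3) by simp
  have "efun (?\<Psi> - U0) + p \<bullet> (w - (?\<Psi> - U0)) \<le> efun w" if w: "w \<in> Ydom" for w
  proof -
    let ?W = "w + U0"
    have d: "w - (?\<Psi> - U0) = ?W - ?\<Psi>" by simp
    have "?W - ?\<Psi> \<in> X1 D"
      using subspace_diff[OF subspace_X1 _ X, of w] w unfolding Ydom_def d by blast
    then have "(?W - ?\<Psi>) \<bullet> oneD = 0" unfolding X1_eq by blast
    then have "p \<bullet> (?W - ?\<Psi>) = b \<bullet> (?W - ?\<Psi>)"
      unfolding p_def inner_diff_left[of b] inner_scaleR_left inner_commute[of oneD] by simp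
    also have "\<dots> = \<gamma>LG * (abs_l2 q \<bullet> (?W - ?\<Psi>)) + \<rho> * g * (?\<Psi> \<bullet> (?W - ?\<Psi>))"
      unfolding b_def inner_add_left inner_scaleR_left ..
    finally have pb: "p \<bullet> (?W - ?\<Psi>) = \<gamma>LG * (abs_l2 q \<bullet> (?W - ?\<Psi>)) + \<rho> * g * (?\<Psi> \<bullet> (?W - ?\<Psi>))" .
    have "\<gamma>LG * (enn2real (area D ?\<Psi>) + abs_l2 q \<bullet> (?W - ?\<Psi>)) \<le> \<gamma>LG * enn2real (area D ?W)"
      using w gamma unfolding Ydom_def by (intro mult_left_mono sub) auto
    moreover have "\<rho> * g * ((norm ?\<Psi>)\<^sup>2 / 2 + ?\<Psi> \<bullet> (?W - ?\<Psi>)) \<le> \<rho> * g * ((norm ?W)\<^sup>2 / 2)"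
    proof (rule mult_left_mono)
      have "(norm ?W)\<^sup>2 = (norm ?\<Psi>)\<^sup>2 + 2 * (?\<Psi> \<bullet> (?W - ?\<Psi>)) + (norm (?W - ?\<Psi>))\<^sup>2"
        unfolding power2_norm_eq_inner inner_diff_left inner_diff_right inner_commute[of ?\<Psi> ?W] by simp
      moreover have "0 \<le> (norm (?W - ?\<Psi>))\<^sup>2" by simp
      ultimately show "(norm ?\<Psi>)\<^sup>2 / 2 + ?\<Psi> \<bullet> (?W - ?\<Psi>) \<le> (norm ?W)\<^sup>2 / 2" by linarith
    qed (use rho grav in simp)
    ultimately show ?thesis unfolding d pb efun_def diff_add_cancel distrib_left by simp
  qed
  then have "p \<in> subgrad (X1 D) Ydom efun (?\<Psi> - U0)" unfolding subgrad_def using pX vY by blast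
  then show ?thesis by blast
qed

end

section \<open>Density of test functions\<close>

lemma max_square_has_derivative: "((\<lambda>t::real. (max 0 t)\<^sup>2) has_real_derivative 2 * max 0 t) (at t)"
proof (cases t "0::real" rule: linorder_cases)
  case less
  have "((\<lambda>t::real. 0) has_real_derivative 2 * max 0 t) (at t)" using less by simp
  then show ?thesis
    by (rule has_field_derivative_transform_within_open[OF _ open_lessThan[of 0]]) (use less in auto)
next
  case equal
  have "((\<lambda>h::real. (max 0 h)\<^sup>2 / h) \<longlongrightarrow> 0) (at 0)"
  proof (rule Lim_null_comparison)
    show "((\<lambda>h::real. \<bar>h\<bar>) \<longlongrightarrow> 0) (at 0)" by (intro tendsto_rabs_zero tendsto_ident_at)
  qed (auto simp: max_def power2_eq_square intro!: always_eventually)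
  then show ?thesis unfolding equal DERIV_def by simp
next
  case greater
  have "((\<lambda>t::real. t\<^sup>2) has_real_derivative 2 * max 0 t) (at t)"
    using greater by (auto intro!: derivative_eq_intros)
  then show ?thesis
    by (rule has_field_derivative_transform_within_open[OF _ open_greaterThan[of 0]]) (use greater in auto)
qed

text \<open>These are the C2 functions with compact support in D; H i is the gradient of the i-th
  partial derivative.\<close>

definition test_function :: "(real^2) set \<Rightarrow> (real^2 \<Rightarrow> real) \<Rightarrow> bool" where
  "test_function D \<psi> \<longleftrightarrow> (\<exists>C G H. C \<subseteq> D \<and> C1_compact C \<psi> G \<and>
     (\<forall>i\<in>Basis. C1_compact C (\<lambda>x. G x \<bullet> i) (H i)))"

lemma test_functionI:
  assumes "C \<subseteq> D" "C1_compact C \<psi> G" "\<And>i. i \<in> Basis \<Longrightarrow> C1_compact C (\<lambda>x. G x \<bullet> i) (H i)"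
  shows "test_function D \<psi>"
  unfolding test_function_def using assms by (intro exI[of _ C] exI[of _ G] exI[of _ H] conjI ballI)

lemma C1_compact_mono:
  "C1_compact C f d \<Longrightarrow> C \<subseteq> C' \<Longrightarrow> compact C' \<Longrightarrow> C1_compact C' f d"
  unfolding C1_compact_def by blast

lemma C1_compact_lincomb:
  assumes "C1_compact C f d" "C1_compact C f' d'"
  shows "C1_compact C (\<lambda>x. a * f x + b * f' x) (\<lambda>x. a *\<^sub>R d x + b *\<^sub>R d' x)"
proof -
  have "GDERIV (\<lambda>x. a * f x + b * f' x) x :> a *\<^sub>R d x + b *\<^sub>R d' x" for x
    using GDERIV_add[OF GDERIV_mult[OF GDERIV_const[where k=a] C1_compactD(4)[OF assms(1)]]
        GDERIV_mult[OF GDERIV_const[where k=b] C1_compactD(4)[OF assms(2)]]] by simp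
  moreover have "continuous_on UNIV (\<lambda>x. a *\<^sub>R d x + b *\<^sub>R d' x)"
    using assms by (intro continuous_intros) (auto simp: C1_compact_def)
  ultimately show ?thesis using assms unfolding C1_compact_def by simp
qed

lemma C1_compact_mult:
  assumes "C1_compact C f d" "C1_compact C f' d'"
  shows "C1_compact C (\<lambda>x. f x * f' x) (\<lambda>x. f x *\<^sub>R d' x + f' x *\<^sub>R d x)"
proof -
  have "GDERIV (\<lambda>x. f x * f' x) x :> f x *\<^sub>R d' x + f' x *\<^sub>R d x" for x
    using C1_compactD(4)[OF assms(1)] C1_compactD(4)[OF assms(2)] by (rule GDERIV_mult)
  moreover have "continuous_on UNIV (\<lambda>x. f x *\<^sub>R d' x + f' x *\<^sub>R d x)"
    using C1_compactD(6)[OF assms(1)] C1_compactD(6)[OF assms(2)] assms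
    by (intro continuous_intros) (auto simp: C1_compact_def)
  ultimately show ?thesis using assms unfolding C1_compact_def by simp
qed

lemma test_function_common:
  assumes "test_function D f" "test_function D f'"
  obtains C G H G' H' where "C \<subseteq> D" "C1_compact C f G" "\<And>i. i \<in> Basis \<Longrightarrow> C1_compact C (\<lambda>x. G x \<bullet> i) (H i)"
    "C1_compact C f' G'" "\<And>i. i \<in> Basis \<Longrightarrow> C1_compact C (\<lambda>x. G' x \<bullet> i) (H' i)"
proof -
  obtain C G H where 1: "C \<subseteq> D" "C1_compact C f G" "\<forall>i\<in>Basis. C1_compact C (\<lambda>x. G x \<bullet> i) (H i)"
    using assms(1) unfolding test_function_def by blast
  obtain C' G' H' where 2: "C' \<subseteq> D" "C1_compact C' f' G'" "\<forall>i\<in>Basis. C1_compact C' (\<lambda>x. G' x \<bullet> i) (H' i)"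
    using assms(2) unfolding test_function_def by blast
  have c: "compact (C \<union> C')" using C1_compactD(1)[OF 1(2)] C1_compactD(1)[OF 2(2)] by (rule compact_Un)
  show ?thesis
    using 1 2 by (intro that[of "C \<union> C'" G H G' H'] C1_compact_mono[OF _ _ c]) auto
qed

lemma test_function_lincomb:
  assumes "test_function D f" "test_function D f'"
  shows "test_function D (\<lambda>x. a * f x + b * f' x)"
proof -
  obtain C G H G' H' where C: "C \<subseteq> D" "C1_compact C f G" "\<And>i. i \<in> Basis \<Longrightarrow> C1_compact C (\<lambda>x. G x \<bullet> i) (H i)"
    "C1_compact C f' G'" "\<And>i. i \<in> Basis \<Longrightarrow> C1_compact C (\<lambda>x. G' x \<bullet> i) (H' i)"
    by (rule test_function_common[OF assms], rule that)
  have "C1_compact C (\<lambda>x. (a *\<^sub>R G x + b *\<^sub>R G' x) \<bullet> i) (\<lambda>x. a *\<^sub>R H i x + b *\<^sub>R H' i x)" if "i \<in> Basis" for i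
    using C1_compact_lincomb[OF C(3)[OF that] C(5)[OF that], of a b] by (simp add: inner_add_left)
  then show ?thesis by (rule test_functionI[OF C(1) C1_compact_lincomb[OF C(2,4)]])
qed

lemma test_function_mult:
  assumes "test_function D f" "test_function D f'"
  shows "test_function D (\<lambda>x. f x * f' x)"
proof -
  obtain C G H G' H' where C: "C \<subseteq> D" "C1_compact C f G" "\<And>i. i \<in> Basis \<Longrightarrow> C1_compact C (\<lambda>x. G x \<bullet> i) (H i)"
    "C1_compact C f' G'" "\<And>i. i \<in> Basis \<Longrightarrow> C1_compact C (\<lambda>x. G' x \<bullet> i) (H' i)"
    by (rule test_function_common[OF assms], rule that)
  have "C1_compact C (\<lambda>x. (f x *\<^sub>R G' x + f' x *\<^sub>R G x) \<bullet> i)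
      (\<lambda>x. 1 *\<^sub>R (f x *\<^sub>R H' i x + (G' x \<bullet> i) *\<^sub>R G x) + 1 *\<^sub>R (f' x *\<^sub>R H i x + (G x \<bullet> i) *\<^sub>R G' x))"
    if "i \<in> Basis" for i
    using C1_compact_lincomb[OF C1_compact_mult[OF C(2) C(5)[OF that]] C1_compact_mult[OF C(4) C(3)[OF that]], of 1 1]
    by (simp add: inner_add_left)
  then show ?thesis by (rule test_functionI[OF C(1) C1_compact_mult[OF C(2,4)]])
qed

lemma test_function_zero: "test_function D (\<lambda>_. 0)"
  by (rule test_functionI[of "{}" _ _ "\<lambda>_. 0" "\<lambda>_ _. 0"]) (auto simp: C1_compact_def GDERIV_const)

text \<open>The identity 1 - f f' = (1 - f) + (1 - f') - (1 - f)(1 - f') expresses the complement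
  through test functions, although f and f' themselves have no compact support.\<close>

lemma test_function_complement_mult:
  assumes "test_function D (\<lambda>x. 1 - f x)" "test_function D (\<lambda>x. 1 - f' x)"
  shows "test_function D (\<lambda>x. 1 - f x * f' x)"
proof -
  have "test_function D (\<lambda>x. 1 * (1 * (1 - f x) + 1 * (1 - f' x)) + (-1) * ((1 - f x) * (1 - f' x)))"
    by (intro test_function_lincomb test_function_mult assms)
  then show ?thesis by (simp add: algebra_simps)
qed

lemma test_function_complement_power:
  assumes "test_function D (\<lambda>x. 1 - f x)"
  shows "test_function D (\<lambda>x. 1 - f x ^ n)"
proof (induction n)
  case 0
  then show ?case by (simp add: test_function_zero)
next
  case (Suc n)
  then show ?case using test_function_complement_mult[OF assms] by simp
qed

lemma test_function_complement_prod:
  assumes "\<And>k::nat. test_function D (\<lambda>x. 1 - f k x)"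
  shows "test_function D (\<lambda>x. 1 - (\<Prod>k<n. f k x))"
proof (induction n)
  case 0
  then show ?case by (simp add: test_function_zero)
next
  case (Suc n)
  then show ?case using test_function_complement_mult[OF Suc assms[of n]] by simp
qed

text \<open>The cube of a positive part is C2, which the square is not; smoothness at the rim of the
  ball comes from this exponent alone.\<close>

definition bump :: "'a::real_inner \<Rightarrow> real \<Rightarrow> 'a \<Rightarrow> real" where
  "bump c r x = (max 0 (1 - (norm (x - c))\<^sup>2 / r\<^sup>2)) ^ 3"

lemma bump_bounds: "0 \<le> bump c r x" "bump c r x \<le> 1"
  unfolding bump_def by (auto intro!: power_le_one)

lemma bump_pos: "0 < r \<Longrightarrow> norm (x - c) < r \<Longrightarrow> 0 < bump c r x"
  unfolding bump_def by (simp add: divide_less_eq power_strict_mono)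

lemma bump_outside:
  assumes "0 < r" "r \<le> norm (x - c)"
  shows "max 0 (1 - (norm (x - c))\<^sup>2 / r\<^sup>2) = 0"
proof -
  have "r\<^sup>2 \<le> (norm (x - c))\<^sup>2" using assms by (intro power_mono) auto
  then show ?thesis using assms by (simp add: le_divide_eq)
qed

lemma test_function_bump:
  assumes r: "0 < r" and sub: "cball c r \<subseteq> D"
  shows "test_function D (bump c r)"
proof -
  define t where "t x = 1 - (norm (x - c))\<^sup>2 / r\<^sup>2" for x :: "real^2"
  define dt where "dt x = (- 2 / r\<^sup>2) *\<^sub>R (x - c)" for x :: "real^2"
  define m where "m x = max 0 (t x)" for x
  have m0: "m x = 0" if "x \<notin> cball c r" for x
    unfolding m_def t_def using that r by (intro bump_outside) (auto simp: dist_norm norm_minus_commute)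
  have t: "GDERIV t x :> dt x" for x
  proof -
    have "GDERIV (\<lambda>x. (norm (x - c))\<^sup>2) x :> 2 *\<^sub>R (x - c)"
      unfolding gderiv_def power2_norm_eq_inner
      by (auto intro!: derivative_eq_intros simp: inner_commute inner_diff_left inner_diff_right)
    from GDERIV_add[OF GDERIV_const[where k=1] GDERIV_mult[OF GDERIV_const[where k="- 1 / r\<^sup>2"] this]]
    have "GDERIV (\<lambda>x. 1 + - 1 / r\<^sup>2 * (norm (x - c))\<^sup>2) x :> dt x" unfolding dt_def by simp
    moreover have "(\<lambda>x. 1 + - 1 / r\<^sup>2 * (norm (x - c))\<^sup>2) = t" unfolding t_def by (simp add: fun_eq_iff)
    ultimately show ?thesis by simp
  qed
  have m2: "GDERIV (\<lambda>x. (m x)\<^sup>2) x :> (2 * m x) *\<^sub>R dt x" for x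
    unfolding m_def using GDERIV_DERIV_compose[OF t max_square_has_derivative] .
  \<comment> \<open>Writing the cube as t m^2 reduces all derivatives to that of the squared
    positive part.\<close>
  have tm: "t x * m x = (m x)\<^sup>2" for x unfolding m_def by (auto simp: max_def power2_eq_square)
  have bump_eq: "bump c r = (\<lambda>x. t x * (m x)\<^sup>2)"
  proof
    fix x
    have "t x * (m x)\<^sup>2 = (t x * m x) * m x" by (simp add: power2_eq_square)
    also have "\<dots> = m x ^ 3" unfolding tm by (simp add: power3_eq_cube power2_eq_square)
    finally show "bump c r x = t x * (m x)\<^sup>2" unfolding bump_def m_def t_def by simp
  qed
  define G where "G x = (3 * (m x)\<^sup>2) *\<^sub>R dt x" for x
  have G: "GDERIV (bump c r) x :> G x" for x
  proof -
    have "t x *\<^sub>R ((2 * m x) *\<^sub>R dt x) + (m x)\<^sup>2 *\<^sub>R dt x = (2 * (t x * m x) + (m x)\<^sup>2) *\<^sub>R dt x"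
      by (simp add: scaleR_add_left mult.left_commute)
    also have "\<dots> = G x" unfolding tm G_def by simp
    finally show ?thesis unfolding bump_eq using GDERIV_mult[OF t m2, of x] by simp
  qed
  have ct: "continuous_on UNIV t" by (rule gderiv_continuous[OF t])
  have cdt: "continuous_on UNIV dt" unfolding dt_def by (intro continuous_intros)
  have cm: "continuous_on UNIV m" unfolding m_def by (intro continuous_intros ct)
  define H where "H i x = (3 * (m x)\<^sup>2) *\<^sub>R ((- 2 / r\<^sup>2) *\<^sub>R i) + (dt x \<bullet> i) *\<^sub>R ((6 * m x) *\<^sub>R dt x)" for i x
  have H: "GDERIV (\<lambda>x. G x \<bullet> i) x :> H i x" for i x
  proof -
    have a: "GDERIV (\<lambda>x. 3 * (m x)\<^sup>2) x :> (6 * m x) *\<^sub>R dt x"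
      using GDERIV_mult[OF GDERIV_const[where k=3] m2] by simp
    have b: "GDERIV (\<lambda>x. dt x \<bullet> i) x :> (- 2 / r\<^sup>2) *\<^sub>R i"
    proof -
      have "GDERIV (\<lambda>x. (x - c) \<bullet> i) x :> i"
        unfolding gderiv_def by (auto intro!: derivative_eq_intros)
      from GDERIV_mult[OF GDERIV_const[where k="- 2 / r\<^sup>2"] this] show ?thesis unfolding dt_def by simp
    qed
    show ?thesis using GDERIV_mult[OF a b] unfolding G_def H_def by simp
  qed
  have "C1_compact (cball c r) (bump c r) G"
    unfolding C1_compact_def
  proof (intro conjI allI impI)
    show "continuous_on UNIV G" unfolding G_def by (intro continuous_intros cm cdt)
    show "bump c r x = 0" if "x \<notin> cball c r" for x unfolding bump_eq using m0[OF that] by simp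
  qed (auto simp: G)
  moreover have "C1_compact (cball c r) (\<lambda>x. G x \<bullet> i) (H i)" for i
    unfolding C1_compact_def
  proof (intro conjI allI impI)
    show "continuous_on UNIV (H i)" unfolding H_def by (intro continuous_intros cm cdt)
    show "G x \<bullet> i = 0" if "x \<notin> cball c r" for x unfolding G_def using m0[OF that] by simp
  qed (auto simp: H)
  ultimately show ?thesis by (rule test_functionI[OF sub])
qed

lemma test_function_outside: "test_function D \<psi> \<Longrightarrow> x \<notin> D \<Longrightarrow> \<psi> x = 0"
  unfolding test_function_def C1_compact_def by blast

text \<open>Covering an open set by countably many balls with bumps \<open>\<beta>\<^sub>k\<close>, the test functions
  \<open>1 - \<Prod>\<^sub>k\<^sub><\<^sub>n (1 - \<beta>\<^sub>k)\<^sup>n\<close> converge to its indicator.\<close>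

lemma open_indicator_approximation:
  assumes U: "open (U :: (real^2) set)"
  obtains \<psi> :: "nat \<Rightarrow> real^2 \<Rightarrow> real" where "\<And>n. test_function U (\<psi> n)"
    "\<And>n x. 0 \<le> \<psi> n x" "\<And>n x. \<psi> n x \<le> 1" "\<And>x. (\<lambda>n. \<psi> n x) \<longlonglongrightarrow> indicator U x"
proof (cases "U = {}")
  case True
  then show ?thesis using that[of "\<lambda>_ _. 0"] test_function_zero by simp
next
  case False
  define \<F> where "\<F> = {ball c r | c r. 0 < r \<and> cball c r \<subseteq> U}"
  have UF: "\<Union>\<F> = U"
  proof
    show "U \<subseteq> \<Union>\<F>"
    proof
      fix x assume "x \<in> U"
      then obtain r where "0 < r" "cball x r \<subseteq> U" using U open_contains_cball by blast
      then show "x \<in> \<Union>\<F>" unfolding \<F>_def by (intro UnionI[of "ball x r"]) auto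
    qed
  qed (auto simp: \<F>_def subset_iff)
  obtain \<F>' where F': "\<F>' \<subseteq> \<F>" "countable \<F>'" "\<Union>\<F>' = \<Union>\<F>"
    using Lindelof[of \<F>] unfolding \<F>_def by auto
  have "\<F>' \<noteq> {}" using F'(3) UF False by auto
  then have rg: "range (from_nat_into \<F>') = \<F>'" using F'(2) by (rule range_from_nat_into)
  have "\<exists>c r. from_nat_into \<F>' k = ball c r \<and> 0 < r \<and> cball c r \<subseteq> U" for k
    using rg F'(1) unfolding \<F>_def by blast
  then obtain c r where cr: "\<And>k. from_nat_into \<F>' k = ball (c k) (r k)" "\<And>k. 0 < r k" "\<And>k. cball (c k) (r k) \<subseteq> U"
    by metis
  define \<beta> where "\<beta> k = bump (c k) (r k)" for k
  define P where "P n x = (\<Prod>k<n. (1 - \<beta> k x) ^ n)" for n x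
  have b: "0 \<le> 1 - \<beta> k x" "1 - \<beta> k x \<le> 1" for k x unfolding \<beta>_def using bump_bounds[of "c k" "r k" x] by auto
  have P: "0 \<le> P n x" "P n x \<le> 1" for n x
    unfolding P_def using b by (auto intro!: prod_nonneg prod_le_1 power_le_one)
  have "test_function U (\<lambda>x. 1 - P n x)" for n
    unfolding P_def
  proof (intro test_function_complement_prod test_function_complement_power)
    show "test_function U (\<lambda>x. 1 - (1 - \<beta> k x))" for k
      using test_function_bump[OF cr(2,3), of k] unfolding \<beta>_def by simp
  qed
  moreover have "(\<lambda>n. 1 - P n x) \<longlonglongrightarrow> indicator U x" for x
  proof (cases "x \<in> U")
    case True
    then obtain k where "x \<in> from_nat_into \<F>' k" using UF F'(3) rg by blast
    then have "0 < \<beta> k x"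
      unfolding \<beta>_def cr(1) by (intro bump_pos cr) (simp add: dist_norm norm_minus_commute)
    then have z: "(\<lambda>n. (1 - \<beta> k x) ^ n) \<longlonglongrightarrow> 0" using b[of k x] by (intro LIMSEQ_realpow_zero) auto
    \<comment> \<open>As soon as n exceeds k, the factor of a ball containing x is present; the
      other factors are at most 1, and the exponent n drives this one to zero.\<close>
    have "(\<lambda>n. P n x) \<longlonglongrightarrow> 0"
    proof (rule Lim_null_comparison[OF _ z])
      show "eventually (\<lambda>n. norm (P n x) \<le> (1 - \<beta> k x) ^ n) sequentially"
      proof (rule eventually_sequentiallyI[of "Suc k"])
        fix n assume n: "Suc k \<le> n"
        have "P n x = (1 - \<beta> k x) ^ n * (\<Prod>j\<in>{..<n} - {k}. (1 - \<beta> j x) ^ n)"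
          unfolding P_def using n by (subst prod.remove[of _ k]) auto
        also have "\<dots> \<le> (1 - \<beta> k x) ^ n * 1"
          using b by (intro mult_left_mono prod_le_1) (auto intro: power_le_one)
        finally show "norm (P n x) \<le> (1 - \<beta> k x) ^ n" using P[of n x] by simp
      qed
    qed
    from tendsto_diff[OF tendsto_const this, of 1] show ?thesis using True by simp
  next
    case False
    then have "1 - P n x = 0" for n using test_function_outside[OF \<open>\<And>n. test_function U (\<lambda>x. 1 - P n x)\<close>] by blast
    then show ?thesis using False by simp
  qed
  ultimately show ?thesis using that[of "\<lambda>n x. 1 - P n x"] P by simp
qed

lemma test_function_subset: "test_function U \<psi> \<Longrightarrow> U \<subseteq> D \<Longrightarrow> test_function D \<psi>"
  unfolding test_function_def by blast

section \<open>Nonnegative test functions approximate nonnegative elements of L2(D)\<close>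

context finite_domain
begin

text \<open>Nonnegativity of the approximants keeps them compatible with the constraint u \<ge> 0;
  the volume is corrected only at the end, by scaling.\<close>

definition approximable :: "l2 \<Rightarrow> bool" where
  "approximable w \<longleftrightarrow> (\<forall>\<epsilon>>0. \<exists>\<psi>. test_function D \<psi> \<and> (\<forall>x. 0 \<le> \<psi> x) \<and> norm (L2_of D \<psi> - w) < \<epsilon>)"

lemma test_function_C0: "test_function D \<psi> \<Longrightarrow> \<psi> \<in> C0 D"
  using C1_compact_admissible(1) unfolding test_function_def admissible_def by blast

lemma approximable_limit:
  assumes "\<And>\<epsilon>. 0 < \<epsilon> \<Longrightarrow> \<exists>w'. approximable w' \<and> norm (w' - w) < \<epsilon>"
  shows "approximable w"
  unfolding approximable_def
proof (intro allI impI)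
  fix \<epsilon> :: real assume "0 < \<epsilon>"
  then obtain w' where w': "approximable w'" "norm (w' - w) < \<epsilon> / 2" using assms[of "\<epsilon> / 2"] by auto
  then obtain \<psi> where "test_function D \<psi>" "\<forall>x. 0 \<le> \<psi> x" "norm (L2_of D \<psi> - w') < \<epsilon> / 2"
    unfolding approximable_def using \<open>0 < \<epsilon>\<close> half_gt_zero by blast
  moreover from this have "norm (L2_of D \<psi> - w) < \<epsilon>"
    using norm_triangle_ineq[of "L2_of D \<psi> - w'" "w' - w"] w'(2) by simp
  ultimately show "\<exists>\<psi>. test_function D \<psi> \<and> (\<forall>x. 0 \<le> \<psi> x) \<and> norm (L2_of D \<psi> - w) < \<epsilon>" by blast
qed

lemma approximable_lincomb:
  assumes v: "approximable v" and w: "approximable w" and ab: "0 \<le> a" "0 \<le> b"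
  shows "approximable (a *\<^sub>R v + b *\<^sub>R w)"
  unfolding approximable_def
proof (intro allI impI)
  fix \<epsilon> :: real assume e: "0 < \<epsilon>"
  define \<delta> where "\<delta> = \<epsilon> / (a + b + 1)"
  have d: "0 < \<delta>" "(a + b + 1) * \<delta> = \<epsilon>" using e ab unfolding \<delta>_def by (auto simp: add_nonneg_pos)
  obtain \<phi> where \<phi>: "test_function D \<phi>" "\<forall>x. 0 \<le> \<phi> x" "norm (L2_of D \<phi> - v) < \<delta>"
    using v d(1) unfolding approximable_def by blast
  obtain \<psi> where \<psi>: "test_function D \<psi>" "\<forall>x. 0 \<le> \<psi> x" "norm (L2_of D \<psi> - w) < \<delta>"
    using w d(1) unfolding approximable_def by blast
  have eq: "L2_of D (\<lambda>x. a * \<phi> x + b * \<psi> x) - (a *\<^sub>R v + b *\<^sub>R w) =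
      a *\<^sub>R (L2_of D \<phi> - v) + b *\<^sub>R (L2_of D \<psi> - w)"
    unfolding L2_of_lincomb[OF test_function_C0[OF \<phi>(1)] test_function_C0[OF \<psi>(1)]]
    by (simp add: algebra_simps)
  have "norm (L2_of D (\<lambda>x. a * \<phi> x + b * \<psi> x) - (a *\<^sub>R v + b *\<^sub>R w)) \<le>
      a * norm (L2_of D \<phi> - v) + b * norm (L2_of D \<psi> - w)"
    unfolding eq using norm_triangle_ineq[of "a *\<^sub>R (L2_of D \<phi> - v)" "b *\<^sub>R (L2_of D \<psi> - w)"] ab by simp
  also have "\<dots> \<le> a * \<delta> + b * \<delta>" using \<phi>(3) \<psi>(3) ab by (intro add_mono mult_left_mono) auto
  also have "\<dots> < (a + b + 1) * \<delta>" using d(1) by (simp add: distrib_right)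
  finally show "\<exists>\<psi>. test_function D \<psi> \<and> (\<forall>x. 0 \<le> \<psi> x) \<and> norm (L2_of D \<psi> - (a *\<^sub>R v + b *\<^sub>R w)) < \<epsilon>"
    using test_function_lincomb[OF \<phi>(1) \<psi>(1)] \<phi>(2) \<psi>(2) ab d(2)
    by (intro exI[of _ "\<lambda>x. a * \<phi> x + b * \<psi> x"]) simp
qed

lemma norm_abs_diff_tendsto:
  fixes fs :: "nat \<Rightarrow> real^2 \<Rightarrow> real"
  assumes sq: "\<And>n. square_integrable (fs n)" "square_integrable f" "square_integrable h"
    and lim: "\<And>x. (\<lambda>n. fs n x) \<longlonglongrightarrow> f x" and bd: "\<And>n x. \<bar>fs n x - f x\<bar> \<le> \<bar>h x\<bar>"
  shows "(\<lambda>n. norm (abs_l2 (fs n) - abs_l2 f)) \<longlonglongrightarrow> 0"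
proof -
  have sqd: "square_integrable (\<lambda>x. fs n x - f x)" for n by (intro square_integrable_diff sq)
  have "(\<lambda>n. \<integral>x. (fs n x - f x)\<^sup>2 \<partial>lborel) \<longlonglongrightarrow> (\<integral>x. 0 \<partial>(lborel :: (real^2) measure))"
  proof (rule integral_dominated_convergence[where w="\<lambda>x. (h x)\<^sup>2"])
    show "integrable lborel (\<lambda>x. (h x)\<^sup>2)" using sq(3) unfolding square_integrable_def by blast
    show "(\<lambda>x. (fs n x - f x)\<^sup>2) \<in> borel_measurable lborel" for n
      using sqd[of n] unfolding square_integrable_def by (intro borel_measurable_power) blast
    show "AE x in lborel. (\<lambda>n. (fs n x - f x)\<^sup>2) \<longlonglongrightarrow> 0"
    proof (rule AE_I2)
      fix x
      have "(\<lambda>n. fs n x - f x) \<longlonglongrightarrow> 0" using lim[of x] by (simp add: LIM_zero)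
      from tendsto_power[OF this, of 2] show "(\<lambda>n. (fs n x - f x)\<^sup>2) \<longlonglongrightarrow> 0" by simp
    qed
    show "AE x in lborel. norm ((fs n x - f x)\<^sup>2) \<le> (h x)\<^sup>2" for n
    proof (rule AE_I2)
      fix x
      have "(fs n x - f x)\<^sup>2 \<le> (h x)\<^sup>2" using bd[of n x] by (simp only: abs_le_square_iff)
      then show "norm ((fs n x - f x)\<^sup>2) \<le> (h x)\<^sup>2" by simp
    qed
  qed simp
  then have "(\<lambda>n. (norm (abs_l2 (fs n) - abs_l2 f))\<^sup>2) \<longlonglongrightarrow> 0"
    unfolding abs_l2_diff[OF sq(1,2)] abs_l2_norm[OF sqd] by simp
  from tendsto_real_sqrt[OF this] show ?thesis by simp
qed

lemma approximable_sequence: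
  fixes fs :: "nat \<Rightarrow> real^2 \<Rightarrow> real"
  assumes "\<And>n. approximable (abs_l2 (fs n))" "\<And>n. square_integrable (fs n)" "square_integrable f" "square_integrable h"
    "\<And>x. (\<lambda>n. fs n x) \<longlonglongrightarrow> f x" "\<And>n x. \<bar>fs n x - f x\<bar> \<le> \<bar>h x\<bar>"
  shows "approximable (abs_l2 f)"
proof (rule approximable_limit)
  fix \<epsilon> :: real assume e: "0 < \<epsilon>"
  have "eventually (\<lambda>n. norm (abs_l2 (fs n) - abs_l2 f) < \<epsilon>) sequentially"
    using order_tendstoD(2)[OF norm_abs_diff_tendsto[OF assms(2-6)] e] .
  then obtain n where "norm (abs_l2 (fs n) - abs_l2 f) < \<epsilon>" by (auto simp: eventually_sequentially)
  then show "\<exists>w'. approximable w' \<and> norm (w' - abs_l2 f) < \<epsilon>" using assms(1) by blast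
qed

lemma approximable_test_function:
  assumes "test_function D \<psi>" "\<And>x. 0 \<le> \<psi> x"
  shows "approximable (L2_of D \<psi>)"
  unfolding approximable_def using assms by (intro allI impI exI[of _ \<psi>]) simp

lemma square_integrable_indicator_subset:
  assumes "A \<in> sets borel" "A \<subseteq> D"
  shows "square_integrable (indicator A)"
  using assms by (intro square_integrable_le[OF square_integrable_indicator]) (auto simp: indicator_def)

lemma approximable_open:
  assumes U: "open U" "U \<subseteq> D"
  shows "approximable (abs_l2 (indicator U))"
proof -
  obtain \<psi> :: "nat \<Rightarrow> real^2 \<Rightarrow> real" where \<psi>: "\<And>n. test_function U (\<psi> n)" "\<And>n x. 0 \<le> \<psi> n x"
      "\<And>n x. \<psi> n x \<le> 1" "\<And>x. (\<lambda>n. \<psi> n x) \<longlonglongrightarrow> indicator U x"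
    using open_indicator_approximation[OF U(1)] by metis
  have T: "test_function D (\<psi> n)" for n by (rule test_function_subset[OF \<psi>(1) U(2)])
  have eq: "(\<lambda>x. indicator D x * \<psi> n x) = \<psi> n" for n
    using test_function_outside[OF T] by (auto simp: fun_eq_iff indicator_def)
  have sq: "square_integrable (\<psi> n)" for n using C0_square_integrable[OF test_function_C0[OF T]] eq by simp
  have app: "approximable (abs_l2 (\<psi> n))" for n
    using approximable_test_function[OF T \<psi>(2)] unfolding L2_of_def eq .
  have bd: "\<bar>\<psi> n x - indicator U x\<bar> \<le> \<bar>indicator D x\<bar>" for n x
  proof (cases "x \<in> D")
    case True
    then show ?thesis using \<psi>(2)[of n x] \<psi>(3)[of n x] by (cases "x \<in> U") simp_all
  next
    case False
    then have "x \<notin> U" using U(2) by blast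
    then show ?thesis using test_function_outside[OF T False, of n] by simp
  qed
  have "square_integrable (indicator U)" using U by (intro square_integrable_indicator_subset) simp_all
  from approximable_sequence[OF app sq this square_integrable_indicator \<psi>(4) bd] show ?thesis .
qed

text \<open>Outer regularity gives an open superset with small excess, and the squared L2 distance
  of the two indicators is the measure of that excess within D.\<close>

lemma approximable_indicator:
  assumes A: "A \<in> sets borel" "A \<subseteq> D"
  shows "approximable (abs_l2 (indicator A))"
proof (rule approximable_limit)
  fix \<epsilon> :: real assume e: "0 < \<epsilon>"
  have e2: "0 < \<epsilon>\<^sup>2" using e by simp
  obtain U where U: "open U" "A \<subseteq> U" "emeasure lborel (U - A) < ennreal (\<epsilon>\<^sup>2)"
    by (rule outer_regular_lborel[OF A(1) e2])
  let ?U = "U \<inter> D"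
  have sqU: "square_integrable (indicator ?U)" and sqA: "square_integrable (indicator A)"
    using U A open_D by (auto intro!: square_integrable_indicator_subset)
  have "(norm (abs_l2 (indicator ?U) - abs_l2 (indicator A)))\<^sup>2 = (\<integral>x. (indicator ?U x - indicator A x)\<^sup>2 \<partial>lborel)"
    unfolding abs_l2_diff[OF sqU sqA] by (rule abs_l2_norm[OF square_integrable_diff[OF sqU sqA]])
  also have "\<dots> = (\<integral>x. indicator (?U - A) x \<partial>lborel)"
    using U(2) A(2) by (intro Bochner_Integration.integral_cong) (auto simp: indicator_def)
  also have "\<dots> = measure lborel (?U - A)" by simp
  also have "\<dots> < \<epsilon>\<^sup>2"
  proof -
    have "emeasure lborel (?U - A) \<le> emeasure lborel (U - A)"
      using U(1) A(1) by (intro emeasure_mono) auto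
    then have "emeasure lborel (?U - A) < ennreal (\<epsilon>\<^sup>2)" using U(3) by (rule le_less_trans)
    then show ?thesis unfolding measure_def using e2
      by (cases "emeasure lborel (?U - A)") (auto simp: ennreal_less_iff)
  qed
  finally have "norm (abs_l2 (indicator ?U) - abs_l2 (indicator A)) < \<epsilon>"
    using e by (simp add: power_less_imp_less_base)
  moreover have "approximable (abs_l2 (indicator ?U))" using U(1) open_D by (intro approximable_open) auto
  ultimately show "\<exists>w'. approximable w' \<and> norm (w' - abs_l2 (indicator A)) < \<epsilon>" by blast
qed

text \<open>The side conditions stand inside the induction statement because each summand, factor
  and monotone approximant must inherit them from the function it builds.\<close>

lemma approximable_nonneg_fun:
  assumes "u \<in> borel_measurable lborel" "\<And>x. 0 \<le> u x"
  shows "square_integrable u \<longrightarrow> (\<forall>x. x \<notin> D \<longrightarrow> u x = 0) \<longrightarrow> approximable (abs_l2 u)"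
  using assms
proof (induction u rule: borel_measurable_induct_real)
  case (set A)
  show ?case
  proof (intro impI)
    assume "\<forall>x. x \<notin> D \<longrightarrow> indicator A x = (0::real)"
    then have "A \<subseteq> D" by (meson indicator_eq_0_iff subsetI)
    then show "approximable (abs_l2 (indicator A))" using set by (intro approximable_indicator) simp_all
  qed
next
  case (mult u c)
  show ?case
  \<comment> \<open>For c = 0 the product says nothing about integrability or support of u, so the
    induction hypothesis is out of reach and the zero function is treated directly.\<close>
  proof (cases "c = 0")
    case True
    then show ?thesis
      using approximable_test_function[OF test_function_zero] unfolding L2_of_def by simp
  next
    case False
    show ?thesis
    proof (intro impI)
      assume sq: "square_integrable (\<lambda>x. c * u x)" and 0: "\<forall>x. x \<notin> D \<longrightarrow> c * u x = 0"
      have "(\<lambda>x. inverse c * (c * u x)) = u" using False by (simp add: fun_eq_iff)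
      then have squ: "square_integrable u" using square_integrable_scale[OF sq, of "inverse c"] by simp
      then have "approximable (abs_l2 u)" using mult 0 False by simp
      from approximable_lincomb[OF this this mult(1), of 0]
      show "approximable (abs_l2 (\<lambda>x. c * u x))" using abs_l2_scale[OF squ, of c] by simp
    qed
  qed
next
  case (add u v)
  show ?case
  proof (intro impI)
    assume sq: "square_integrable (\<lambda>x. v x + u x)" and 0: "\<forall>x. x \<notin> D \<longrightarrow> v x + u x = 0"
    have le: "0 \<le> u x" "0 \<le> v x" for x using add by auto
    have z: "u x = 0" "v x = 0" if "x \<notin> D" for x using 0 that le[of x] by (smt (verit))+
    have squ: "square_integrable u" "square_integrable v"
      using le add by (auto intro!: square_integrable_le[OF sq])
    have "approximable (abs_l2 u)" "approximable (abs_l2 v)" using add squ z by auto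
    from approximable_lincomb[OF this(2,1), of 1 1]
    show "approximable (abs_l2 (\<lambda>x. v x + u x))" using abs_l2_add[OF squ(2,1)] by simp
  qed
next
  case (seq U)
  show ?case
  proof (intro impI)
    assume sq: "square_integrable u" and 0: "\<forall>x. x \<notin> D \<longrightarrow> u x = 0"
    have lim: "(\<lambda>i. U i x) \<longlonglongrightarrow> u x" for x using seq by simp
    have le: "0 \<le> U i x" "U i x \<le> u x" for i x
    proof -
      show "0 \<le> U i x" using seq by simp
      have "incseq (\<lambda>i. U i x)" using seq by (simp add: incseq_def le_fun_def)
      then show "U i x \<le> u x" using lim by (rule incseq_le)
    qed
    have sqU: "square_integrable (U i)" for i
    proof (rule square_integrable_le[OF sq])
      show "U i \<in> borel_measurable lborel" using seq by simp
      show "\<bar>U i x\<bar> \<le> \<bar>u x\<bar>" for x using le[of i x] by linarith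
    qed
    have "U i x = 0" if "x \<notin> D" for i x using le[of i x] 0 that by force
    then have "approximable (abs_l2 (U i))" for i using seq sqU by blast
    then show "approximable (abs_l2 u)"
    proof (rule approximable_sequence[OF _ sqU sq sq lim])
      show "\<bar>U n x - u x\<bar> \<le> \<bar>u x\<bar>" for n x using le[of n x] by simp
    qed
  qed
qed

lemma approximable_nonneg:
  assumes "w \<in> L2_on D" "AE x in lborel. x \<in> D \<longrightarrow> 0 \<le> rep_l2 w x"
  shows "approximable w"
proof -
  define u where "u x = indicator D x * max 0 (rep_l2 w x)" for x
  have mu: "u \<in> borel_measurable lborel" unfolding u_def by measurable
  have sq: "square_integrable u"
    by (rule square_integrable_le[OF square_integrable_rep[of w] mu]) (auto simp: u_def indicator_def)
  have "AE x in lborel. x \<notin> D \<longrightarrow> rep_l2 w x = 0" using assms(1) unfolding L2_on_def by simp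
  then have "AE x in lborel. u x = rep_l2 w x"
    using assms(2) by eventually_elim (auto simp: u_def indicator_def)
  then have "abs_l2 u = w" using abs_l2_eqI[OF sq square_integrable_rep] abs_rep_l2 by metis
  moreover have "approximable (abs_l2 u)"
    using approximable_nonneg_fun[OF mu] sq by (auto simp: u_def)
  ultimately show ?thesis by simp
qed

end

context droplet
begin

text \<open>Nonnegative test functions tending to u* + v have volumes \<open>m n\<close> tending to
  V > 0, so rescaling by V / \<open>m n\<close> restores the volume, keeps the sign, and does not
  change the limit. The rescaled functions are test functions, where the energy has a
  subgradient.\<close>

lemma constraint_set_dense:
  assumes V: "0 < V" "(LINT x:D|lborel. ustar x) = V"
  shows "constraint_set D ustar \<subseteq> closure {v \<in> constraint_set D ustar. subgrad (X1 D) Ydom efun v \<noteq> {}}"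
proof
  fix v assume v: "v \<in> constraint_set D ustar"
  define w where "w = U0 + v"
  have U0: "U0 \<in> L2_on D"
    unfolding L2_on_def L2_of_def mem_Collect_eq using rep_abs_l2[OF C0_square_integrable[OF ustar_C0]]
    by eventually_elim simp
  have "U0 \<bullet> oneD = V"
  proof -
    have "U0 \<bullet> oneD = (\<integral>x. (indicator D x * ustar x) * indicator D x \<partial>lborel)"
      unfolding L2_of_def oneD_def by (intro abs_l2_inner C0_square_integrable ustar_C0 square_integrable_indicator)
    also have "\<dots> = (LINT x:D|lborel. ustar x)"
      unfolding set_lebesgue_integral_def by (intro Bochner_Integration.integral_cong) (auto simp: indicator_def)
    finally show ?thesis using V by simp
  qed
  have vX: "v \<in> L2_on D" "v \<bullet> oneD = 0" using v unfolding constraint_set_def X1_eq by auto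
  have wV: "w \<bullet> oneD = V" unfolding w_def using \<open>U0 \<bullet> oneD = V\<close> vX by (simp add: inner_add_left)
  have "w \<in> L2_on D" unfolding w_def using U0 vX subspace_L2_on by (simp add: subspace_add)
  moreover have "AE x in lborel. x \<in> D \<longrightarrow> 0 \<le> rep_l2 w x" using v unfolding constraint_set_def w_def by simp
  ultimately have app: "approximable w" by (rule approximable_nonneg)
  have "\<exists>\<psi>. test_function D \<psi> \<and> (\<forall>x. 0 \<le> \<psi> x) \<and> norm (L2_of D \<psi> - w) < inverse (real (Suc n))" for n
    using app unfolding approximable_def by simp
  then obtain \<psi> where \<psi>: "\<And>n. test_function D (\<psi> n)" "\<And>n x. 0 \<le> \<psi> n x"
    "\<And>n. norm (L2_of D (\<psi> n) - w) < inverse (real (Suc n))" by metis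
  have "(\<lambda>n. L2_of D (\<psi> n) - w) \<longlonglongrightarrow> 0"
    using \<psi>(3) by (intro Lim_null_comparison[OF _ LIMSEQ_inverse_real_of_nat]) (auto intro!: always_eventually less_imp_le)
  then have lim: "(\<lambda>n. L2_of D (\<psi> n)) \<longlonglongrightarrow> w" by (rule LIM_zero_cancel)
  define m where "m n = L2_of D (\<psi> n) \<bullet> oneD" for n
  have m: "m \<longlonglongrightarrow> V" unfolding m_def wV[symmetric] by (intro tendsto_intros lim)
  have mpos: "eventually (\<lambda>n. 0 < m n) sequentially" using order_tendstoD(1)[OF m V(1)] .
  define z where "z n = (V / m n) *\<^sub>R L2_of D (\<psi> n) - U0" for n
  have "z \<longlonglongrightarrow> (V / V) *\<^sub>R w - U0" unfolding z_def using V by (intro tendsto_intros m lim) auto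
  then have "z \<longlonglongrightarrow> v" using V unfolding w_def by simp
  moreover have "eventually (\<lambda>n. z n \<in> {v \<in> constraint_set D ustar. subgrad (X1 D) Ydom efun v \<noteq> {}}) sequentially"
    using mpos
  proof eventually_elim
    case (elim n)
    \<comment> \<open>The vacuous second summand brings a scalar multiple into the form of the
      lemmas on linear combinations.\<close>
    let ?\<phi> = "\<lambda>x. (V / m n) * \<psi> n x + 0 * \<psi> n x"
    have T: "test_function D ?\<phi>" by (intro test_function_lincomb \<psi>(1))
    have C0: "?\<phi> \<in> C0 D" by (rule test_function_C0[OF T])
    have eq: "L2_of D ?\<phi> = (V / m n) *\<^sub>R L2_of D (\<psi> n)"
      using L2_of_lincomb[OF test_function_C0[OF \<psi>(1)] test_function_C0[OF \<psi>(1)], of "V / m n" n 0 n] by simp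
    have zn: "z n = L2_of D ?\<phi> - U0" unfolding z_def eq ..
    have rep: "AE x in lborel. rep_l2 (L2_of D ?\<phi>) x = indicator D x * ?\<phi> x"
      unfolding L2_of_def by (rule rep_abs_l2[OF C0_square_integrable[OF C0]])
    have "L2_of D ?\<phi> \<in> L2_on D"
      unfolding L2_on_def mem_Collect_eq using rep by eventually_elim simp
    then have "z n \<in> L2_on D" unfolding zn using U0 subspace_L2_on by (simp add: subspace_diff)
    moreover have "z n \<bullet> oneD = 0"
      unfolding zn eq inner_diff_left inner_scaleR_left m_def[symmetric] \<open>U0 \<bullet> oneD = V\<close> using elim by simp
    ultimately have X: "z n \<in> X1 D" unfolding X1_eq by simp
    have "AE x in lborel. x \<in> D \<longrightarrow> 0 \<le> rep_l2 (U0 + z n) x"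
      unfolding zn using rep by (simp, eventually_elim) (use \<psi>(2) elim V in simp)
    then have "z n \<in> constraint_set D ustar" unfolding constraint_set_def using X by simp
    moreover have "subgrad (X1 D) Ydom efun (z n) \<noteq> {}"
    proof -
      obtain C G H where "C \<subseteq> D" "C1_compact C ?\<phi> G" "\<forall>i\<in>Basis. C1_compact C (\<lambda>x. G x \<bullet> i) (H i)"
        using T unfolding test_function_def by blast
      then show ?thesis unfolding zn using X[unfolded zn] by (intro test_function_in_domain) auto
    qed
    ultimately show ?case by blast
  qed
  then have "eventually (\<lambda>n. z n \<in> closure {v \<in> constraint_set D ustar. subgrad (X1 D) Ydom efun v \<noteq> {}}) sequentially"
    by (rule eventually_mono) (rule subsetD[OF closure_subset])
  ultimately show "v \<in> closure {v \<in> constraint_set D ustar. subgrad (X1 D) Ydom efun v \<noteq> {}}"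
    by (intro Lim_in_closed_set[OF closed_closure _ sequentially_bot])
qed

end

section \<open>Convergence of the projection method\<close>

theorem theorem3p3:
  fixes D :: "(real^2) set"
    and V \<gamma>LG \<rho> g \<zeta> T :: real
    and ustar :: "real^2 \<Rightarrow> real"
    and v0 u0 :: l2
    and S :: "real \<Rightarrow> l2 \<Rightarrow> l2"
    and u :: "real \<Rightarrow> l2"
  assumes "open D" and "connected D" and "D \<noteq> {}"
    and "emeasure lborel D < \<infinity>"
    and "C1_boundary D"
    and "0 < V" and "0 < \<gamma>LG" and "0 < \<rho>" and "0 < g" and "0 < \<zeta>"
    and "ustar \<in> C0 D" and "C2_on D ustar"
    and "\<forall>x\<in>D. 0 \<le> ustar x" and "(LINT x:D|lborel. ustar x) = V"
    and "v0 \<in> constraint_set D ustar"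
    and "u0 = L2_of D ustar + v0"
    and "0 < T"
    and "generates_semigroup (op_sum (grad_E D \<gamma>LG \<rho> g ustar) (sub_IK D ustar)) S"
    and "\<forall>t\<in>{0..T}. u t = L2_of D ustar + S t v0"
  shows "((\<lambda>\<tau>. SUP t\<in>{0..T}. ereal (norm (ubar D \<gamma>LG \<rho> g ustar u0 \<tau> t - u t))) \<longlongrightarrow> 0)
           (at_right 0)"
proof -
  interpret droplet D \<gamma>LG \<rho> g ustar
    using assms by unfold_locales auto
  let ?K = "constraint_set D ustar"
  \<comment> \<open>Besides reaching all initial data in K, density provides a point of K with
    finite energy, which makes the effective domains of E, of I_K and of their sum nonempty.\<close>
  have dense: "?K \<subseteq> closure {v \<in> ?K. subgrad (X1 D) Ydom efun v \<noteq> {}}"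
    by (rule constraint_set_dense[OF \<open>0 < V\<close> \<open>(LINT x:D|lborel. ustar x) = V\<close>])
  then have "{v \<in> ?K. subgrad (X1 D) Ydom efun v \<noteq> {}} \<noteq> {}"
    using \<open>v0 \<in> ?K\<close> by (metis closure_empty empty_iff subsetD)
  then have meet: "Ydom \<inter> ?K \<noteq> {}" unfolding subgrad_def by blast
  have "closed_convex_fun (X1 D) Ydom efun" using meet by (intro closed_convex_fun_energy) blast
  moreover have "closed_convex_fun (X1 D) ?K (\<lambda>_. 0)" using meet by (intro closed_convex_fun_constraint) blast
  ultimately interpret P: splitting "X1 D" Ydom ?K efun
    using meet by (intro splitting.intro splitting_axioms.intro)
  have S: "generates_semigroup P.Cop S"
    using assms(18) unfolding P.Cop_def grad_E_eq sub_IK_eq .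
  \<comment> \<open>The shifts by u* between the two resolvents cancel, so iterating on u is
    iterating F on v.\<close>
  have step: "(JB D ustar \<tau> \<circ> JA D \<gamma>LG \<rho> g ustar \<tau>) (U0 + v) = U0 + P.F \<tau> v" for \<tau> v
    unfolding JA_def JB_def shifted_def grad_E_eq sub_IK_eq P.F_def by simp
  have "((JB D ustar \<tau> \<circ> JA D \<gamma>LG \<rho> g ustar \<tau>) ^^ n) (U0 + v0) = U0 + (P.F \<tau> ^^ n) v0" for \<tau> n
  proof (induction n)
    case (Suc n)
    then show ?case using step[of \<tau> "(P.F \<tau> ^^ n) v0"] by simp
  qed simp
  then have ubar: "ubar D \<gamma>LG \<rho> g ustar u0 \<tau> t = U0 + (P.F \<tau> ^^ nat \<lfloor>t / \<tau>\<rfloor>) v0" for \<tau> t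
    unfolding ubar_def \<open>u0 = U0 + v0\<close> .
  let ?err = "\<lambda>\<tau>. SUP t\<in>{0..T}. ereal (norm (ubar D \<gamma>LG \<rho> g ustar u0 \<tau> t - u t))"
  have err: "norm (ubar D \<gamma>LG \<rho> g ustar u0 \<tau> t - u t) = norm ((P.F \<tau> ^^ nat \<lfloor>t / \<tau>\<rfloor>) v0 - S t v0)"
    if "t \<in> {0..T}" for \<tau> t
  proof -
    have "u t = U0 + S t v0" using assms(19) that by blast
    then show ?thesis unfolding ubar by simp
  qed
  show ?thesis
  proof (rule order_tendstoI)
    fix a :: ereal assume a: "a < 0"
    \<comment> \<open>The index set contains 0, so the supremum in \<open>ereal\<close> is taken
      over a nonempty family of norms.\<close>
    have "0 \<le> ?err \<tau>" for \<tau>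
      using \<open>0 < T\<close> by (intro SUP_upper2[of 0]) auto
    then show "eventually (\<lambda>\<tau>. a < ?err \<tau>) (at_right 0)"
      using a by (intro always_eventually allI) (rule less_le_trans)
  next
    fix a :: ereal assume "0 < a"
    then obtain \<epsilon> where e: "0 < ereal \<epsilon>" "ereal \<epsilon> < a" using ereal_dense2 by blast
    have "eventually (\<lambda>\<tau>. \<forall>t\<in>{0..T}. norm ((P.F \<tau> ^^ nat \<lfloor>t / \<tau>\<rfloor>) v0 - S t v0) \<le> \<epsilon>) (at_right 0)"
      using e(1) by (intro P.product_formula[OF S dense \<open>v0 \<in> ?K\<close> \<open>0 < T\<close>]) simp
    then show "eventually (\<lambda>\<tau>. ?err \<tau> < a) (at_right 0)"
    proof eventually_elim
      case (elim \<tau>)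
      have "?err \<tau> \<le> ereal \<epsilon>"
      proof (rule SUP_least)
        fix t assume t: "t \<in> {0..T}"
        then show "ereal (norm (ubar D \<gamma>LG \<rho> g ustar u0 \<tau> t - u t)) \<le> ereal \<epsilon>"
          unfolding err[OF t] using elim by simp
      qed
      then show ?case using e(2) by (rule le_less_trans)
    qed
  qed
qed

end
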